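(* Let $n\geq3$. Let $p\in C^\infty(\mathbb{R}^n\setminus\{0\})$ be a positive function satisfying $p(\lambda\xi)=\lambda p(\xi)$ for all $\lambda>0$ and $\xi\in\mathbb{R}^n\setminus\{0\}$. Assume that the hypersurface $\Sigma=\{\xi:\ p(\xi)=1\}$ has non-vanishing Gaussian curvature. Then the solution $u(t,x)$ to the equation \[ \begin{cases}(i\partial_t+L_p)u(t,x)=0,\\ u(0,x)=f(x),\end{cases}\qquad L_p=p(D_x)^2, \] has the estimate \[ \left\|\langle x\rangle^{-1}\langle D\rangle^{1/2}u\right\|_{L^2(\mathbb{R}_t\times\mathbb{R}^n_x)}\leq C\|f\|_{L^2(\mathbb{R}^n_x)}, \] with a constant $C>0$ independent of $f$.
   Context: Let $F_x$ be the Fourier transform on $\mathbb{R}^n$ and $F_\xi^{-1}$ its inverse. For a function $a(\xi)$, $a(D)=F_\xi^{-1}a(\xi)F_x$ is the Fourier multiplier with symbol $a$ (acting in the $x$ variable); in particular $L_p=p(D_x)^2=F_\xi^{-1}p(\xi)^2F_x$ and $\langle D\rangle^{1/2}$ has symbol $(1+|\xi|^2)^{1/4}$. Also $\langle x\rangle^{-1}=(1+|x|^2)^{-1/2}$. The solution is the one given by $u(t,\cdot)=e^{itL_p}f$. *)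

theory Defs
  imports "HOL-Analysis.Analysis"
begin

primrec Ck_on :: "nat \<Rightarrow> 'a::real_normed_vector set \<Rightarrow> ('a \<Rightarrow> 'b::real_normed_vector) \<Rightarrow> bool" where
  "Ck_on 0 S f \<longleftrightarrow> continuous_on S f"
| "Ck_on (Suc k) S f \<longleftrightarrow>
     (\<forall>x\<in>S. f differentiable (at x)) \<and>
     (\<forall>v. Ck_on k S (\<lambda>x. frechet_derivative f (at x) v))"

text \<open>Intended for open \<open>S\<close> only: the derivatives are taken at \<open>at x\<close>, not within \<open>S\<close>.\<close>

definition smooth_on :: "'a::real_normed_vector set \<Rightarrow> ('a \<Rightarrow> 'b::real_normed_vector) \<Rightarrow> bool" where
  "smooth_on S f \<longleftrightarrow> (\<forall>k. Ck_on k S f)"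

definition test_function :: "('a::euclidean_space \<Rightarrow> complex) \<Rightarrow> bool" where
  "test_function \<phi> \<longleftrightarrow> smooth_on UNIV \<phi> \<and> compact (closure {x. \<phi> x \<noteq> 0})"

definition grad :: "('a::euclidean_space \<Rightarrow> real) \<Rightarrow> 'a \<Rightarrow> 'a" where
  "grad p x = (\<Sum>b\<in>Basis. frechet_derivative p (at x) b *\<^sub>R b)"

definition unit_normal :: "('a::euclidean_space \<Rightarrow> real) \<Rightarrow> 'a \<Rightarrow> 'a" where
  "unit_normal p x = grad p x /\<^sub>R norm (grad p x)"

definition tangent_space :: "('a::euclidean_space \<Rightarrow> real) \<Rightarrow> 'a \<Rightarrow> 'a set" where
  "tangent_space p x = {v. grad p x \<bullet> v = 0}"

text \<open>
  Determinant of a linear endomorphism \<open>A\<close> of a subspace \<open>V\<close>: the Leibniz formula for the matrix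
  of \<open>A\<close> in an orthonormal basis of \<open>V\<close>. The value does not depend on the basis chosen.
\<close>

definition subspace_det :: "'a::euclidean_space set \<Rightarrow> ('a \<Rightarrow> 'a) \<Rightarrow> real" where
  "subspace_det V A =
     (let B = (SOME B. B \<subseteq> V \<and> pairwise orthogonal B \<and> (\<forall>b\<in>B. norm b = 1) \<and> span B = V)
      in \<Sum>\<sigma> | \<sigma> permutes B. of_int (sign \<sigma>) * (\<Prod>b\<in>B. b \<bullet> A (\<sigma> b)))"

text \<open>
  The Gaussian curvature at \<open>x\<close> of the level set of \<open>p\<close> through \<open>x\<close> (where \<open>grad p x \<noteq> 0\<close>), oriented
  by \<open>unit_normal p\<close>: the determinant of the Weingarten map, i.e. of the differential of the unit
  normal field acting on the tangent space. The sign convention for the Weingarten map can change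
  the curvature only by a sign.
\<close>

definition gaussian_curvature :: "('a::euclidean_space \<Rightarrow> real) \<Rightarrow> 'a \<Rightarrow> real" where
  "gaussian_curvature p x =
     subspace_det (tangent_space p x) (frechet_derivative (unit_normal p) (at x))"

definition in_L2 :: "'a measure \<Rightarrow> ('a \<Rightarrow> complex) \<Rightarrow> bool" where
  "in_L2 M f \<longleftrightarrow> f \<in> borel_measurable M \<and> integrable M (\<lambda>x. (norm (f x))\<^sup>2)"

definition L2_norm :: "'a measure \<Rightarrow> ('a \<Rightarrow> complex) \<Rightarrow> real" where
  "L2_norm M f = sqrt (LINT x|M. (norm (f x))\<^sup>2)"

definition fourier_integral :: "('a::euclidean_space \<Rightarrow> complex) \<Rightarrow> 'a \<Rightarrow> complex" where
  "fourier_integral f \<xi> = (LINT x|lborel. cis (- (x \<bullet> \<xi>)) * f x)"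

definition inv_fourier_integral :: "('a::euclidean_space \<Rightarrow> complex) \<Rightarrow> 'a \<Rightarrow> complex" where
  "inv_fourier_integral g x =
     of_real (1 / (2 * pi) ^ DIM('a)) * (LINT \<xi>|lborel. cis (x \<bullet> \<xi>) * g \<xi>)"

text \<open>
  On square integrable functions the Fourier transform and its inverse are the \<open>L\<^sup>2\<close>-limits, as
  \<open>R \<rightarrow> \<infinity>\<close>, of the integrals over the balls of radius \<open>R\<close>. The limit is determined only up to a
  null set, and \<open>L2_lim\<close> picks a representative. The convergence is phrased with the nonnegative
  integral, which is \<open>\<infinity>\<close> if the difference is not square integrable.
\<close>

definition L2_lim :: "(real \<Rightarrow> 'a::euclidean_space \<Rightarrow> complex) \<Rightarrow> 'a \<Rightarrow> complex" where
  "L2_lim F = (SOME g. in_L2 lborel g \<and>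
     ((\<lambda>R. \<integral>\<^sup>+ x. ennreal ((norm (F R x - g x))\<^sup>2) \<partial>lborel) \<longlongrightarrow> 0) at_top)"

definition fourier_L2 :: "('a::euclidean_space \<Rightarrow> complex) \<Rightarrow> 'a \<Rightarrow> complex" where
  "fourier_L2 f = L2_lim (\<lambda>R. fourier_integral (\<lambda>x. indicator (cball 0 R) x *\<^sub>R f x))"

definition inv_fourier_L2 :: "('a::euclidean_space \<Rightarrow> complex) \<Rightarrow> 'a \<Rightarrow> complex" where
  "inv_fourier_L2 g = L2_lim (\<lambda>R. inv_fourier_integral (\<lambda>\<xi>. indicator (cball 0 R) \<xi> *\<^sub>R g \<xi>))"

text \<open>For symbols \<open>a\<close> and \<open>f\<close> in \<open>L\<^sup>2\<close> such that \<open>a\<close> times the transform of \<open>f\<close> is in \<open>L\<^sup>2\<close>.\<close>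

definition multiplier :: "('a::euclidean_space \<Rightarrow> complex) \<Rightarrow> ('a \<Rightarrow> complex) \<Rightarrow> 'a \<Rightarrow> complex" where
  "multiplier a f = inv_fourier_L2 (\<lambda>\<xi>. a \<xi> * fourier_L2 f \<xi>)"

text \<open>
  For an unbounded symbol of polynomial growth, such as that of \<open>\<langle>D\<rangle>\<^sup>1\<^sup>/\<^sup>2\<close>, and a general \<open>f\<close> in
  \<open>L\<^sup>2\<close>, \<open>a(D) f\<close> is a distribution; it acts on test functions through the duality
  \<open>\<langle>F\<^sup>-\<^sup>1 g, \<phi>\<rangle> = \<langle>g, F\<^sup>-\<^sup>1 \<phi>\<rangle>\<close> (bilinear pairing, no complex conjugation).
\<close>

definition multiplier_distr ::
    "('a::euclidean_space \<Rightarrow> complex) \<Rightarrow> ('a \<Rightarrow> complex) \<Rightarrow> ('a \<Rightarrow> complex) \<Rightarrow> complex" where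
  "multiplier_distr a f \<phi> =
     (LINT \<xi>|lborel. a \<xi> * fourier_L2 f \<xi> * inv_fourier_integral \<phi> \<xi>)"

text \<open>The distribution \<open>T\<close> is (given by) the locally integrable function \<open>v\<close>.\<close>

definition is_function_distr ::
    "(('a::euclidean_space \<Rightarrow> complex) \<Rightarrow> complex) \<Rightarrow> ('a \<Rightarrow> complex) \<Rightarrow> bool" where
  "is_function_distr T v \<longleftrightarrow>
     (\<forall>K. compact K \<longrightarrow> set_integrable lborel K v) \<and>
     (\<forall>\<phi>. test_function \<phi> \<longrightarrow> T \<phi> = (LINT x|lborel. v x * \<phi> x))"

definition japanese :: "'a::real_normed_vector \<Rightarrow> real" where
  "japanese x = sqrt (1 + (norm x)\<^sup>2)"

text \<open>\<open>\<langle>D\<rangle>\<^sup>1\<^sup>/\<^sup>2 f\<close> as a distribution\<close>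

definition half_deriv :: "('a::euclidean_space \<Rightarrow> complex) \<Rightarrow> ('a \<Rightarrow> complex) \<Rightarrow> complex" where
  "half_deriv = multiplier_distr (\<lambda>\<xi>. of_real (japanese \<xi> powr (1/2)))"

text \<open>\<open>exp (i t L\<^sub>p) f\<close>, where \<open>L\<^sub>p\<close> has the symbol \<open>p(\<xi>)\<^sup>2\<close>\<close>

definition evolution ::
    "('a::euclidean_space \<Rightarrow> real) \<Rightarrow> real \<Rightarrow> ('a \<Rightarrow> complex) \<Rightarrow> 'a \<Rightarrow> complex" where
  "evolution p t f = multiplier (\<lambda>\<xi>. exp (\<i> * of_real (t * (p \<xi>)\<^sup>2))) f"

end

theory Submission
  imports Defs "HOL-Probability.Characteristic_Functions"
begin

text \<open>
  On the Fourier side the half derivative of the solution is, up to a constant,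
  \<open>\<integral> exp (i (t p(\<xi>)\<^sup>2 + x \<bullet> \<xi>)) H(\<xi>) d\<xi>\<close> with \<open>H = \<langle>\<xi>\<rangle>\<^sup>1\<^sup>/\<^sup>2 F f\<close>. Squaring it and integrating over
  \<open>t\<close> and over \<open>x\<close> with the weight \<open>\<langle>x\<rangle>\<^sup>-\<^sup>2\<close> removes the oscillation and leaves a quadratic form in \<open>H\<close> with the
  nonnegative kernel \<open>k(\<xi> - \<xi>') \<delta>(p(\<xi>)\<^sup>2 - p(\<xi>')\<^sup>2)\<close>, where \<open>k\<close> is the Fourier transform of the weight
  (\<open>weighted_TTstar_bound\<close>). By Schur's test (\<open>schur_test\<close>) the estimate follows once
  \<open>\<langle>\<xi>\<rangle> \<integral> k(\<xi> - \<xi>') \<delta>(p(\<xi>)\<^sup>2 - p(\<xi>')\<^sup>2) d\<xi>'\<close> is bounded uniformly in \<open>\<xi>\<close>, and this is a statement about sizes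
  only. It holds since \<open>k(\<zeta>)\<close> behaves like \<open>\<bar>\<zeta>\<bar>\<^sup>2\<^sup>-\<^sup>n\<close> near the origin, decays exponentially, and is integrated over
  the level set \<open>p = r\<close>, a set of dimension \<open>n - 1\<close>: the integral over the level set is \<open>O(1)\<close> for large \<open>r\<close> and, by scaling,
  \<open>O(r)\<close> for small \<open>r\<close>, while \<open>\<delta>(p\<^sup>2 - r\<^sup>2)\<close> contributes the factor \<open>1 / (2 r)\<close> (\<open>kernel_bound\<close>).

  The argument is carried out with Gaussians. The weight is the superposition
  \<open>\<langle>x\<rangle>\<^sup>-\<^sup>2 = \<integral> 2 w exp (- w\<^sup>2 (1 + \<bar>x\<bar>\<^sup>2)) dw\<close> over \<open>w > 0\<close>, and \<open>\<delta>\<close> is the limit of the Gaussians that come from a time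
  cutoff \<open>exp (- \<epsilon> t\<^sup>2)\<close>. Surface integrals are replaced by volume integrals over the shell \<open>1 \<le> p \<le> 2\<close>:
  \<open>polar_inequality\<close> expresses polar coordinates adapted to \<open>p\<close> through it, and \<open>shell_gaussian_bound\<close> says
  that the projection of the shell along rays to \<open>p = 1\<close> has the growth of a measure of dimension \<open>n - 1\<close>.

  It remains to pass from frequency-truncated data, for which all integrals converge absolutely, to general
  \<open>f\<close> in \<open>L\<^sup>2\<close>. The same \<open>T T\<^sup>*\<close> argument gives the Plancherel inequality, hence the existence of the \<open>L\<^sup>2\<close> Fourier
  transform and its inverse, and Fourier inversion identifies the transform of the evolution. The weighted truncated
  solutions converge in space-time \<open>L\<^sup>2\<close> by the estimate itself; pairing with test functions, whose transforms decay
  enough by \<open>test_function_fourier_weighted\<close>, shows that for almost every \<open>t\<close> the limit is the distribution in question.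
\<close>

section \<open>Square integrable functions\<close>

definition nn_L2 :: "'a measure \<Rightarrow> ('a \<Rightarrow> complex) \<Rightarrow> ennreal" where
  "nn_L2 M f = (\<integral>\<^sup>+x. ennreal ((norm (f x))\<^sup>2) \<partial>M)"

lemma in_L2_iff: "in_L2 M f \<longleftrightarrow> f \<in> borel_measurable M \<and> nn_L2 M f < \<infinity>"
proof -
  have "integrable M (\<lambda>x. (norm (f x))\<^sup>2) \<longleftrightarrow> nn_L2 M f < \<infinity>" if [measurable]: "f \<in> borel_measurable M"
    unfolding nn_L2_def by (subst integrable_iff_bounded) auto
  then show ?thesis unfolding in_L2_def by blast
qed

lemma in_L2_measurable [measurable_dest]: "in_L2 M f \<Longrightarrow> f \<in> borel_measurable M"
  by (simp add: in_L2_def)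

lemma L2_norm_eq: "in_L2 M f \<Longrightarrow> ennreal ((L2_norm M f)\<^sup>2) = nn_L2 M f"
  unfolding in_L2_def L2_norm_def nn_L2_def
  by (subst nn_integral_eq_integral) auto

lemma nn_L2_mono:
  assumes "\<And>x. x \<in> space M \<Longrightarrow> norm (f x) \<le> norm (g x)"
  shows "nn_L2 M f \<le> nn_L2 M g"
  unfolding nn_L2_def by (intro nn_integral_mono ennreal_leI power_mono assms) auto

lemma nn_L2_cong_AE: "AE x in M. f x = g x \<Longrightarrow> nn_L2 M f = nn_L2 M g"
  unfolding nn_L2_def by (intro nn_integral_cong_AE) auto

lemma nn_L2_cmult:
  assumes [measurable]: "f \<in> borel_measurable M"
  shows "nn_L2 M (\<lambda>x. c * f x) = ennreal ((norm c)\<^sup>2) * nn_L2 M f"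
  unfolding nn_L2_def norm_mult power_mult_distrib
  by (subst nn_integral_cmult[symmetric]) (auto simp: ennreal_mult)

lemma nn_L2_add_le:
  assumes [measurable]: "f \<in> borel_measurable M" "g \<in> borel_measurable M"
  shows "nn_L2 M (\<lambda>x. f x + g x) \<le> 2 * nn_L2 M f + 2 * nn_L2 M g"
proof -
  have "(norm (a + b))\<^sup>2 \<le> 2 * (norm a)\<^sup>2 + 2 * (norm b)\<^sup>2" for a b :: complex
  proof -
    have "(norm (a + b))\<^sup>2 \<le> (norm a + norm b)\<^sup>2"
      by (intro power_mono norm_triangle_ineq) auto
    also have "\<dots> \<le> 2 * (norm a)\<^sup>2 + 2 * (norm b)\<^sup>2"
      using zero_le_power2[of "norm a - norm b"] by (simp add: power2_eq_square algebra_simps)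
    finally show ?thesis .
  qed
  then have "ennreal ((norm (f x + g x))\<^sup>2) \<le> 2 * ennreal ((norm (f x))\<^sup>2) + 2 * ennreal ((norm (g x))\<^sup>2)" for x
    by (subst (asm) ennreal_le_iff[symmetric]) (auto simp: ennreal_mult)
  then have "nn_L2 M (\<lambda>x. f x + g x) \<le> (\<integral>\<^sup>+x. 2 * ennreal ((norm (f x))\<^sup>2) + 2 * ennreal ((norm (g x))\<^sup>2) \<partial>M)"
    unfolding nn_L2_def by (intro nn_integral_mono)
  then show ?thesis
    unfolding nn_L2_def by (simp add: nn_integral_add nn_integral_cmult)
qed

lemma nn_L2_uminus: "nn_L2 M (\<lambda>x. f x - g x) = nn_L2 M (\<lambda>x. g x - f x)"
  unfolding nn_L2_def by (simp add: norm_minus_commute)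

lemma nn_L2_triangle:
  assumes [measurable]: "f \<in> borel_measurable M" "g \<in> borel_measurable M" "h \<in> borel_measurable M"
  shows "nn_L2 M (\<lambda>x. f x - h x) \<le> 2 * nn_L2 M (\<lambda>x. f x - g x) + 2 * nn_L2 M (\<lambda>x. g x - h x)"
  using nn_L2_add_le[of "\<lambda>x. f x - g x" M "\<lambda>x. g x - h x"] by simp

lemma nn_L2_le_diff:
  assumes [measurable]: "f \<in> borel_measurable M" "g \<in> borel_measurable M"
  shows "nn_L2 M f \<le> 2 * nn_L2 M g + 2 * nn_L2 M (\<lambda>x. f x - g x)"
  using nn_L2_add_le[of g M "\<lambda>x. f x - g x"] by simp

lemma nn_L2_eq_0:
  assumes [measurable]: "f \<in> borel_measurable M" and "nn_L2 M f = 0"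
  shows "AE x in M. f x = 0"
  using assms(2) unfolding nn_L2_def by (subst (asm) nn_integral_0_iff_AE) auto

lemma in_L2_diff:
  assumes "in_L2 M f" "in_L2 M g"
  shows "in_L2 M (\<lambda>x. f x - g x)"
proof -
  note [measurable] = assms[THEN in_L2_measurable]
  have "nn_L2 M (\<lambda>x. f x - g x) \<le> 2 * nn_L2 M f + 2 * nn_L2 M (\<lambda>x. - g x)"
    using nn_L2_add_le[of f M "\<lambda>x. - g x"] by simp
  also have "nn_L2 M (\<lambda>x. - g x) = nn_L2 M g" by (simp add: nn_L2_def)
  also have "2 * nn_L2 M f + 2 * nn_L2 M g < \<infinity>" using assms by (simp add: in_L2_iff ennreal_mult_less_top)
  finally show ?thesis by (simp add: in_L2_iff)
qed

lemma L2_limit_unique: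
  assumes [measurable]: "\<And>k. F k \<in> borel_measurable M" "f \<in> borel_measurable M" "g \<in> borel_measurable M"
    and f: "((\<lambda>k. nn_L2 M (\<lambda>x. F k x - f x)) \<longlongrightarrow> 0) A"
    and g: "((\<lambda>k. nn_L2 M (\<lambda>x. F k x - g x)) \<longlongrightarrow> 0) A" and "A \<noteq> bot"
  shows "AE x in M. f x = g x"
proof -
  have "((\<lambda>k. 2 * nn_L2 M (\<lambda>x. F k x - f x) + 2 * nn_L2 M (\<lambda>x. F k x - g x)) \<longlongrightarrow> 2 * 0 + 2 * 0) A"
    by (intro tendsto_add ennreal_tendsto_cmult f g) auto
  moreover have "nn_L2 M (\<lambda>x. f x - g x) \<le> 2 * nn_L2 M (\<lambda>x. F k x - f x) + 2 * nn_L2 M (\<lambda>x. F k x - g x)" for k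
    using nn_L2_triangle[of f M "F k" g] by (simp add: nn_L2_uminus[of M f "F k"])
  ultimately have "nn_L2 M (\<lambda>x. f x - g x) \<le> 2 * 0 + 2 * 0"
    by (intro tendsto_lowerbound[OF _ _ \<open>A \<noteq> bot\<close>]) auto
  then show ?thesis using nn_L2_eq_0[of "\<lambda>x. f x - g x" M] by auto
qed

lemma norm_integral_mult_le:
  assumes [measurable]: "f \<in> borel_measurable M" "w \<in> borel_measurable M"
  shows "(ennreal (norm (LINT x|M. f x * w x)))\<^sup>2 \<le> nn_L2 M f * nn_L2 M w"
proof -
  have "ennreal (norm (LINT x|M. f x * w x)) \<le> (\<integral>\<^sup>+x. ennreal (norm (f x * w x)) \<partial>M)"
    by (cases "integrable M (\<lambda>x. f x * w x)")
       (auto intro: integral_norm_bound_ennreal simp: not_integrable_integral_eq)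
  also have "\<dots> = (\<integral>\<^sup>+x. ennreal (norm (f x)) * ennreal (norm (w x)) \<partial>M)"
    by (simp add: norm_mult ennreal_mult)
  finally have "(ennreal (norm (LINT x|M. f x * w x)))\<^sup>2 \<le> (\<integral>\<^sup>+x. ennreal (norm (f x)) * ennreal (norm (w x)) \<partial>M)\<^sup>2"
    by (intro power_mono) auto
  also have "\<dots> \<le> (\<integral>\<^sup>+x. (ennreal (norm (f x)))\<^sup>2 \<partial>M) * (\<integral>\<^sup>+x. (ennreal (norm (w x)))\<^sup>2 \<partial>M)"
    by (intro Cauchy_Schwarz_nn_integral) auto
  finally show ?thesis by (simp add: nn_L2_def ennreal_power)
qed

lemma L2_mult_integrable:
  assumes "in_L2 M f" "in_L2 M w"
  shows "integrable M (\<lambda>x. f x * w x)"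
proof -
  have [measurable]: "f \<in> borel_measurable M" "w \<in> borel_measurable M"
    and i: "integrable M (\<lambda>x. (norm (f x))\<^sup>2)" "integrable M (\<lambda>x. (norm (w x))\<^sup>2)"
    using assms by (auto simp: in_L2_def)
  have "norm (f x * w x) \<le> norm ((norm (f x))\<^sup>2 + (norm (w x))\<^sup>2)" for x
  proof -
    have "norm (f x) * norm (w x) \<le> 2 * norm (f x) * norm (w x)" by (simp add: mult_le_cancel_right2)
    also have "\<dots> \<le> (norm (f x))\<^sup>2 + (norm (w x))\<^sup>2" by (rule sum_squares_bound)
    finally show ?thesis by (simp add: norm_mult)
  qed
  then show ?thesis
    by (intro Bochner_Integration.integrable_bound[OF Bochner_Integration.integrable_add[OF i]]) auto
qed

lemma tendsto_zero_ennreal_power2: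
  fixes u :: "'a \<Rightarrow> real"
  assumes "((\<lambda>k. (ennreal (norm (u k)))\<^sup>2) \<longlongrightarrow> 0) A"
  shows "(u \<longlongrightarrow> 0) A"
proof -
  have "((\<lambda>k. ennreal ((norm (u k))\<^sup>2)) \<longlongrightarrow> ennreal 0) A" using assms by (simp add: ennreal_power)
  then have "((\<lambda>k. (norm (u k))\<^sup>2) \<longlongrightarrow> 0) A"
    by (subst (asm) tendsto_ennreal_iff) auto
  then have "((\<lambda>k. sqrt ((norm (u k))\<^sup>2)) \<longlongrightarrow> sqrt 0) A" by (intro tendsto_real_sqrt)
  then show ?thesis by (simp add: tendsto_rabs_zero_iff)
qed

lemma L2_pairing_tendsto:
  assumes F: "\<And>k. in_L2 M (F k)" and f: "in_L2 M f" and w: "in_L2 M w"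
    and lim: "((\<lambda>k. nn_L2 M (\<lambda>x. F k x - f x)) \<longlongrightarrow> 0) A"
  shows "((\<lambda>k. LINT x|M. F k x * w x) \<longlongrightarrow> (LINT x|M. f x * w x)) A"
proof -
  note [measurable] = F[THEN in_L2_measurable] f[THEN in_L2_measurable] w[THEN in_L2_measurable]
  have eq: "(LINT x|M. F k x * w x) - (LINT x|M. f x * w x) = (LINT x|M. (F k x - f x) * w x)" for k
    by (simp add: left_diff_distrib L2_mult_integrable[OF F w] L2_mult_integrable[OF f w])
  have "((\<lambda>k. nn_L2 M w * nn_L2 M (\<lambda>x. F k x - f x)) \<longlongrightarrow> nn_L2 M w * 0) A"
    using w by (intro ennreal_tendsto_cmult lim) (auto simp: in_L2_iff)
  then have l0: "((\<lambda>k. nn_L2 M w * nn_L2 M (\<lambda>x. F k x - f x)) \<longlongrightarrow> 0) A" by simp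
  have "((\<lambda>k. (ennreal (norm (norm ((LINT x|M. F k x * w x) - (LINT x|M. f x * w x)))))\<^sup>2) \<longlongrightarrow> 0) A"
  proof (rule tendsto_sandwich[OF _ _ tendsto_const l0])
    show "\<forall>\<^sub>F k in A. (ennreal (norm (norm ((LINT x|M. F k x * w x) - (LINT x|M. f x * w x)))))\<^sup>2
        \<le> nn_L2 M w * nn_L2 M (\<lambda>x. F k x - f x)"
    proof (intro always_eventually allI)
      fix k
      show "(ennreal (norm (norm ((LINT x|M. F k x * w x) - (LINT x|M. f x * w x)))))\<^sup>2
        \<le> nn_L2 M w * nn_L2 M (\<lambda>x. F k x - f x)"
        unfolding eq using norm_integral_mult_le[of "\<lambda>x. F k x - f x" M w] by (simp add: mult.commute)
    qed
  qed auto
  then have "((\<lambda>k. norm ((LINT x|M. F k x * w x) - (LINT x|M. f x * w x))) \<longlongrightarrow> 0) A"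
    by (rule tendsto_zero_ennreal_power2)
  then show ?thesis by (simp add: tendsto_norm_zero_iff LIM_zero_cancel)
qed

text \<open>Riesz--Fischer. Along a subsequence whose consecutive distances squared are at most
  \<open>8\<^sup>-\<^sup>k\<close>, the weighted sum of the squares of the increments (weights \<open>2\<^sup>k\<close>) is integrable,
  so that almost everywhere the increments are dominated by a geometric sequence.\<close>

lemma L2_complete:
  fixes F :: "nat \<Rightarrow> 'a \<Rightarrow> complex"
  assumes [measurable]: "\<And>k. F k \<in> borel_measurable M"
    and cauchy: "\<And>e. e > 0 \<Longrightarrow> \<exists>N. \<forall>m\<ge>N. \<forall>n\<ge>N. nn_L2 M (\<lambda>x. F m x - F n x) \<le> ennreal e"
  shows "\<exists>g \<in> borel_measurable M. (\<lambda>k. nn_L2 M (\<lambda>x. F k x - g x)) \<longlonglongrightarrow> 0"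
proof -
  define e where "e k = (1/8::real) ^ k" for k
  have "\<forall>k. \<exists>N. \<forall>m\<ge>N. \<forall>n\<ge>N. nn_L2 M (\<lambda>x. F m x - F n x) \<le> ennreal (e k)"
    by (intro allI cauchy) (simp add: e_def)
  then obtain N where N: "\<And>k m n. m \<ge> N k \<Longrightarrow> n \<ge> N k \<Longrightarrow> nn_L2 M (\<lambda>x. F m x - F n x) \<le> ennreal (e k)"
    by metis
  define r where "r k = (\<Sum>i\<le>k. N i) + k" for k
  have r_ge: "N k \<le> r j" if "k \<le> j" for k j
    using member_le_sum[of k "{..j}" N] that by (auto simp: r_def)
  define D where "D k x = F (r (Suc k)) x - F (r k) x" for k x
  have [measurable]: "D k \<in> borel_measurable M" for k by (simp add: D_def[abs_def])
  have D: "nn_L2 M (D k) \<le> ennreal (e k)" for k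
    unfolding D_def by (intro N r_ge) auto
  have "(\<integral>\<^sup>+x. (\<Sum>k. ennreal (2 ^ k) * ennreal ((norm (D k x))\<^sup>2)) \<partial>M) = (\<Sum>k. ennreal (2 ^ k) * nn_L2 M (D k))"
    unfolding nn_L2_def by (subst nn_integral_suminf) (auto simp: nn_integral_cmult)
  also have "\<dots> \<le> (\<Sum>k. ennreal ((1/4) ^ k))"
  proof (intro suminf_le summableI)
    fix k
    have "ennreal (2 ^ k) * nn_L2 M (D k) \<le> ennreal (2 ^ k) * ennreal (e k)"
      by (intro mult_left_mono D) auto
    also have "\<dots> = ennreal ((1/4) ^ k)"
      by (simp add: e_def flip: ennreal_mult power_mult_distrib)
    finally show "ennreal (2 ^ k) * nn_L2 M (D k) \<le> ennreal ((1/4) ^ k)" .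
  qed
  also have "\<dots> < \<infinity>"
    by (subst suminf_ennreal2) (auto intro: summable_geometric)
  finally have "AE x in M. (\<Sum>k. ennreal (2 ^ k) * ennreal ((norm (D k x))\<^sup>2)) \<noteq> \<infinity>"
    by (intro nn_integral_PInf_AE) auto
  then have conv: "AE x in M. convergent (\<lambda>k. F (r k) x)"
  proof eventually_elim
    case (elim x)
    define B where "B = enn2real (\<Sum>k. ennreal (2 ^ k) * ennreal ((norm (D k x))\<^sup>2))"
    have B: "ennreal (2 ^ k * (norm (D k x))\<^sup>2) \<le> ennreal B" for k
    proof -
      have "ennreal (2 ^ k * (norm (D k x))\<^sup>2) \<le> (\<Sum>k. ennreal (2 ^ k) * ennreal ((norm (D k x))\<^sup>2))"
        using sum_le_suminf[of "\<lambda>k. ennreal (2 ^ k) * ennreal ((norm (D k x))\<^sup>2)" "{k}"]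
        by (simp add: ennreal_mult)
      also have "\<dots> = ennreal B" using elim by (simp add: B_def less_top)
      finally show ?thesis .
    qed
    have "norm (D k x) \<le> sqrt B * (1 / sqrt 2) ^ k" for k
    proof -
      have "2 ^ k * (norm (D k x))\<^sup>2 \<le> B" using B[of k] by (simp add: B_def)
      then have "(norm (D k x))\<^sup>2 \<le> B / 2 ^ k" by (simp add: field_simps)
      then have "norm (D k x) \<le> sqrt (B / 2 ^ k)" by (rule real_le_rsqrt)
      also have "\<dots> = sqrt B * (1 / sqrt 2) ^ k"
        by (simp add: real_sqrt_divide real_sqrt_power power_divide)
      finally show ?thesis .
    qed
    moreover have "summable (\<lambda>k. sqrt B * (1 / sqrt 2) ^ k)"
      by (intro summable_mult summable_geometric) simp
    ultimately have "summable (\<lambda>k. D k x)"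
      by (rule summable_comparison_test'[rotated])
    then have "convergent (\<lambda>n. \<Sum>k<n. D k x)" by (simp add: summable_iff_convergent)
    moreover have "(\<Sum>k<n. D k x) = F (r n) x - F (r 0) x" for n
      unfolding D_def by (rule sum_lessThan_telescope)
    ultimately have "convergent (\<lambda>n. F (r n) x - F (r 0) x)" by simp
    from convergent_add[OF this convergent_const[of "F (r 0) x"]] show ?case by simp
  qed
  define g where "g x = lim (\<lambda>k. F (r k) x)" for x
  have [measurable]: "g \<in> borel_measurable M" unfolding g_def[abs_def] by measurable
  have a: "nn_L2 M (\<lambda>x. F m x - g x) \<le> ennreal (e k)" if "m \<ge> N k" for m k
  proof -
    have "nn_L2 M (\<lambda>x. F m x - g x) = (\<integral>\<^sup>+x. liminf (\<lambda>j. ennreal ((norm (F m x - F (r j) x))\<^sup>2)) \<partial>M)"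
      unfolding nn_L2_def
    proof (rule nn_integral_cong_AE, use conv in eventually_elim)
      case (elim x)
      then have "(\<lambda>j. F (r j) x) \<longlonglongrightarrow> g x" by (simp add: g_def convergent_LIMSEQ_iff)
      then have "(\<lambda>j. ennreal ((norm (F m x - F (r j) x))\<^sup>2)) \<longlonglongrightarrow> ennreal ((norm (F m x - g x))\<^sup>2)"
        by (intro tendsto_intros tendsto_ennrealI)
      then show ?case by (intro lim_imp_Liminf[symmetric]) auto
    qed
    also have "\<dots> \<le> liminf (\<lambda>j. nn_L2 M (\<lambda>x. F m x - F (r j) x))"
      unfolding nn_L2_def by (intro nn_integral_liminf) auto
    also have "\<dots> \<le> ennreal (e k)"
      by (intro Liminf_le eventually_sequentiallyI[of k] N[OF that r_ge] sequentially_bot)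
    finally show ?thesis .
  qed
  have "e \<longlonglongrightarrow> 0" unfolding e_def by (intro LIMSEQ_power_zero) auto
  then have l: "(\<lambda>k. ennreal (e k)) \<longlonglongrightarrow> 0" using tendsto_ennrealI by force
  have "(\<lambda>k. nn_L2 M (\<lambda>x. F k x - g x)) \<longlonglongrightarrow> 0"
    proof (rule order_tendstoI)
      fix a' :: ennreal assume "0 < a'"
      from order_tendstoD(2)[OF l this] obtain k where "ennreal (e k) < a'"
        by (auto simp: eventually_sequentially)
      then show "\<forall>\<^sub>F m in sequentially. nn_L2 M (\<lambda>x. F m x - g x) < a'"
        by (intro eventually_sequentiallyI[of "N k"]) (blast intro: le_less_trans[OF a])
    qed auto
  then show ?thesis by (intro bexI[of _ g]) auto
qed

lemma scaled_L2_Cauchy: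
  fixes G :: "'i::linorder \<Rightarrow> 'a \<Rightarrow> complex"
  assumes [measurable]: "\<And>k. G k \<in> borel_measurable M" "g \<in> borel_measurable M"
    and lim: "((\<lambda>k. nn_L2 M (\<lambda>x. G k x - g x)) \<longlongrightarrow> 0) at_top" and K: "K < \<infinity>" and e: "e > 0"
  shows "\<exists>N. \<forall>m\<ge>N. \<forall>n\<ge>N. K * nn_L2 M (\<lambda>x. G m x - G n x) \<le> ennreal e"
proof -
  define u where "u k = K * nn_L2 M (\<lambda>x. G k x - g x)" for k
  have "(u \<longlongrightarrow> K * 0) at_top"
    unfolding u_def using K by (intro ennreal_tendsto_cmult lim) simp
  then have "\<forall>\<^sub>F k in at_top. u k < ennreal (e / 4)"
    using e by (intro order_tendstoD(2)) auto
  then obtain N where N: "\<And>k. k \<ge> N \<Longrightarrow> u k < ennreal (e / 4)"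
    by (auto simp: eventually_at_top_linorder)
  show ?thesis
  proof (intro exI allI impI)
    fix m n assume mn: "m \<ge> N" "n \<ge> N"
    have "K * nn_L2 M (\<lambda>x. G m x - G n x) \<le> K * (2 * nn_L2 M (\<lambda>x. G m x - g x) + 2 * nn_L2 M (\<lambda>x. g x - G n x))"
      by (intro mult_left_mono nn_L2_triangle) auto
    also have "\<dots> = 2 * u m + 2 * u n"
      by (simp add: u_def distrib_left mult_ac nn_L2_uminus[of _ g])
    also have "\<dots> \<le> 2 * ennreal (e / 4) + 2 * ennreal (e / 4)"
      using N[OF mn(1)] N[OF mn(2)] by (intro add_mono mult_left_mono) auto
    also have "\<dots> = ennreal e"
      using e by (simp add: ennreal_mult[symmetric] ennreal_plus[symmetric] flip: ennreal_numeral)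
    finally show "K * nn_L2 M (\<lambda>x. G m x - G n x) \<le> ennreal e" .
  qed
qed

text \<open>The limit over real radii is the limit along the integers.\<close>

lemma L2_lim_exists:
  fixes F :: "real \<Rightarrow> 'a::euclidean_space \<Rightarrow> complex"
  assumes [measurable]: "\<And>R. F R \<in> borel_measurable lborel"
    and fin: "\<And>R. nn_L2 lborel (F R) < \<infinity>"
    and cauchy: "\<And>e. e > 0 \<Longrightarrow> \<exists>N. \<forall>R\<ge>N. \<forall>R'\<ge>N. nn_L2 lborel (\<lambda>x. F R x - F R' x) \<le> ennreal e"
  shows "in_L2 lborel (L2_lim F)" "((\<lambda>R. nn_L2 lborel (\<lambda>x. F R x - L2_lim F x)) \<longlongrightarrow> 0) at_top"
proof -
  have "\<exists>N::nat. \<forall>m\<ge>N. \<forall>n\<ge>N. nn_L2 lborel (\<lambda>x. F (real m) x - F (real n) x) \<le> ennreal e" if e: "e > 0" for e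
  proof -
    obtain N where N: "\<forall>R\<ge>N. \<forall>R'\<ge>N. nn_L2 lborel (\<lambda>x. F R x - F R' x) \<le> ennreal e"
      using cauchy[OF e] by blast
    obtain N' :: nat where "N \<le> real N'" using real_arch_simple by blast
    then show ?thesis by (intro exI[of _ N'] allI impI N[rule_format]) auto
  qed
  then obtain g where g[measurable]: "g \<in> borel_measurable lborel"
    and lim: "(\<lambda>k. nn_L2 lborel (\<lambda>x. F (real k) x - g x)) \<longlonglongrightarrow> 0"
    using L2_complete[of "\<lambda>k. F (real k)" lborel] by (auto simp: Ball_def)
  have limR: "((\<lambda>R. nn_L2 lborel (\<lambda>x. F R x - g x)) \<longlongrightarrow> 0) at_top"
  proof (rule order_tendstoI)
    fix a :: ennreal assume a: "0 < a"
    obtain e where e: "e > 0" "ennreal e < a"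
    proof (cases a)
      case (real r)
      with a have "r / 2 > 0" "ennreal (r / 2) < a" by (auto simp: ennreal_less_iff)
      then show ?thesis by (rule that)
    qed (rule that[of 1], auto)
    obtain N where N: "\<forall>R\<ge>N. \<forall>R'\<ge>N. nn_L2 lborel (\<lambda>x. F R x - F R' x) \<le> ennreal (e / 4)"
      using cauchy[of "e / 4"] e by auto
    have "\<forall>\<^sub>F k in sequentially. nn_L2 lborel (\<lambda>x. F (real k) x - g x) < ennreal (e / 4)"
      using e by (intro order_tendstoD(2)[OF lim]) auto
    then have "\<forall>\<^sub>F k in sequentially. nn_L2 lborel (\<lambda>x. F (real k) x - g x) < ennreal (e / 4) \<and> real k \<ge> N"
      by (intro eventually_conj filterlim_real_sequentially[THEN filterlim_at_top[THEN iffD1], rule_format])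
    then obtain k where k: "nn_L2 lborel (\<lambda>x. F (real k) x - g x) < ennreal (e / 4)" "real k \<ge> N"
      by (auto simp: eventually_sequentially)
    show "\<forall>\<^sub>F R in at_top. nn_L2 lborel (\<lambda>x. F R x - g x) < a"
      using eventually_ge_at_top[of N]
    proof eventually_elim
      case (elim R)
      have "nn_L2 lborel (\<lambda>x. F R x - g x)
          \<le> 2 * nn_L2 lborel (\<lambda>x. F R x - F (real k) x) + 2 * nn_L2 lborel (\<lambda>x. F (real k) x - g x)"
        by (intro nn_L2_triangle) auto
      also have "\<dots> \<le> 2 * ennreal (e / 4) + 2 * ennreal (e / 4)"
        using N elim k by (intro add_mono mult_left_mono) auto
      also have "\<dots> = ennreal e"
        using e by (simp add: ennreal_mult[symmetric] ennreal_plus[symmetric] flip: ennreal_numeral)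
      finally show ?case using e by (simp add: le_less_trans)
    qed
  qed auto
  have "nn_L2 lborel g < \<infinity>"
  proof -
    have "\<forall>\<^sub>F R in at_top. nn_L2 lborel (\<lambda>x. F R x - g x) < 1"
      by (intro order_tendstoD(2)[OF limR]) auto
    then obtain R where R: "nn_L2 lborel (\<lambda>x. F R x - g x) < 1" by (auto simp: eventually_at_top_linorder)
    have "nn_L2 lborel g \<le> 2 * nn_L2 lborel (F R) + 2 * nn_L2 lborel (\<lambda>x. g x - F R x)"
      by (intro nn_L2_le_diff) auto
    also have "\<dots> \<le> 2 * nn_L2 lborel (F R) + 2 * 1"
      using R by (intro add_mono mult_left_mono) (auto simp: nn_L2_uminus[of _ g])
    also have "\<dots> < \<infinity>" using fin[of R] by (simp add: ennreal_mult_less_top)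
    finally show ?thesis .
  qed
  then have "\<exists>g. in_L2 lborel g \<and> ((\<lambda>R. \<integral>\<^sup>+ x. ennreal ((norm (F R x - g x))\<^sup>2) \<partial>lborel) \<longlongrightarrow> 0) at_top"
    using limR by (intro exI[of _ g]) (auto simp: in_L2_iff nn_L2_def)
  from someI_ex[OF this]
  show "in_L2 lborel (L2_lim F)" "((\<lambda>R. nn_L2 lborel (\<lambda>x. F R x - L2_lim F x)) \<longlongrightarrow> 0) at_top"
    unfolding L2_lim_def nn_L2_def by auto
qed

text \<open>Passing to the limit with the quadratic triangle inequality costs a factor \<open>2\<close>, which is
  harmless since no sharp constants are needed.\<close>

lemma nn_L2_limit_le:
  assumes [measurable]: "\<And>k. F k \<in> borel_measurable M" "f \<in> borel_measurable M"
    and f: "((\<lambda>k. nn_L2 M (\<lambda>x. F k x - f x)) \<longlongrightarrow> 0) A" and "A \<noteq> bot"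
    and le: "\<forall>\<^sub>F k in A. nn_L2 M (F k) \<le> B"
  shows "nn_L2 M f \<le> 2 * B"
proof -
  have "((\<lambda>k. 2 * B + 2 * nn_L2 M (\<lambda>x. F k x - f x)) \<longlongrightarrow> 2 * B + 2 * 0) A"
    by (intro tendsto_add ennreal_tendsto_cmult f) auto
  moreover have "\<forall>\<^sub>F k in A. nn_L2 M f \<le> 2 * B + 2 * nn_L2 M (\<lambda>x. F k x - f x)"
    using le
  proof eventually_elim
    case (elim k)
    have "nn_L2 M f \<le> 2 * nn_L2 M (F k) + 2 * nn_L2 M (\<lambda>x. f x - F k x)" by (intro nn_L2_le_diff) auto
    also have "\<dots> \<le> 2 * B + 2 * nn_L2 M (\<lambda>x. F k x - f x)"
      using elim by (intro add_mono mult_left_mono) (auto simp: nn_L2_uminus[of _ f])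
    finally show ?case .
  qed
  ultimately show ?thesis
    using tendsto_lowerbound[OF _ _ \<open>A \<noteq> bot\<close>] by fastforce
qed

lemma sets_cball [measurable]: "cball (a::'a::euclidean_space) r \<in> sets borel"
  by (intro borel_closed) simp

abbreviation cutoff :: "real \<Rightarrow> ('a::euclidean_space \<Rightarrow> complex) \<Rightarrow> 'a \<Rightarrow> complex" where
  "cutoff R f \<equiv> \<lambda>x. indicator (cball 0 R) x *\<^sub>R f x"

lemma nn_L2_cutoff_tendsto:
  assumes f: "in_L2 lborel (f :: 'a::euclidean_space \<Rightarrow> complex)"
  shows "((\<lambda>R. nn_L2 lborel (\<lambda>x. indicator (cball 0 R) x *\<^sub>R f x - f x)) \<longlongrightarrow> 0) at_top"
proof -
  note [measurable] = f[THEN in_L2_measurable]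
  have i: "integrable lborel (\<lambda>x. (norm (f x))\<^sup>2)" using f by (simp add: in_L2_def)
  have "((\<lambda>R. LINT x|lborel. (norm (indicator (cball 0 R) x *\<^sub>R f x - f x))\<^sup>2) \<longlongrightarrow> (LINT x|(lborel::'a measure). 0)) at_top"
  proof (rule integral_dominated_convergence_at_top[OF _ _ i])
    show "AE x in lborel. ((\<lambda>R. (norm (indicator (cball 0 R) x *\<^sub>R f x - f x))\<^sup>2) \<longlongrightarrow> 0) at_top"
    proof (rule AE_I2)
      fix x
      show "((\<lambda>R. (norm (indicator (cball 0 R) x *\<^sub>R f x - f x))\<^sup>2) \<longlongrightarrow> 0) at_top"
        by (rule tendsto_eventually, use eventually_ge_at_top[of "norm x"] in eventually_elim) auto
    qed
    show "\<forall>\<^sub>F R in at_top. AE x in lborel. norm ((norm (indicator (cball 0 R) x *\<^sub>R f x - f x))\<^sup>2) \<le> (norm (f x))\<^sup>2"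
      by (intro always_eventually allI AE_I2) (auto split: split_indicator)
  qed auto
  then have "((\<lambda>R. ennreal (LINT x|lborel. (norm (indicator (cball 0 R) x *\<^sub>R f x - f x))\<^sup>2)) \<longlongrightarrow> ennreal 0) at_top"
    by (intro tendsto_ennrealI) simp
  moreover have "ennreal (LINT x|lborel. (norm (indicator (cball 0 R) x *\<^sub>R f x - f x))\<^sup>2)
      = nn_L2 lborel (\<lambda>x. indicator (cball 0 R) x *\<^sub>R f x - f x)" for R
    unfolding nn_L2_def
    by (subst nn_integral_eq_integral)
       (auto intro!: Bochner_Integration.integrable_bound[OF i] split: split_indicator)
  ultimately show ?thesis by simp
qed

lemma in_L2_cutoff:
  assumes f: "in_L2 lborel (f :: 'a::euclidean_space \<Rightarrow> complex)"
  shows "in_L2 lborel (cutoff R f)"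
proof -
  note [measurable] = f[THEN in_L2_measurable]
  have "nn_L2 lborel (cutoff R f) \<le> nn_L2 lborel f"
    by (intro nn_L2_mono) (auto split: split_indicator)
  with f show ?thesis by (auto simp: in_L2_iff)
qed

lemma integrable_cutoff:
  assumes f: "in_L2 lborel (f :: 'a::euclidean_space \<Rightarrow> complex)"
  shows "integrable lborel (cutoff R f)"
proof -
  have "nn_L2 lborel (indicator (cball (0::'a) R)) = (\<integral>\<^sup>+x. indicator (cball (0::'a) R) x \<partial>lborel)"
    unfolding nn_L2_def by (intro nn_integral_cong) (auto split: split_indicator)
  also have "\<dots> = emeasure lborel (cball (0::'a) R)" by simp
  also have "\<dots> < \<infinity>" by (rule emeasure_lborel_cball_finite)
  finally have "in_L2 lborel (indicator (cball (0::'a) R))"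
    unfolding in_L2_iff by simp
  from L2_mult_integrable[OF this f] show ?thesis
    by (rule Bochner_Integration.integrable_cong[THEN iffD1, rotated -1]) (auto split: split_indicator)
qed

lemma nn_integral_tendsto_0_AE_subseq:
  fixes D :: "nat \<Rightarrow> 'a \<Rightarrow> ennreal"
  assumes [measurable]: "\<And>k. D k \<in> borel_measurable M"
    and lim: "(\<lambda>k. \<integral>\<^sup>+t. D k t \<partial>M) \<longlonglongrightarrow> 0"
  shows "\<exists>r. filterlim r at_top sequentially \<and> (AE t in M. (\<lambda>k. D (r k) t) \<longlonglongrightarrow> 0)"
proof -
  have "\<exists>j\<ge>k. (\<integral>\<^sup>+t. D j t \<partial>M) < ennreal ((1/2) ^ k)" for k
  proof -
    have "\<forall>\<^sub>F j in sequentially. (\<integral>\<^sup>+t. D j t \<partial>M) < ennreal ((1/2) ^ k)"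
      by (intro order_tendstoD(2)[OF lim]) simp
    then show ?thesis unfolding eventually_sequentially by (metis nat_le_linear)
  qed
  then obtain r where r: "\<And>k. r k \<ge> k" "\<And>k. (\<integral>\<^sup>+t. D (r k) t \<partial>M) < ennreal ((1/2) ^ k)" by metis
  have "(\<integral>\<^sup>+t. (\<Sum>k. D (r k) t) \<partial>M) = (\<Sum>k. \<integral>\<^sup>+t. D (r k) t \<partial>M)"
    by (rule nn_integral_suminf) measurable
  also have "\<dots> \<le> (\<Sum>k. ennreal ((1/2) ^ k))"
    by (intro suminf_le summableI less_imp_le r)
  also have "\<dots> < \<infinity>" by (subst suminf_ennreal2) (auto intro: summable_geometric)
  finally have "AE t in M. (\<Sum>k. D (r k) t) \<noteq> \<infinity>"
    by (intro nn_integral_PInf_AE) auto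
  then have "AE t in M. (\<lambda>k. D (r k) t) \<longlonglongrightarrow> 0"
  proof eventually_elim
    case (elim t)
    have fin: "D (r k) t \<noteq> \<infinity>" for k
      using sum_le_suminf[of "\<lambda>k. D (r k) t" "{k}"] elim by (auto simp: top_unique)
    have eq: "D (r k) t = ennreal (enn2real (D (r k) t))" for k using fin[of k] by (simp add: less_top)
    have "(\<Sum>k. ennreal (enn2real (D (r k) t))) \<noteq> top" using elim by (simp add: eq[symmetric])
    then have "summable (\<lambda>k. enn2real (D (r k) t))" by (intro summable_suminf_not_top) auto
    then have "(\<lambda>k. enn2real (D (r k) t)) \<longlonglongrightarrow> 0" by (rule summable_LIMSEQ_zero)
    then have "(\<lambda>k. ennreal (enn2real (D (r k) t))) \<longlonglongrightarrow> ennreal 0" by (rule tendsto_ennrealI)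
    then show ?case by (simp add: eq[symmetric])
  qed
  moreover have "filterlim r at_top sequentially"
    by (rule filterlim_at_top_mono[OF filterlim_ident]) (simp add: r)
  ultimately show ?thesis by blast
qed

section \<open>Gaussians and the Fourier integral\<close>

lemma cis_measurable [measurable]: "cis \<in> borel_measurable borel"
  by (intro borel_measurable_continuous_onI continuous_on_cis continuous_on_id)

lemma cnj_measurable [measurable]: "cnj \<in> borel_measurable borel"
  by (intro borel_measurable_continuous_onI continuous_on_cnj continuous_on_id)

lemma cis_diff: "cis (a - b) = cis a * cnj (cis b)"
  by (simp add: cis_cnj cis_mult)

lemma cis_sum: "finite A \<Longrightarrow> cis (sum f A) = (\<Prod>a\<in>A. cis (f a))"
  by (induction A rule: finite_induct) (auto simp: cis_mult[symmetric])

text \<open>Rescaled form of the characteristic function of the normal distribution.\<close>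

lemma gaussian_fourier_real:
  fixes a t :: real assumes a: "a > 0"
  shows "(LINT x|lborel. cis (x * t) * of_real (exp (- a * x\<^sup>2))) = of_real (sqrt (pi / a) * exp (- t\<^sup>2 / (4 * a)))"
proof -
  have "complex_of_real (exp (- (s\<^sup>2) / 2)) = (LINT x|std_normal_distribution. cis (s * x))" for s
    using fun_cong[OF char_std_normal_distribution, of s] by (simp add: char_def cis_conv_exp)
  also have "(LINT x|std_normal_distribution. cis (s * x)) = (LINT x|lborel. std_normal_density x *\<^sub>R cis (s * x))" for s
    by (subst integral_density) (auto simp: normal_density_nonneg)
  finally have "complex_of_real (exp (- ((t / sqrt (2 * a))\<^sup>2) / 2))
      = (LINT x|lborel. std_normal_density x *\<^sub>R cis (t / sqrt (2 * a) * x))" .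
  also have "\<dots> = sqrt (2 * a) *\<^sub>R (LINT x|lborel. std_normal_density (sqrt (2 * a) * x) *\<^sub>R cis (x * t))"
    using a by (subst lborel_integral_real_affine[where t=0 and c="sqrt (2 * a)"]) (auto simp: mult.commute)
  also have "\<dots> = (sqrt (2 * a) / sqrt (2 * pi)) *\<^sub>R (LINT x|lborel. cis (x * t) * of_real (exp (- a * x\<^sup>2)))"
    using a by (simp add: std_normal_density_def power_mult_distrib scaleR_conv_of_real mult.commute)
  finally have *: "complex_of_real (exp (- ((t / sqrt (2 * a))\<^sup>2) / 2)) = (sqrt (2 * a) / sqrt (2 * pi)) *\<^sub>R (LINT x|lborel. cis (x * t) * of_real (exp (- a * x\<^sup>2)))" .
  have "sqrt (pi / a) *\<^sub>R (sqrt (2 * a) / sqrt (2 * pi)) *\<^sub>R (LINT x|lborel. cis (x * t) * of_real (exp (- a * x\<^sup>2)))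
      = (LINT x|lborel. cis (x * t) * of_real (exp (- a * x\<^sup>2)))"
    using a by (simp add: real_sqrt_divide real_sqrt_mult)
  then show ?thesis using a unfolding *[symmetric]
    by (simp add: power_divide scaleR_conv_of_real)
qed

lemma gaussian_integrable_real:
  fixes a :: real assumes a: "a > 0"
  shows "integrable lborel (\<lambda>x. exp (- a * x\<^sup>2))"
proof -
  have "integrable lborel (\<lambda>x. std_normal_density (0 + sqrt (2 * a) * x) )"
    using a integrable_std_normal_moment[of 0] by (intro lborel_integrable_real_affine) auto
  then have "integrable lborel (\<lambda>x. sqrt (2 * pi) * std_normal_density (0 + sqrt (2 * a) * x) )"
    by (rule integrable_mult_right)
  then show ?thesis using a by (simp add: std_normal_density_def power_mult_distrib)
qed

lemma norm_power2_Basis: "(norm (x::'a::euclidean_space))\<^sup>2 = (\<Sum>b\<in>Basis. (x \<bullet> b)\<^sup>2)"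
  by (subst power2_norm_eq_inner, subst euclidean_inner) (simp add: power2_eq_square)

lemma lborel_integral_prod_Basis:
  fixes f :: "'a::euclidean_space \<Rightarrow> real \<Rightarrow> complex"
  assumes "\<And>b. b \<in> Basis \<Longrightarrow> integrable lborel (f b)"
  shows "integrable lborel (\<lambda>x::'a. \<Prod>b\<in>Basis. f b (x \<bullet> b))"
    and "(LINT x|lborel. (\<Prod>b\<in>Basis. f b (x \<bullet> b))) = (\<Prod>b\<in>Basis. LINT x|lborel. f b x)"
proof -
  interpret P: product_sigma_finite "\<lambda>_::'a. lborel::real measure" ..
  have [measurable]: "f b \<in> borel_measurable borel" if "b \<in> Basis" for b
    using assms[OF that] by auto
  have eq: "(\<Prod>b\<in>Basis. f b ((\<Sum>c\<in>Basis. w c *\<^sub>R c) \<bullet> b)) = (\<Prod>b\<in>Basis. f b (w b))" for w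
    by (intro prod.cong) auto
  have i: "integrable (\<Pi>\<^sub>M b\<in>(Basis::'a set). lborel) (\<lambda>w. \<Prod>b\<in>Basis. f b (w b))"
    by (intro P.product_integrable_prod assms) auto
  show "integrable lborel (\<lambda>x::'a. \<Prod>b\<in>Basis. f b (x \<bullet> b))"
    by (subst lborel_eq, subst integrable_distr_eq) (use i in \<open>auto simp: eq\<close>)
  show "(LINT x|lborel. (\<Prod>b\<in>Basis. f b (x \<bullet> b))) = (\<Prod>b\<in>Basis. LINT x|lborel. f b x)"
    by (subst lborel_eq, subst integral_distr) (auto simp: eq P.product_integral_prod assms)
qed

text \<open>The Fourier transform of \<open>exp (- a \<bar>x\<bar>\<^sup>2)\<close>.\<close>

definition gauss_hat :: "real \<Rightarrow> 'a::euclidean_space \<Rightarrow> real" where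
  "gauss_hat a \<xi> = sqrt (pi / a) ^ DIM('a) * exp (- (norm \<xi>)\<^sup>2 / (4 * a))"

lemma gaussian_fourier:
  fixes \<xi> :: "'a::euclidean_space" assumes a: "a > 0"
  shows "(LINT x|lborel. cis (x \<bullet> \<xi>) * of_real (exp (- a * (norm x)\<^sup>2))) = of_real (gauss_hat a \<xi>)"
    and gaussian_integrable: "integrable lborel (\<lambda>x::'a. exp (- a * (norm x)\<^sup>2))"
proof -
  have eq: "cis (x \<bullet> \<xi>) * of_real (exp (- a * (norm x)\<^sup>2))
     = (\<Prod>b\<in>Basis. (\<lambda>t. cis (t * (\<xi> \<bullet> b)) * of_real (exp (- a * t\<^sup>2))) (x \<bullet> b))" for x \<xi> :: 'a
    by (simp add: euclidean_inner[of x \<xi>] cis_sum prod.distrib norm_power2_Basis sum_distrib_left exp_sum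
        flip: sum_negf)
  have i1: "integrable lborel (\<lambda>t. cis (t * (\<xi> \<bullet> b)) * of_real (exp (- a * t\<^sup>2)))" for \<xi> b :: 'a
    by (rule Bochner_Integration.integrable_bound[OF gaussian_integrable_real[OF a]])
       (auto simp: norm_mult)
  show "(LINT x|lborel. cis (x \<bullet> \<xi>) * of_real (exp (- a * (norm x)\<^sup>2))) = of_real (gauss_hat a \<xi>)"
    unfolding eq
    by (subst lborel_integral_prod_Basis(2)[OF i1])
       (simp add: gaussian_fourier_real[OF a, simplified] prod.distrib gauss_hat_def norm_power2_Basis sum_divide_distrib exp_sum
        flip: sum_negf)
  have "integrable lborel (\<lambda>x::'a. cis (x \<bullet> 0) * of_real (exp (- a * (norm x)\<^sup>2)))"
    unfolding eq by (rule lborel_integral_prod_Basis(1)[OF i1])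
  then have "integrable lborel (\<lambda>x::'a. complex_of_real (exp (- a * (norm x)\<^sup>2)))" by simp
  then show "integrable lborel (\<lambda>x::'a. exp (- a * (norm x)\<^sup>2))" by (subst (asm) complex_of_real_integrable_eq)
qed

lemma gauss_hat_nonneg: "a > 0 \<Longrightarrow> gauss_hat a \<xi> \<ge> 0"
  by (simp add: gauss_hat_def)

lemma gauss_hat_measurable [measurable]: "gauss_hat a \<in> borel_measurable borel"
  unfolding gauss_hat_def[abs_def] by measurable

lemma gaussian_nn_integral:
  assumes a: "a > 0"
  shows "(\<integral>\<^sup>+x. ennreal (exp (- a * (norm (x::'a::euclidean_space))\<^sup>2)) \<partial>lborel) = ennreal (sqrt (pi / a) ^ DIM('a))"
proof -
  have "(LINT x|lborel. complex_of_real (exp (- a * (norm (x::'a))\<^sup>2))) = of_real (sqrt (pi / a) ^ DIM('a))"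
    using gaussian_fourier(1)[OF a, of "0::'a"] by (simp add: gauss_hat_def)
  then have "(LINT x|lborel. exp (- a * (norm (x::'a))\<^sup>2)) = sqrt (pi / a) ^ DIM('a)"
    unfolding integral_complex_of_real of_real_eq_iff .
  then show ?thesis
    by (subst nn_integral_eq_integral[OF gaussian_integrable[OF a]]) auto
qed

lemma lborel_nn_integral_affine:
  fixes f :: "'a::euclidean_space \<Rightarrow> ennreal"
  assumes [measurable]: "f \<in> borel_measurable borel" and c: "c \<noteq> 0"
  shows "(\<integral>\<^sup>+x. f x \<partial>lborel) = ennreal (\<bar>c\<bar> ^ DIM('a)) * (\<integral>\<^sup>+x. f (t + c *\<^sub>R x) \<partial>lborel)"
  by (subst lborel_affine[OF c, of t])
     (simp add: nn_integral_density nn_integral_distr nn_integral_cmult ennreal_power)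

lemma gauss_hat_nn_integral:
  assumes a: "a > 0"
  shows "(\<integral>\<^sup>+\<xi>. ennreal (gauss_hat a (\<eta> - \<xi> :: 'a::euclidean_space)) \<partial>lborel) = ennreal ((2 * pi) ^ DIM('a))"
proof -
  have "(\<integral>\<^sup>+\<xi>. ennreal (gauss_hat a (\<eta> - \<xi>)) \<partial>lborel) = (\<integral>\<^sup>+\<xi>. ennreal (gauss_hat a (\<xi>::'a)) \<partial>lborel)"
    by (subst (2) lborel_nn_integral_affine[where c="-1" and t=\<eta>]) auto
  also have "\<dots> = ennreal (sqrt (pi / a) ^ DIM('a)) * (\<integral>\<^sup>+\<xi>. ennreal (exp (- (1 / (4 * a)) * (norm (\<xi>::'a))\<^sup>2)) \<partial>lborel)"
    using a by (subst nn_integral_cmult[symmetric]) (auto simp: gauss_hat_def ennreal_mult)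
  also have "\<dots> = ennreal (sqrt (pi / a) ^ DIM('a)) * ennreal (sqrt (pi / (1 / (4 * a))) ^ DIM('a))"
    using a by (subst gaussian_nn_integral) auto
  also have "\<dots> = ennreal ((2 * pi) ^ DIM('a))"
  proof -
    have "sqrt (pi / a) * sqrt (pi / (1 / (4 * a))) = sqrt ((2 * pi)\<^sup>2)"
      unfolding real_sqrt_mult[symmetric] using a by (intro arg_cong[where f=sqrt]) (simp add: power2_eq_square)
    then have "sqrt (pi / a) * sqrt (pi / (1 / (4 * a))) = 2 * pi" by (simp only: real_sqrt_abs) simp
    then have "sqrt (pi / a) ^ DIM('a) * sqrt (pi / (1 / (4 * a))) ^ DIM('a) = (2 * pi) ^ DIM('a)"
      by (simp only: power_mult_distrib[symmetric])
    moreover have "ennreal (sqrt (pi / a) ^ DIM('a)) * ennreal (sqrt (pi / (1 / (4 * a))) ^ DIM('a))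
        = ennreal (sqrt (pi / a) ^ DIM('a) * sqrt (pi / (1 / (4 * a))) ^ DIM('a))"
      using a by (intro ennreal_mult[symmetric] zero_le_power) auto
    ultimately show ?thesis by (simp only:)
  qed
  finally show ?thesis .
qed

lemma (in pair_sigma_finite) integrable_mult_pair:
  fixes f g :: "_ \<Rightarrow> complex"
  assumes f: "integrable M1 f" and g: "integrable M2 g"
  shows "integrable (M1 \<Otimes>\<^sub>M M2) (\<lambda>z. f (fst z) * g (snd z))"
proof (rule Fubini_integrable)
  have [measurable]: "f \<in> borel_measurable M1" "g \<in> borel_measurable M2" using f g by auto
  show "(\<lambda>z. f (fst z) * g (snd z)) \<in> borel_measurable (M1 \<Otimes>\<^sub>M M2)" by measurable
  show "integrable M1 (\<lambda>x. LINT y|M2. norm (f (fst (x, y)) * g (snd (x, y))))"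
    using f by (simp add: norm_mult)
  show "AE x in M1. integrable M2 (\<lambda>y. f (fst (x, y)) * g (snd (x, y)))"
    using g by simp
qed

lemma (in pair_sigma_finite) integral_mult_pair:
  fixes f g :: "_ \<Rightarrow> complex"
  assumes f: "integrable M1 f" and g: "integrable M2 g"
  shows "(LINT z|(M1 \<Otimes>\<^sub>M M2). f (fst z) * g (snd z)) = (LINT x|M1. f x) * (LINT y|M2. g y)"
  using integral_fst'[OF integrable_mult_pair[OF f g]] by simp

text \<open>The \<open>T T\<^sup>*\<close> argument: squaring the oscillatory integral and integrating first over the
  (finite) measure in \<open>y\<close> leaves a quadratic form whose kernel no longer contains \<open>y\<close>.\<close>

lemma TTstar_bound:
  fixes \<phi> :: "'b \<Rightarrow> 'a \<Rightarrow> real" and h :: "'a \<Rightarrow> complex"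
  assumes "finite_measure N" "sigma_finite_measure M"
    and \<phi>[measurable]: "case_prod \<phi> \<in> borel_measurable (N \<Otimes>\<^sub>M M)"
    and h: "integrable M h"
  shows "(\<integral>\<^sup>+y. ennreal ((norm (LINT m|M. cis (\<phi> y m) * h m))\<^sup>2) \<partial>N)
    \<le> (\<integral>\<^sup>+m. \<integral>\<^sup>+m'. ennreal (norm (h m) * norm (h m') * norm (LINT y|N. cis (\<phi> y m - \<phi> y m'))) \<partial>M \<partial>M)"
proof -
  interpret N: finite_measure N by fact
  interpret M: sigma_finite_measure M by fact
  interpret MM: pair_sigma_finite M M ..
  interpret P: pair_sigma_finite N "M \<Otimes>\<^sub>M M"
    by (intro pair_sigma_finite.intro N.sigma_finite_measure_axioms MM.sigma_finite_measure_axioms)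
  have [measurable]: "h \<in> borel_measurable M" using h by auto
  define I where "I y = (LINT m|M. cis (\<phi> y m) * h m)" for y
  define J where "J y z = cis (\<phi> y (fst z) - \<phi> y (snd z)) * (h (fst z) * cnj (h (snd z)))" for y z
  have [measurable]: "I \<in> borel_measurable N" unfolding I_def[abs_def] by measurable
  have [measurable]: "case_prod J \<in> borel_measurable (N \<Otimes>\<^sub>M (M \<Otimes>\<^sub>M M))"
    unfolding J_def by measurable
  have Ib: "norm (I y) \<le> (LINT m|M. norm (h m))" if "y \<in> space N" for y
    unfolding I_def using integral_norm_bound[of M "\<lambda>m. cis (\<phi> y m) * h m"] by (simp add: norm_mult)
  have ih: "integrable M (\<lambda>m. cis (\<phi> y m) * h m)" if [measurable]: "y \<in> space N" for y
    by (rule Bochner_Integration.integrable_bound[OF h]) (auto simp: norm_mult)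
  have hh: "integrable (M \<Otimes>\<^sub>M M) (\<lambda>z. h (fst z) * cnj (h (snd z)))"
    using h by (intro MM.integrable_mult_pair) auto
  have II: "I y * cnj (I y) = (LINT z|(M \<Otimes>\<^sub>M M). J y z)" if y: "y \<in> space N" for y
  proof -
    have "I y * cnj (I y) = (LINT m|M. cis (\<phi> y m) * h m) * (LINT m|M. cnj (cis (\<phi> y m) * h m))"
      unfolding I_def by (simp only: Bochner_Integration.integral_cnj)
    also have "\<dots> = (LINT z|(M \<Otimes>\<^sub>M M). (cis (\<phi> y (fst z)) * h (fst z)) * cnj (cis (\<phi> y (snd z)) * h (snd z)))"
      using ih[OF y] by (intro MM.integral_mult_pair[symmetric]) (auto simp only: integrable_cnj)
    also have "\<dots> = (LINT z|(M \<Otimes>\<^sub>M M). J y z)"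
      unfolding J_def cis_diff by (simp add: mult_ac)
    finally show ?thesis .
  qed
  have iJ: "integrable (N \<Otimes>\<^sub>M (M \<Otimes>\<^sub>M M)) (case_prod J)"
  proof (rule Bochner_Integration.integrable_bound)
    show "integrable (N \<Otimes>\<^sub>M (M \<Otimes>\<^sub>M M)) (\<lambda>z. (\<lambda>_. 1) (fst z) * (h (fst (snd z)) * cnj (h (snd (snd z)))))"
      using P.integrable_mult_pair[OF _ hh, of "\<lambda>_. 1"] by simp
  qed (auto simp: J_def norm_mult)
  have iI: "integrable N (\<lambda>y. (norm (I y))\<^sup>2)"
    by (rule N.integrable_const_bound[where B="(LINT m|M. norm (h m))\<^sup>2"])
       (auto intro!: AE_I2 power_mono Ib)
  have "complex_of_real (LINT y|N. (norm (I y))\<^sup>2) = (LINT y|N. I y * cnj (I y))"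
    by (simp only: complex_norm_square[symmetric] integral_complex_of_real)
  also have "\<dots> = (LINT y|N. LINT z|(M \<Otimes>\<^sub>M M). J y z)"
    by (intro Bochner_Integration.integral_cong II) auto
  also have "\<dots> = (LINT z|(M \<Otimes>\<^sub>M M). LINT y|N. J y z)"
    by (intro P.Fubini_integral[symmetric] iJ)
  finally have eq: "complex_of_real (LINT y|N. (norm (I y))\<^sup>2) = (LINT z|(M \<Otimes>\<^sub>M M). LINT y|N. J y z)" .
  have "(\<integral>\<^sup>+y. ennreal ((norm (I y))\<^sup>2) \<partial>N) = ennreal (norm (complex_of_real (LINT y|N. (norm (I y))\<^sup>2)))"
    using iI by (subst nn_integral_eq_integral) (auto simp: integral_nonneg_AE)
  also have "\<dots> \<le> (\<integral>\<^sup>+z. ennreal (norm (LINT y|N. J y z)) \<partial>(M \<Otimes>\<^sub>M M))"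
    unfolding eq using P.integrable_snd[OF iJ] by (rule integral_norm_bound_ennreal)
  also have "\<dots> = (\<integral>\<^sup>+m. \<integral>\<^sup>+m'. ennreal (norm (LINT y|N. J y (m, m'))) \<partial>M \<partial>M)"
    by (subst M.nn_integral_fst[symmetric]) auto
  also have "\<dots> = (\<integral>\<^sup>+m. \<integral>\<^sup>+m'. ennreal (norm (h m) * norm (h m') * norm (LINT y|N. cis (\<phi> y m - \<phi> y m'))) \<partial>M \<partial>M)"
    by (simp add: J_def norm_mult mult_ac)
  finally show ?thesis unfolding I_def .
qed

text \<open>Schur's test in the symmetric form: by \<open>2 a b \<le> a\<^sup>2 + b\<^sup>2\<close> and the symmetry of the kernel, the quadratic
  form is at most the integral of \<open>\<bar>h\<bar>\<^sup>2\<close> against the row integrals of the kernel.\<close>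

lemma schur_test:
  fixes h :: "'a \<Rightarrow> complex" and K :: "'a \<Rightarrow> 'a \<Rightarrow> real"
  assumes "sigma_finite_measure M" and [measurable]: "h \<in> borel_measurable M"
    and K[measurable]: "case_prod K \<in> borel_measurable (M \<Otimes>\<^sub>M M)"
    and K0: "\<And>m m'. K m m' \<ge> 0" and sym: "\<And>m m'. K m m' = K m' m"
  shows "(\<integral>\<^sup>+m. \<integral>\<^sup>+m'. ennreal (norm (h m) * norm (h m') * K m m') \<partial>M \<partial>M)
    \<le> (\<integral>\<^sup>+m. ennreal ((norm (h m))\<^sup>2) * (\<integral>\<^sup>+m'. ennreal (K m m') \<partial>M) \<partial>M)"
proof -
  interpret M: sigma_finite_measure M by fact
  interpret MM: pair_sigma_finite M M ..
  define Q where "Q m m' = ennreal ((norm (h m))\<^sup>2) * ennreal (K m m')" for m m'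
  have [measurable]: "case_prod Q \<in> borel_measurable (M \<Otimes>\<^sub>M M)" unfolding Q_def by measurable
  define D where "D = (\<integral>\<^sup>+m. \<integral>\<^sup>+m'. Q m m' \<partial>M \<partial>M)"
  have D': "(\<integral>\<^sup>+m. \<integral>\<^sup>+m'. Q m' m \<partial>M \<partial>M) = D"
    unfolding D_def by (rule MM.Fubini') measurable
  have "2 * ennreal (norm (h m) * norm (h m') * K m m') \<le> Q m m' + Q m' m" for m m'
  proof -
    have "2 * (norm (h m) * norm (h m') * K m m') = (2 * norm (h m) * norm (h m')) * K m m'" by simp
    also have "\<dots> \<le> ((norm (h m))\<^sup>2 + (norm (h m'))\<^sup>2) * K m m'"
      by (intro mult_right_mono sum_squares_bound K0)
    finally have "ennreal (2 * (norm (h m) * norm (h m') * K m m')) \<le> ennreal (((norm (h m))\<^sup>2 + (norm (h m'))\<^sup>2) * K m m')"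
      by (rule ennreal_leI)
    then show ?thesis
      by (simp add: Q_def K0 ennreal_mult ennreal_plus distrib_right sym[of m'] mult.assoc)
  qed
  then have "2 * (\<integral>\<^sup>+m. \<integral>\<^sup>+m'. ennreal (norm (h m) * norm (h m') * K m m') \<partial>M \<partial>M)
      \<le> (\<integral>\<^sup>+m. \<integral>\<^sup>+m'. Q m m' + Q m' m \<partial>M \<partial>M)"
    by (simp add: nn_integral_cmult[symmetric] nn_integral_mono)
  also have "\<dots> = 2 * D"
  proof -
    have "(\<integral>\<^sup>+m. \<integral>\<^sup>+m'. Q m m' + Q m' m \<partial>M \<partial>M) = (\<integral>\<^sup>+m. (\<integral>\<^sup>+m'. Q m m' \<partial>M) + (\<integral>\<^sup>+m'. Q m' m \<partial>M) \<partial>M)"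
      by (intro nn_integral_cong nn_integral_add) measurable
    also have "\<dots> = D + D"
      by (subst nn_integral_add) (auto simp: D' D_def)
    finally show ?thesis by (simp add: mult_2)
  qed
  finally have "(\<integral>\<^sup>+m. \<integral>\<^sup>+m'. ennreal (norm (h m) * norm (h m') * K m m') \<partial>M \<partial>M) \<le> D"
    by (subst (asm) ennreal_mult_le_mult_iff) auto
  also have "D = (\<integral>\<^sup>+m. ennreal ((norm (h m))\<^sup>2) * (\<integral>\<^sup>+m'. ennreal (K m m') \<partial>M) \<partial>M)"
    unfolding D_def Q_def by (intro nn_integral_cong nn_integral_cmult) measurable
  finally show ?thesis .
qed

text \<open>The form in which the argument is applied: the finite measure has a density \<open>w\<close>.\<close>

lemma weighted_TTstar_bound:
  fixes \<phi> :: "'b \<Rightarrow> 'a \<Rightarrow> real" and h :: "'a \<Rightarrow> complex" and w :: "'b \<Rightarrow> real"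
  assumes w: "integrable N w" "\<And>y. w y \<ge> 0" and "sigma_finite_measure M"
    and \<phi>[measurable]: "case_prod \<phi> \<in> borel_measurable (N \<Otimes>\<^sub>M M)"
    and h: "integrable M h"
  shows "(\<integral>\<^sup>+y. ennreal (w y) * ennreal ((norm (LINT m|M. cis (\<phi> y m) * h m))\<^sup>2) \<partial>N)
    \<le> (\<integral>\<^sup>+m. \<integral>\<^sup>+m'. ennreal (norm (h m) * norm (h m') * norm (LINT y|N. cis (\<phi> y m - \<phi> y m') * of_real (w y))) \<partial>M \<partial>M)"
proof -
  interpret M: sigma_finite_measure M by fact
  have [measurable]: "w \<in> borel_measurable N" "h \<in> borel_measurable M" using w h by auto
  define D where "D = density N (\<lambda>y. ennreal (w y))"
  have "emeasure D (space D) = (\<integral>\<^sup>+y. ennreal (w y) \<partial>N)"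
    unfolding D_def by (subst emeasure_density) (auto intro!: nn_integral_cong split: split_indicator)
  also have "\<dots> < \<infinity>" using w by (simp add: nn_integral_eq_integral)
  finally have D: "finite_measure D" by (intro finite_measureI) auto
  have sD: "sets (D \<Otimes>\<^sub>M M) = sets (N \<Otimes>\<^sub>M M)" by (intro sets_pair_measure_cong) (auto simp: D_def)
  have "case_prod \<phi> \<in> borel_measurable (D \<Otimes>\<^sub>M M)"
    unfolding measurable_cong_sets[OF sD refl] by measurable
  from TTstar_bound[OF D assms(3) this h]
  have "(\<integral>\<^sup>+y. ennreal ((norm (LINT m|M. cis (\<phi> y m) * h m))\<^sup>2) \<partial>D)
    \<le> (\<integral>\<^sup>+m. \<integral>\<^sup>+m'. ennreal (norm (h m) * norm (h m') * norm (LINT y|D. cis (\<phi> y m - \<phi> y m'))) \<partial>M \<partial>M)" .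
  also have "(\<integral>\<^sup>+y. ennreal ((norm (LINT m|M. cis (\<phi> y m) * h m))\<^sup>2) \<partial>D)
     = (\<integral>\<^sup>+y. ennreal (w y) * ennreal ((norm (LINT m|M. cis (\<phi> y m) * h m))\<^sup>2) \<partial>N)"
    unfolding D_def by (subst nn_integral_density) auto
  also have "(\<integral>\<^sup>+m. \<integral>\<^sup>+m'. ennreal (norm (h m) * norm (h m') * norm (LINT y|D. cis (\<phi> y m - \<phi> y m'))) \<partial>M \<partial>M)
     = (\<integral>\<^sup>+m. \<integral>\<^sup>+m'. ennreal (norm (h m) * norm (h m') * norm (LINT y|N. cis (\<phi> y m - \<phi> y m') * of_real (w y))) \<partial>M \<partial>M)"
  proof (intro nn_integral_cong)
    fix m m' assume [measurable]: "m \<in> space M" "m' \<in> space M"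
    have "(LINT y|D. cis (\<phi> y m - \<phi> y m')) = (LINT y|N. cis (\<phi> y m - \<phi> y m') * of_real (w y))"
      unfolding D_def using w
      by (subst integral_density) (auto simp: scaleR_conv_of_real mult.commute)
    then show "ennreal (norm (h m) * norm (h m') * norm (LINT y|D. cis (\<phi> y m - \<phi> y m')))
      = ennreal (norm (h m) * norm (h m') * norm (LINT y|N. cis (\<phi> y m - \<phi> y m') * of_real (w y)))" by simp
  qed
  finally show ?thesis .
qed

text \<open>Fatou's lemma removes a Gaussian cutoff from a bound that is uniform in the cutoff.\<close>

lemma nn_integral_le_of_gaussian_weights:
  fixes g :: "'a \<Rightarrow> real"
  assumes [measurable]: "g \<in> borel_measurable M" "F \<in> borel_measurable M"
    and le: "\<And>s. s > 0 \<Longrightarrow> (\<integral>\<^sup>+y. ennreal (exp (- s * g y)) * F y \<partial>M) \<le> B"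
  shows "(\<integral>\<^sup>+y. F y \<partial>M) \<le> B"
proof -
  define s where "s k = inverse (real (Suc k))" for k
  have lim: "(\<lambda>k. ennreal (exp (- s k * g y)) * F y) \<longlonglongrightarrow> F y" for y
  proof -
    have "s \<longlonglongrightarrow> 0" unfolding s_def by (rule LIMSEQ_inverse_real_of_nat)
    then have "(\<lambda>k. ennreal (exp (- s k * g y))) \<longlonglongrightarrow> ennreal (exp (- 0 * g y))"
      by (intro tendsto_intros tendsto_ennrealI)
    then have "(\<lambda>k. ennreal (exp (- s k * g y)) * F y) \<longlonglongrightarrow> ennreal (exp (- 0 * g y)) * F y"
      by (intro tendsto_mult_ennreal tendsto_const) auto
    then show ?thesis by simp
  qed
  have "(\<integral>\<^sup>+y. F y \<partial>M) = (\<integral>\<^sup>+y. liminf (\<lambda>k. ennreal (exp (- s k * g y)) * F y) \<partial>M)"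
    using lim_imp_Liminf[OF sequentially_bot lim] by simp
  also have "\<dots> \<le> liminf (\<lambda>k. \<integral>\<^sup>+y. ennreal (exp (- s k * g y)) * F y \<partial>M)"
    by (intro nn_integral_liminf) auto
  also have "\<dots> \<le> B"
    by (intro Liminf_le always_eventually allI le) (auto simp: s_def)
  finally show ?thesis .
qed

section \<open>The Fourier transform on square integrable functions\<close>

text \<open>The sign \<open>\<sigma>\<close> and, below, the constant factor \<open>c\<close> are parameters so that the Fourier transform and
  its inverse are treated together.\<close>

definition wave_integral :: "real \<Rightarrow> ('a::euclidean_space \<Rightarrow> complex) \<Rightarrow> 'a \<Rightarrow> complex" where
  "wave_integral \<sigma> f y = (LINT x|lborel. cis (\<sigma> * (x \<bullet> y)) * f x)"

lemma fourier_integral_eq: "fourier_integral f = wave_integral (- 1) f"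
  by (simp add: fun_eq_iff fourier_integral_def wave_integral_def)

lemma inv_fourier_integral_eq:
  "inv_fourier_integral g = (\<lambda>x::'a::euclidean_space. of_real (1 / (2 * pi) ^ DIM('a)) * wave_integral 1 g x)"
  by (simp add: fun_eq_iff inv_fourier_integral_def wave_integral_def inner_commute)

lemma wave_integral_measurable [measurable]:
  assumes [measurable]: "f \<in> borel_measurable lborel"
  shows "wave_integral \<sigma> f \<in> borel_measurable borel"
  unfolding wave_integral_def[abs_def] by measurable

lemma wave_integrable:
  assumes f: "integrable lborel f"
  shows "integrable lborel (\<lambda>x. cis (\<sigma> * (x \<bullet> y)) * f x)"
proof -
  have [measurable]: "f \<in> borel_measurable lborel" using f by auto
  show ?thesis by (rule Bochner_Integration.integrable_bound[OF f]) (auto simp: norm_mult)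
qed

lemma wave_integral_diff:
  assumes "integrable lborel f" "integrable lborel g"
  shows "wave_integral \<sigma> (\<lambda>x. f x - g x) y = wave_integral \<sigma> f y - wave_integral \<sigma> g y"
  unfolding wave_integral_def
  by (simp add: right_diff_distrib wave_integrable assms)

lemma wave_integral_bound:
  assumes "integrable lborel f"
  shows "norm (wave_integral \<sigma> f y) \<le> (LINT x|lborel. norm (f x))"
  unfolding wave_integral_def using integral_norm_bound[of lborel "\<lambda>x. cis (\<sigma> * (x \<bullet> y)) * f x"]
  by (simp add: norm_mult)

text \<open>With the Gaussian weight \<open>exp (- s \<bar>y\<bar>\<^sup>2)\<close> the kernel of the \<open>T T\<^sup>*\<close> form is a Gaussian of mass
  \<open>(2 \<pi>)\<^sup>n\<close>, whatever \<open>s\<close>, so that the bound given by Schur's test persists as \<open>s\<close> tends to \<open>0\<close>.\<close>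

lemma plancherel_le:
  fixes f :: "'a::euclidean_space \<Rightarrow> complex"
  assumes f: "integrable lborel f" and \<sigma>: "\<bar>\<sigma>\<bar> = 1"
  shows "nn_L2 lborel (wave_integral \<sigma> f) \<le> ennreal ((2 * pi) ^ DIM('a)) * nn_L2 lborel f"
  unfolding nn_L2_def[of _ "wave_integral \<sigma> f"]
proof (rule nn_integral_le_of_gaussian_weights[where g="\<lambda>y. (norm y)\<^sup>2"])
  have [measurable]: "f \<in> borel_measurable lborel" using f by auto
  show "(\<lambda>y. ennreal ((norm (wave_integral \<sigma> f y))\<^sup>2)) \<in> borel_measurable lborel" by measurable
  fix s :: real assume s: "s > 0"
  have K: "(LINT y|lborel. cis (\<sigma> * (x \<bullet> y) - \<sigma> * (x' \<bullet> y)) * of_real (exp (- s * (norm y)\<^sup>2)))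
      = of_real (gauss_hat s (x - x'))" for x x' :: 'a
  proof -
    have "(norm (\<sigma> *\<^sub>R (x - x')))\<^sup>2 = (norm (x - x'))\<^sup>2" using \<sigma> by simp
    then have "gauss_hat s (\<sigma> *\<^sub>R (x - x')) = gauss_hat s (x - x')" unfolding gauss_hat_def by simp
    moreover have "\<sigma> * (x \<bullet> y) - \<sigma> * (x' \<bullet> y) = y \<bullet> (\<sigma> *\<^sub>R (x - x'))" for y
      by (simp add: inner_diff_right inner_commute algebra_simps)
    ultimately show ?thesis using gaussian_fourier(1)[OF s, of "\<sigma> *\<^sub>R (x - x')"] by simp
  qed
  have "(\<integral>\<^sup>+y. ennreal (exp (- s * (norm y)\<^sup>2)) * ennreal ((norm (wave_integral \<sigma> f y))\<^sup>2) \<partial>lborel)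
    \<le> (\<integral>\<^sup>+x. \<integral>\<^sup>+x'. ennreal (norm (f x) * norm (f x') * gauss_hat s (x - x')) \<partial>lborel \<partial>lborel)"
    unfolding wave_integral_def
    by (rule order_trans[OF weighted_TTstar_bound[OF gaussian_integrable[OF s] _ sigma_finite_lborel _ f]])
       (use s in \<open>auto simp: K[unfolded mult_minus_left] gauss_hat_nonneg\<close>)
  also have "\<dots> \<le> (\<integral>\<^sup>+x. ennreal ((norm (f x))\<^sup>2) * (\<integral>\<^sup>+x'. ennreal (gauss_hat s (x - x')) \<partial>lborel) \<partial>lborel)"
    by (intro schur_test sigma_finite_lborel gauss_hat_nonneg s) (auto simp: gauss_hat_def norm_minus_commute)
  also have "\<dots> = ennreal ((2 * pi) ^ DIM('a)) * nn_L2 lborel f"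
    unfolding gauss_hat_nn_integral[OF s] nn_L2_def by (simp add: nn_integral_multc mult.commute)
  finally show "(\<integral>\<^sup>+y. ennreal (exp (- s * (norm y)\<^sup>2)) * ennreal ((norm (wave_integral \<sigma> f y))\<^sup>2) \<partial>lborel)
    \<le> ennreal ((2 * pi) ^ DIM('a)) * nn_L2 lborel f" .
qed simp

definition wave_L2 :: "real \<Rightarrow> complex \<Rightarrow> ('a::euclidean_space \<Rightarrow> complex) \<Rightarrow> 'a \<Rightarrow> complex" where
  "wave_L2 \<sigma> c f = L2_lim (\<lambda>R y. c * wave_integral \<sigma> (cutoff R f) y)"

lemma fourier_L2_eq: "fourier_L2 f = wave_L2 (- 1) 1 f"
  by (simp add: fourier_L2_def wave_L2_def fourier_integral_eq)

lemma inv_fourier_L2_eq: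
  "inv_fourier_L2 (f :: 'a::euclidean_space \<Rightarrow> complex) = wave_L2 1 (of_real (1 / (2 * pi) ^ DIM('a))) f"
  by (simp add: inv_fourier_L2_def wave_L2_def inv_fourier_integral_eq)

text \<open>The Plancherel constant for \<open>c\<close> times the wave integral; the type argument supplies the dimension.\<close>

definition wave_const :: "complex \<Rightarrow> 'a::euclidean_space itself \<Rightarrow> ennreal" where
  "wave_const c _ = ennreal ((norm c)\<^sup>2 * (2 * pi) ^ DIM('a))"

lemma wave_const_finite: "wave_const c t < \<infinity>" by (simp add: wave_const_def)

lemma plancherel_const_le:
  fixes f :: "'a::euclidean_space \<Rightarrow> complex"
  assumes f: "integrable lborel f" and \<sigma>: "\<bar>\<sigma>\<bar> = 1"
  shows "nn_L2 lborel (\<lambda>y. c * wave_integral \<sigma> f y) \<le> wave_const c TYPE('a) * nn_L2 lborel f"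
proof -
  have [measurable]: "f \<in> borel_measurable lborel" using f by auto
  have "nn_L2 lborel (\<lambda>y. c * wave_integral \<sigma> f y) = ennreal ((norm c)\<^sup>2) * nn_L2 lborel (wave_integral \<sigma> f)"
    by (intro nn_L2_cmult) measurable
  also have "\<dots> \<le> ennreal ((norm c)\<^sup>2) * (ennreal ((2 * pi) ^ DIM('a)) * nn_L2 lborel f)"
    by (intro mult_left_mono plancherel_le assms) auto
  finally show ?thesis by (simp add: wave_const_def ennreal_mult mult.assoc)
qed

context
  fixes \<sigma> :: real and c :: complex
  assumes \<sigma>: "\<bar>\<sigma>\<bar> = 1"
begin

lemma wave_L2_limit:
  fixes f :: "'a::euclidean_space \<Rightarrow> complex"
  assumes f: "in_L2 lborel f"
  shows "in_L2 lborel (wave_L2 \<sigma> c f)"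
    and "((\<lambda>R. nn_L2 lborel (\<lambda>y. c * wave_integral \<sigma> (cutoff R f) y - wave_L2 \<sigma> c f y)) \<longlongrightarrow> 0) at_top"
proof -
  define g where "g = (\<lambda>R x. indicator (cball 0 R) x *\<^sub>R f x)"
  have g_def': "g R x = indicator (cball 0 R) x *\<^sub>R f x" for R x by (simp add: g_def)
  have g: "integrable lborel (g R)" "in_L2 lborel (g R)" for R
    unfolding g_def by (intro integrable_cutoff in_L2_cutoff f)+
  note [measurable] = f[THEN in_L2_measurable] g(2)[THEN in_L2_measurable]
  have fin: "nn_L2 lborel (\<lambda>y. c * wave_integral \<sigma> (g R) y) < \<infinity>" for R
    using g(2)[of R] by (intro le_less_trans[OF plancherel_const_le[OF g(1) \<sigma>]])
       (auto simp: in_L2_iff ennreal_mult_less_top wave_const_def)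
  have cauchy: "\<exists>N. \<forall>R\<ge>N. \<forall>R'\<ge>N. nn_L2 lborel (\<lambda>y. c * wave_integral \<sigma> (g R) y - c * wave_integral \<sigma> (g R') y) \<le> ennreal e"
    if e: "e > 0" for e
  proof -
    obtain N where N: "\<forall>R\<ge>N. \<forall>R'\<ge>N. wave_const c TYPE('a) * nn_L2 lborel (\<lambda>x. g R x - g R' x) \<le> ennreal e"
      using scaled_L2_Cauchy[OF _ _ nn_L2_cutoff_tendsto[OF f, folded g_def'] wave_const_finite[of c "TYPE('a)"] e] by auto
    show ?thesis
    proof (intro exI allI impI)
      fix R R' assume R: "R \<ge> N" "R' \<ge> N"
      have "nn_L2 lborel (\<lambda>y. c * wave_integral \<sigma> (g R) y - c * wave_integral \<sigma> (g R') y)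
         = nn_L2 lborel (\<lambda>y. c * wave_integral \<sigma> (\<lambda>x. g R x - g R' x) y)"
        by (simp add: wave_integral_diff g right_diff_distrib)
      also have "\<dots> \<le> wave_const c TYPE('a) * nn_L2 lborel (\<lambda>x. g R x - g R' x)"
        by (intro plancherel_const_le Bochner_Integration.integrable_diff g \<sigma>)
      also have "\<dots> \<le> ennreal e" using N R by blast
      finally show "nn_L2 lborel (\<lambda>y. c * wave_integral \<sigma> (g R) y - c * wave_integral \<sigma> (g R') y) \<le> ennreal e" .
    qed
  qed
  from L2_lim_exists[of "\<lambda>R y. c * wave_integral \<sigma> (g R) y", OF _ fin cauchy]
  show "in_L2 lborel (wave_L2 \<sigma> c f)"
    "((\<lambda>R. nn_L2 lborel (\<lambda>y. c * wave_integral \<sigma> (cutoff R f) y - wave_L2 \<sigma> c f y)) \<longlongrightarrow> 0) at_top"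
    by (auto simp: wave_L2_def g_def)
qed

lemma wave_L2_bound:
  fixes f :: "'a::euclidean_space \<Rightarrow> complex"
  assumes f: "in_L2 lborel f"
  shows "nn_L2 lborel (wave_L2 \<sigma> c f) \<le> 2 * (wave_const c TYPE('a) * nn_L2 lborel f)"
proof (rule nn_L2_limit_le[OF _ _ wave_L2_limit(2)[OF f]])
  note [measurable] = f[THEN in_L2_measurable] wave_L2_limit(1)[OF f, THEN in_L2_measurable]
    in_L2_cutoff[OF f, THEN in_L2_measurable]
  show "(\<lambda>y. c * wave_integral \<sigma> (cutoff R f) y) \<in> borel_measurable lborel" for R
    by measurable
  show "wave_L2 \<sigma> c f \<in> borel_measurable lborel" by measurable
  show "\<forall>\<^sub>F R in at_top. nn_L2 lborel (\<lambda>y. c * wave_integral \<sigma> (cutoff R f) y)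
      \<le> wave_const c TYPE('a) * nn_L2 lborel f"
  proof (intro always_eventually allI)
    fix R
    have "nn_L2 lborel (\<lambda>y. c * wave_integral \<sigma> (cutoff R f) y)
      \<le> wave_const c TYPE('a) * nn_L2 lborel (cutoff R f)"
      by (intro plancherel_const_le \<sigma> integrable_cutoff f)
    also have "\<dots> \<le> wave_const c TYPE('a) * nn_L2 lborel f"
      by (intro mult_left_mono nn_L2_mono) (auto split: split_indicator)
    finally show "nn_L2 lborel (\<lambda>y. c * wave_integral \<sigma> (cutoff R f) y) \<le> \<dots>" .
  qed
qed simp

lemma wave_L2_eq_integral:
  fixes f :: "'a::euclidean_space \<Rightarrow> complex"
  assumes f: "in_L2 lborel f" "integrable lborel f"
  shows "AE y in lborel. wave_L2 \<sigma> c f y = c * wave_integral \<sigma> f y"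
proof (rule L2_limit_unique[OF _ _ _ wave_L2_limit(2)[OF f(1)]])
  note [measurable] = f(1)[THEN in_L2_measurable] wave_L2_limit(1)[OF f(1), THEN in_L2_measurable]
    in_L2_cutoff[OF f(1), THEN in_L2_measurable]
  show "(\<lambda>y. c * wave_integral \<sigma> (cutoff R f) y) \<in> borel_measurable lborel" for R
    by measurable
  show "wave_L2 \<sigma> c f \<in> borel_measurable lborel" "(\<lambda>y. c * wave_integral \<sigma> f y) \<in> borel_measurable lborel" by measurable
  have "((\<lambda>R. wave_const c TYPE('a) * nn_L2 lborel (\<lambda>x. indicator (cball 0 R) x *\<^sub>R f x - f x)) \<longlongrightarrow> wave_const c TYPE('a) * 0) at_top"
    by (intro ennreal_tendsto_cmult nn_L2_cutoff_tendsto f) (auto simp: wave_const_def)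
  then have l0: "((\<lambda>R. wave_const c TYPE('a) * nn_L2 lborel (\<lambda>x. indicator (cball 0 R) x *\<^sub>R f x - f x)) \<longlongrightarrow> 0) at_top" by simp
  show "((\<lambda>R. nn_L2 lborel (\<lambda>y. c * wave_integral \<sigma> (cutoff R f) y - c * wave_integral \<sigma> f y)) \<longlongrightarrow> 0) at_top"
  proof (rule tendsto_sandwich[OF _ _ tendsto_const l0])
    show "\<forall>\<^sub>F R in at_top. nn_L2 lborel (\<lambda>y. c * wave_integral \<sigma> (cutoff R f) y - c * wave_integral \<sigma> f y)
      \<le> wave_const c TYPE('a) * nn_L2 lborel (\<lambda>x. indicator (cball 0 R) x *\<^sub>R f x - f x)"
    proof (intro always_eventually allI)
      fix R
      have "(\<lambda>y. c * wave_integral \<sigma> (cutoff R f) y - c * wave_integral \<sigma> f y)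
        = (\<lambda>y. c * wave_integral \<sigma> (\<lambda>x. indicator (cball 0 R) x *\<^sub>R f x - f x) y)"
        by (simp add: wave_integral_diff integrable_cutoff f right_diff_distrib)
      then show "nn_L2 lborel (\<lambda>y. c * wave_integral \<sigma> (cutoff R f) y - c * wave_integral \<sigma> f y)
        \<le> wave_const c TYPE('a) * nn_L2 lborel (\<lambda>x. indicator (cball 0 R) x *\<^sub>R f x - f x)"
        using plancherel_const_le[OF Bochner_Integration.integrable_diff[OF integrable_cutoff[OF f(1)] f(2)] \<sigma>, of c R] by simp
    qed
  qed auto
qed simp

lemma wave_L2_diff:
  fixes f g :: "'a::euclidean_space \<Rightarrow> complex"
  assumes f: "in_L2 lborel f" and g: "in_L2 lborel g"
  shows "nn_L2 lborel (\<lambda>y. wave_L2 \<sigma> c f y - wave_L2 \<sigma> c g y) \<le> 2 * (wave_const c TYPE('a) * nn_L2 lborel (\<lambda>x. f x - g x))"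
proof -
  define cut where "cut R h = (cutoff R h)" for R and h :: "'a \<Rightarrow> complex"
  note L = wave_L2_limit(2)[OF f, folded cut_def] wave_L2_limit(2)[OF g, folded cut_def]
  have I: "integrable lborel (cut R f)" "integrable lborel (cut R g)" for R
    unfolding cut_def by (intro integrable_cutoff f g)+
  note [measurable] = f[THEN in_L2_measurable] wave_L2_limit(1)[OF f, THEN in_L2_measurable]
    g[THEN in_L2_measurable] wave_L2_limit(1)[OF g, THEN in_L2_measurable]
    I[THEN borel_measurable_integrable]
  let ?F = "\<lambda>R y. c * wave_integral \<sigma> (cut R f) y - c * wave_integral \<sigma> (cut R g) y"
  show ?thesis
  proof (rule nn_L2_limit_le[where F="?F" and A=at_top])
    have "((\<lambda>R. 2 * nn_L2 lborel (\<lambda>y. c * wave_integral \<sigma> (cut R f) y - wave_L2 \<sigma> c f y)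
       + 2 * nn_L2 lborel (\<lambda>y. c * wave_integral \<sigma> (cut R g) y - wave_L2 \<sigma> c g y)) \<longlongrightarrow> 2 * 0 + 2 * 0) at_top"
      by (intro tendsto_add ennreal_tendsto_cmult L) auto
    then have l0: "((\<lambda>R. 2 * nn_L2 lborel (\<lambda>y. c * wave_integral \<sigma> (cut R f) y - wave_L2 \<sigma> c f y)
       + 2 * nn_L2 lborel (\<lambda>y. c * wave_integral \<sigma> (cut R g) y - wave_L2 \<sigma> c g y)) \<longlongrightarrow> 0) at_top" by simp
    show "((\<lambda>R. nn_L2 lborel (\<lambda>y. ?F R y - (wave_L2 \<sigma> c f y - wave_L2 \<sigma> c g y))) \<longlongrightarrow> 0) at_top"
    proof (rule tendsto_sandwich[OF _ _ tendsto_const l0])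
      show "\<forall>\<^sub>F R in at_top. nn_L2 lborel (\<lambda>y. ?F R y - (wave_L2 \<sigma> c f y - wave_L2 \<sigma> c g y))
        \<le> 2 * nn_L2 lborel (\<lambda>y. c * wave_integral \<sigma> (cut R f) y - wave_L2 \<sigma> c f y)
       + 2 * nn_L2 lborel (\<lambda>y. c * wave_integral \<sigma> (cut R g) y - wave_L2 \<sigma> c g y)"
      proof (intro always_eventually allI)
        fix R
        have "(\<lambda>y. ?F R y - (wave_L2 \<sigma> c f y - wave_L2 \<sigma> c g y))
          = (\<lambda>y. (c * wave_integral \<sigma> (cut R f) y - wave_L2 \<sigma> c f y) + (wave_L2 \<sigma> c g y - c * wave_integral \<sigma> (cut R g) y))"
          by (simp add: algebra_simps)
        then show "nn_L2 lborel (\<lambda>y. ?F R y - (wave_L2 \<sigma> c f y - wave_L2 \<sigma> c g y))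
          \<le> 2 * nn_L2 lborel (\<lambda>y. c * wave_integral \<sigma> (cut R f) y - wave_L2 \<sigma> c f y)
          + 2 * nn_L2 lborel (\<lambda>y. c * wave_integral \<sigma> (cut R g) y - wave_L2 \<sigma> c g y)"
          using nn_L2_add_le[of "\<lambda>y. c * wave_integral \<sigma> (cut R f) y - wave_L2 \<sigma> c f y" lborel
             "\<lambda>y. wave_L2 \<sigma> c g y - c * wave_integral \<sigma> (cut R g) y"]
          by (simp add: nn_L2_uminus[of _ "wave_L2 \<sigma> c g"])
      qed
    qed auto
    show "\<forall>\<^sub>F R in at_top. nn_L2 lborel (?F R) \<le> wave_const c TYPE('a) * nn_L2 lborel (\<lambda>x. f x - g x)"
    proof (intro always_eventually allI)
      fix R
      have "?F R = (\<lambda>y. c * wave_integral \<sigma> (\<lambda>x. cut R f x - cut R g x) y)"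
        by (simp add: wave_integral_diff I right_diff_distrib)
      then have "nn_L2 lborel (?F R) \<le> wave_const c TYPE('a) * nn_L2 lborel (\<lambda>x. cut R f x - cut R g x)"
        using plancherel_const_le[OF Bochner_Integration.integrable_diff[OF I] \<sigma>, of c R] by simp
      also have "\<dots> \<le> wave_const c TYPE('a) * nn_L2 lborel (\<lambda>x. f x - g x)"
        by (intro mult_left_mono nn_L2_mono) (auto simp: cut_def split: split_indicator)
      finally show "nn_L2 lborel (?F R) \<le> wave_const c TYPE('a) * nn_L2 lborel (\<lambda>x. f x - g x)" .
    qed
  qed auto
qed

end

text \<open>The multiplication formula: Fubini for the symmetric kernel \<open>cis (\<sigma> (x \<bullet> y))\<close>.\<close>

lemma wave_integral_exchange:
  fixes f g :: "'a::euclidean_space \<Rightarrow> complex"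
  assumes f: "integrable lborel f" and g: "integrable lborel g"
  shows "(LINT y|lborel. wave_integral \<sigma> f y * g y) = (LINT x|lborel. f x * wave_integral \<sigma> g x)"
proof -
  have [measurable]: "f \<in> borel_measurable lborel" "g \<in> borel_measurable lborel" using f g by auto
  have i: "integrable (lborel \<Otimes>\<^sub>M lborel) (\<lambda>(x, y). cis (\<sigma> * (x \<bullet> y)) * f x * g y)"
    by (rule Bochner_Integration.integrable_bound[OF lborel_pair.integrable_mult_pair[OF f g]])
       (auto simp: norm_mult)
  have "(LINT y|lborel. wave_integral \<sigma> f y * g y) = (LINT y|lborel. LINT x|lborel. cis (\<sigma> * (x \<bullet> y)) * f x * g y)"
    unfolding wave_integral_def by simp
  also have "\<dots> = (LINT x|lborel. LINT y|lborel. cis (\<sigma> * (x \<bullet> y)) * f x * g y)"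
    by (rule lborel_pair.Fubini_integral[OF i])
  also have "\<dots> = (LINT x|lborel. f x * wave_integral \<sigma> g x)"
    unfolding wave_integral_def by (simp add: mult_ac inner_commute flip: integral_mult_right_zero)
  finally show ?thesis .
qed

section \<open>Fourier inversion\<close>

text \<open>After restriction to a large box \<open>D\<close> is integrable, and the Borel sets over which its integral
  vanishes form a Dynkin class containing the boxes.\<close>

lemma L2_zero_of_box_integrals:
  fixes D :: "'a::euclidean_space \<Rightarrow> complex"
  assumes D: "in_L2 lborel D" and box0: "\<And>a b. (LINT x|lborel. D x * indicator (box a b) x) = 0"
  shows "AE x in lborel. D x = 0"
proof -
  note [measurable] = D[THEN in_L2_measurable]
  define B where "B N = box (- (real N *\<^sub>R One)) (real N *\<^sub>R One :: 'a)" for N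
  have [measurable]: "B N \<in> sets borel" for N by (simp add: B_def)
  define E where "E N x = D x * indicator (B N) x" for N x
  have iE: "integrable lborel (E N)" for N
  proof -
    have "nn_L2 lborel (indicator (B N)) = (\<integral>\<^sup>+x. indicator (B N) x \<partial>lborel)"
      unfolding nn_L2_def by (intro nn_integral_cong) (auto split: split_indicator)
    also have "\<dots> < \<infinity>" by (simp add: B_def emeasure_lborel_box_finite[unfolded infinity_ennreal_def])
    finally have "in_L2 lborel (indicator (B N))" by (simp add: in_L2_iff B_def)
    from L2_mult_integrable[OF D this] show ?thesis by (simp add: E_def[abs_def])
  qed
  have E0: "(LINT x|lborel. E N x * indicator A x) = 0" if "A \<in> sets (borel :: 'a measure)" for A N
  proof -
    let ?G = "range (\<lambda>(a, b). box a b::'a set)"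
    have "Int_stable ?G" by (auto simp: Int_stable_def box_Int_box)
    moreover have "?G \<subseteq> Pow UNIV" by auto
    moreover have "A \<in> sigma_sets UNIV ?G" using that by (simp add: borel_eq_box)
    ultimately show ?thesis
    proof (induction rule: sigma_sets_induct_disjoint)
      case (basic A)
      then obtain a b where A: "A = box a b" by auto
      obtain c d where "B N \<inter> box a b = box c d" unfolding B_def box_Int_box by blast
      then have "E N x * indicator A x = D x * indicator (box c d) x" for x
        by (auto simp: E_def A split: split_indicator)
      with box0[of c d] show ?case by simp
    next
      case empty then show ?case by simp
    next
      case (compl A)
      have [measurable]: "A \<in> sets borel" using compl by (simp add: borel_eq_box)
      have "(LINT x|lborel. E N x * indicator (UNIV - A) x) = (LINT x|lborel. E N x - E N x * indicator A x)"
        by (intro Bochner_Integration.integral_cong) (auto split: split_indicator)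
      also have "\<dots> = (LINT x|lborel. E N x) - (LINT x|lborel. E N x * indicator A x)"
        by (intro Bochner_Integration.integral_diff iE Bochner_Integration.integrable_bound[OF iE[of N]])
           (auto simp: E_def split: split_indicator)
      also have "\<dots> = 0" using compl box0 by (simp add: E_def B_def)
      finally show ?case .
    next
      case (union A)
      have [measurable]: "A i \<in> sets borel" for i using union(2) by (auto simp: borel_eq_box)
      have "(\<lambda>n. LINT x|lborel. (\<Sum>i<n. E N x * indicator (A i) x)) \<longlonglongrightarrow> (LINT x|lborel. E N x * indicator (\<Union>i. A i) x)"
      proof (rule integral_dominated_convergence[where w="\<lambda>x. norm (E N x)"])
        show "AE x in lborel. (\<lambda>n. \<Sum>i<n. E N x * indicator (A i) x) \<longlonglongrightarrow> E N x * indicator (\<Union>i. A i) x"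
        proof (rule AE_I2)
          fix x
          have "(\<lambda>i. indicator (A i) x :: complex) sums indicator (\<Union>i. A i) x"
          proof (cases "x \<in> (\<Union>i. A i)")
            case True
            then obtain j where j: "x \<in> A j" by auto
            then have "indicator (A i) x = (if i = j then 1 else 0 :: complex)" for i
              using union(1) by (auto simp: disjoint_family_on_def split: split_indicator)
            then show ?thesis using sums_single[of j "\<lambda>_. 1 :: complex"] True by simp
          qed auto
          from sums_mult[OF this, of "E N x"]
          show "(\<lambda>n. \<Sum>i<n. E N x * indicator (A i) x) \<longlonglongrightarrow> E N x * indicator (\<Union>i. A i) x"
            by (simp add: sums_def)
        qed
        show "AE x in lborel. norm (\<Sum>i<n. E N x * indicator (A i) x) \<le> norm (E N x)" for n
        proof (rule AE_I2)
          fix x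
          have "disjoint_family_on A {..<n}" using union(1) by (auto simp: disjoint_family_on_def)
          then have "(\<Sum>i<n. indicator (A i) x :: complex) = indicator (\<Union>i<n. A i) x"
            by (intro indicator_UN_disjoint[symmetric]) auto
          then show "norm (\<Sum>i<n. E N x * indicator (A i) x) \<le> norm (E N x)"
            by (simp add: sum_distrib_left[symmetric] norm_mult mult_le_cancel_left1 split: split_indicator)
        qed
      next
        show "integrable lborel (\<lambda>x. norm (E N x))" by (intro integrable_norm iE)
      qed (auto simp: E_def)
      moreover have "(LINT x|lborel. (\<Sum>i<n. E N x * indicator (A i) x)) = 0" for n
        using union(3)
        by (subst Bochner_Integration.integral_sum)
           (auto intro!: Bochner_Integration.integrable_bound[OF iE[of N]] simp: E_def B_def split: split_indicator)
      ultimately show ?case by (simp add: LIMSEQ_const_iff)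
    qed
  qed
  have "AE x in lborel. E N x = 0" for N
  proof (rule sigma_finite_measure.density_zero[OF sigma_finite_lborel iE])
    fix A assume "A \<in> sets (lborel :: 'a measure)"
    then show "set_lebesgue_integral lborel A (E N) = 0"
      using E0[of A N] unfolding set_lebesgue_integral_def
      by (simp add: scaleR_conv_of_real mult.commute of_real_indicator)
  qed
  then have "AE x in lborel. \<forall>N. E N x = 0" by (simp add: AE_all_countable)
  then show ?thesis
  proof eventually_elim
    case (elim x)
    have "x \<in> (\<Union>N. B N)" unfolding B_def UN_box_eq_UNIV by simp
    then obtain N where "x \<in> B N" by blast
    then show ?case using elim[rule_format, of N] by (simp add: E_def)
  qed
qed

lemma lborel_integral_affine:
  fixes f :: "'a::euclidean_space \<Rightarrow> real"
  assumes [measurable]: "f \<in> borel_measurable borel" and c: "c \<noteq> 0"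
  shows "(LINT x|lborel. f x) = \<bar>c\<bar> ^ DIM('a) * (LINT x|lborel. f (t + c *\<^sub>R x))"
  by (subst lborel_affine[OF c, of t])
     (simp add: integral_density integral_distr)

lemma gauss_hat_integrable:
  assumes a: "a > 0"
  shows "integrable lborel (\<lambda>\<xi>::'a::euclidean_space. gauss_hat a (\<eta> - \<xi>))"
    and "(LINT \<xi>|lborel. gauss_hat a (\<eta> - \<xi> :: 'a)) = (2 * pi) ^ DIM('a)"
proof -
  show i: "integrable lborel (\<lambda>\<xi>::'a. gauss_hat a (\<eta> - \<xi>))"
    using gauss_hat_nn_integral[OF a, of \<eta>]
    by (intro integrableI_nonneg) (auto simp: gauss_hat_nonneg[OF a])
  show "(LINT \<xi>|lborel. gauss_hat a (\<eta> - \<xi> :: 'a)) = (2 * pi) ^ DIM('a)"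
    using gauss_hat_nn_integral[OF a, of \<eta>] i gauss_hat_nonneg[OF a]
    by (subst (asm) nn_integral_eq_integral) (auto intro!: integral_nonneg_AE)
qed

text \<open>Gaussian means form an approximate identity. For indicators of sets this is dominated
  convergence after rescaling, as the indicator is continuous off the frontier.\<close>

lemma gauss_hat_approximates:
  fixes B :: "'a::euclidean_space set"
  assumes [measurable]: "B \<in> sets borel" and \<eta>: "\<eta> \<notin> frontier B"
    and s: "\<And>k. s k > 0" "s \<longlonglongrightarrow> 0"
  shows "(\<lambda>k. LINT \<xi>|lborel. gauss_hat (s k) (\<eta> - \<xi>) * indicator B \<xi>) \<longlonglongrightarrow> (2 * pi) ^ DIM('a) * indicator B \<eta>"
proof -
  have "(LINT \<xi>|lborel. gauss_hat (s k) (\<eta> - \<xi>) * indicator B \<xi>)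
      = (LINT \<zeta>|lborel. gauss_hat 1 (0 - \<zeta>) * indicator B (\<eta> + sqrt (s k) *\<^sub>R \<zeta>))" for k
  proof -
    have "\<bar>sqrt (s k)\<bar> ^ DIM('a) * gauss_hat (s k) (\<eta> - (\<eta> + sqrt (s k) *\<^sub>R \<zeta>)) = gauss_hat 1 (0 - \<zeta>)" for \<zeta> :: 'a
      using s(1)[of k] by (simp add: gauss_hat_def power_mult_distrib real_sqrt_divide power_divide)
    moreover have "(LINT \<xi>|lborel. gauss_hat (s k) (\<eta> - \<xi>) * indicator B \<xi>)
      = \<bar>sqrt (s k)\<bar> ^ DIM('a) * (LINT \<zeta>|lborel. gauss_hat (s k) (\<eta> - (\<eta> + sqrt (s k) *\<^sub>R \<zeta>)) * indicator B (\<eta> + sqrt (s k) *\<^sub>R \<zeta>))"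
      using s(1)[of k] by (subst lborel_integral_affine[where c="sqrt (s k)" and t=\<eta>]) auto
    ultimately show ?thesis
      by (simp only: integral_mult_right_zero[symmetric] mult.assoc[symmetric])
  qed
  moreover have "(\<lambda>k. LINT \<zeta>|lborel. gauss_hat 1 (0 - \<zeta>) * indicator B (\<eta> + sqrt (s k) *\<^sub>R \<zeta>))
      \<longlonglongrightarrow> (LINT \<zeta>|lborel. gauss_hat 1 (0 - \<zeta> :: 'a) * indicator B \<eta>)"
  proof (rule integral_dominated_convergence[OF _ _ gauss_hat_integrable(1)[of 1 0]])
    show "AE \<zeta> in lborel. (\<lambda>k. gauss_hat 1 (0 - \<zeta>) * indicator B (\<eta> + sqrt (s k) *\<^sub>R \<zeta>)) \<longlonglongrightarrow> gauss_hat 1 (0 - \<zeta> :: 'a) * indicator B \<eta>"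
    proof (rule AE_I2)
      fix \<zeta> :: 'a
      have "(\<lambda>k. \<eta> + sqrt (s k) *\<^sub>R \<zeta>) \<longlonglongrightarrow> \<eta> + sqrt 0 *\<^sub>R \<zeta>"
        by (intro tendsto_intros s)
      moreover have "isCont (indicator B :: 'a \<Rightarrow> real) \<eta>" using \<eta> by (simp add: isCont_indicator)
      ultimately have "(\<lambda>k. indicator B (\<eta> + sqrt (s k) *\<^sub>R \<zeta>) :: real) \<longlonglongrightarrow> indicator B \<eta>"
        by (auto intro: isCont_tendsto_compose)
      then show "(\<lambda>k. gauss_hat 1 (0 - \<zeta>) * indicator B (\<eta> + sqrt (s k) *\<^sub>R \<zeta>)) \<longlonglongrightarrow> gauss_hat 1 (0 - \<zeta> :: 'a) * indicator B \<eta>"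
        by (intro tendsto_intros)
    qed
  qed (auto simp: gauss_hat_nonneg intro!: AE_I2 split: split_indicator)
  ultimately show ?thesis using gauss_hat_integrable(2)[of 1 "0::'a"] by simp
qed

text \<open>Fourier inversion for integrable and square integrable functions. The Gaussian cutoffs of
  the inverse transform have as their Fourier transforms the Gaussian means of \<open>g\<close>; both sides
  are compared through their integrals over boxes.\<close>

lemma fourier_inversion_integrable:
  fixes g :: "'a::euclidean_space \<Rightarrow> complex"
  assumes g: "in_L2 lborel g" "integrable lborel g"
  shows "AE \<xi> in lborel. wave_L2 (- 1) 1 (inv_fourier_integral g) \<xi> = g \<xi>"
proof -
  note [measurable] = g(1)[THEN in_L2_measurable]
  define c where "c = complex_of_real (1 / (2 * pi) ^ DIM('a))"
  define G where "G = inv_fourier_integral g"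
  have G_eq: "G = (\<lambda>x. c * wave_integral 1 g x)" by (simp add: G_def inv_fourier_integral_eq c_def)
  have [measurable]: "G \<in> borel_measurable borel" unfolding G_eq by measurable
  have G: "in_L2 lborel G"
    using plancherel_const_le[OF g(2), of 1 c] g(1) unfolding G_eq
    by (auto simp: in_L2_iff wave_const_def ennreal_mult_less_top elim!: le_less_trans)
  have Gb: "norm (G x) \<le> norm c * (LINT x|lborel. norm (g x))" for x
    unfolding G_eq norm_mult by (intro mult_left_mono wave_integral_bound g) auto
  define s where "s k = inverse (real (Suc k))" for k
  have s: "s k > 0" "s \<longlonglongrightarrow> 0" for k
    using LIMSEQ_inverse_real_of_nat by (simp_all add: s_def[abs_def] del: of_nat_Suc)
  define e where "e k x = exp (- s k * (norm (x::'a))\<^sup>2)" for k x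
  have e: "0 < e k x" "e k x \<le> 1" for k x using s(1)[of k] by (auto simp: e_def)
  have [measurable]: "e k \<in> borel_measurable borel" for k unfolding e_def[abs_def] by measurable
  define Gk where "Gk k x = of_real (e k x) * G x" for k x
  have [measurable]: "Gk k \<in> borel_measurable borel" for k unfolding Gk_def[abs_def] by measurable
  have Gk: "in_L2 lborel (Gk k)" for k
  proof -
    have "norm (Gk k x) \<le> norm (G x)" for x
      using e[of k x] by (simp add: Gk_def norm_mult mult_left_le_one_le)
    then have "nn_L2 lborel (Gk k) \<le> nn_L2 lborel G" by (intro nn_L2_mono)
    with G show ?thesis by (auto simp: in_L2_iff)
  qed
  have ie: "integrable lborel (e k)" for k
    unfolding e_def[abs_def] using gaussian_integrable[OF s(1)] .
  have iGk: "integrable lborel (Gk k)" for k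
  proof (rule Bochner_Integration.integrable_bound)
    show "integrable lborel (\<lambda>x. (norm c * (LINT x|lborel. norm (g x))) * e k x)"
      by (intro integrable_mult_right ie)
    show "AE x in lborel. norm (Gk k x) \<le> norm ((norm c * (LINT x|lborel. norm (g x))) * e k x)"
      using e[of k] by (intro AE_I2) (auto simp: Gk_def norm_mult abs_mult less_imp_le mult.commute intro!: mult_right_mono Gb order_trans[OF Gb])
  qed measurable
  have "(\<lambda>k. LINT x|lborel. (norm (Gk k x - G x))\<^sup>2) \<longlonglongrightarrow> (LINT x|(lborel::'a measure). 0)"
  proof (rule integral_dominated_convergence[where w="\<lambda>x. (norm (G x))\<^sup>2"])
    show "integrable lborel (\<lambda>x. (norm (G x))\<^sup>2)" using G by (simp add: in_L2_def)
    show "AE x in lborel. (\<lambda>k. (norm (Gk k x - G x))\<^sup>2) \<longlonglongrightarrow> 0"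
    proof (rule AE_I2)
      fix x
      have "(\<lambda>k. (norm (of_real (exp (- s k * (norm x)\<^sup>2)) * G x - G x))\<^sup>2) \<longlonglongrightarrow> (norm (of_real (exp (- 0 * (norm x)\<^sup>2)) * G x - G x))\<^sup>2"
        by (intro tendsto_intros s)
      then show "(\<lambda>k. (norm (Gk k x - G x))\<^sup>2) \<longlonglongrightarrow> 0" by (simp add: Gk_def e_def)
    qed
    show "AE x in lborel. norm ((norm (Gk k x - G x))\<^sup>2) \<le> (norm (G x))\<^sup>2" for k
    proof (rule AE_I2)
      fix x
      have "Gk k x - G x = of_real (e k x - 1) * G x" by (simp add: Gk_def algebra_simps)
      moreover have "norm (complex_of_real (e k x - 1)) \<le> 1"
        unfolding norm_of_real using e[of k x] by auto
      ultimately have "norm (Gk k x - G x) \<le> 1 * norm (G x)"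
        by (simp only: norm_mult mult_right_mono norm_ge_zero)
      then show "norm ((norm (Gk k x - G x))\<^sup>2) \<le> (norm (G x))\<^sup>2" by (simp add: power_mono)
    qed
  qed measurable
  then have "(\<lambda>k. ennreal (LINT x|lborel. (norm (Gk k x - G x))\<^sup>2)) \<longlonglongrightarrow> ennreal 0"
    by (intro tendsto_ennrealI) simp
  moreover have "ennreal (LINT x|lborel. (norm (Gk k x - G x))\<^sup>2) = nn_L2 lborel (\<lambda>x. Gk k x - G x)" for k
  proof -
    have "in_L2 lborel (\<lambda>x. Gk k x - G x)" by (intro in_L2_diff Gk G)
    then show ?thesis unfolding nn_L2_def in_L2_def by (subst nn_integral_eq_integral) auto
  qed
  ultimately have GkG: "(\<lambda>k. nn_L2 lborel (\<lambda>x. Gk k x - G x)) \<longlonglongrightarrow> 0" by simp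
  define F where "F f = wave_L2 (- 1) 1 f" for f :: "'a \<Rightarrow> complex"
  have FG: "in_L2 lborel (F G)" "in_L2 lborel (F (Gk k))" for k
    unfolding F_def by (auto intro: wave_L2_limit G Gk)
  have FGk: "(\<lambda>k. nn_L2 lborel (\<lambda>x. F (Gk k) x - F G x)) \<longlonglongrightarrow> 0"
  proof (rule tendsto_sandwich[OF _ _ tendsto_const])
    show "\<forall>\<^sub>F k in sequentially. nn_L2 lborel (\<lambda>x. F (Gk k) x - F G x) \<le> (2 * wave_const 1 TYPE('a)) * nn_L2 lborel (\<lambda>x. Gk k x - G x)"
      unfolding F_def using wave_L2_diff[OF _ Gk G, of "- 1" 1] by (intro always_eventually) (simp add: mult.assoc)
    have "(\<lambda>k. (2 * wave_const 1 TYPE('a)) * nn_L2 lborel (\<lambda>x. Gk k x - G x)) \<longlonglongrightarrow> (2 * wave_const 1 TYPE('a)) * 0"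
      by (intro ennreal_tendsto_cmult GkG) (simp add: wave_const_def ennreal_mult_less_top)
    then show "(\<lambda>k. (2 * wave_const 1 TYPE('a)) * nn_L2 lborel (\<lambda>x. Gk k x - G x)) \<longlonglongrightarrow> 0" by simp
  qed auto
  \<comment> \<open>The multiplication formula, applied to \<open>g\<close> and a modulated Gaussian.\<close>
  have mean: "wave_integral (- 1) (Gk k) \<xi> = c * (LINT \<eta>|lborel. g \<eta> * of_real (gauss_hat (s k) (\<eta> - \<xi>)))" for k \<xi>
  proof -
    define w where "w x = cis (- (x \<bullet> \<xi>)) * of_real (e k x)" for x
    have "integrable lborel (\<lambda>x. complex_of_real (e k x))" using ie[of k] by simp
    from wave_integrable[OF this, of "-1" \<xi>] have iw: "integrable lborel w" by (simp add: w_def[abs_def])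
    have ww: "wave_integral 1 w \<eta> = of_real (gauss_hat (s k) (\<eta> - \<xi>))" for \<eta>
    proof -
      have "cis (1 * (x \<bullet> \<eta>)) * w x = cis (x \<bullet> (\<eta> - \<xi>)) * of_real (exp (- s k * (norm x)\<^sup>2))" for x
        by (simp add: w_def e_def cis_mult inner_diff_right mult.assoc[symmetric])
      then show ?thesis unfolding wave_integral_def using gaussian_fourier(1)[OF s(1), of "\<eta> - \<xi>" k] by simp
    qed
    have "wave_integral (- 1) (Gk k) \<xi> = (LINT x|lborel. c * (wave_integral 1 g x * w x))"
      unfolding wave_integral_def[of "- 1"] by (simp add: Gk_def G_eq w_def mult_ac)
    also have "\<dots> = c * (LINT \<eta>|lborel. g \<eta> * wave_integral 1 w \<eta>)"
      by (simp add: wave_integral_exchange[OF g(2) iw])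
    finally show ?thesis by (simp add: ww)
  qed
  have "(LINT x|lborel. (F G x - g x) * indicator (box a b) x) = 0" for a b
  proof -
    define B where "B = box a b"
    let ?g = "\<lambda>k \<eta> \<xi>. g \<eta> * of_real (gauss_hat (s k) (\<eta> - \<xi>))"
    have [measurable]: "B \<in> sets borel" by (simp add: B_def)
    have "nn_L2 lborel (indicator B) = (\<integral>\<^sup>+x. indicator B x \<partial>lborel)"
      unfolding nn_L2_def by (intro nn_integral_cong) (auto split: split_indicator)
    also have "\<dots> < \<infinity>" by (simp add: B_def emeasure_lborel_box_finite[unfolded infinity_ennreal_def])
    finally have B: "in_L2 lborel (indicator B)" by (simp add: in_L2_iff)
    have iB: "integrable lborel (indicator B :: 'a \<Rightarrow> complex)"
    proof -
      have "integrable lborel (indicator B :: 'a \<Rightarrow> real)"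
        by (intro integrable_real_indicator) (auto simp: B_def emeasure_lborel_box_finite[unfolded infinity_ennreal_def])
      then have "integrable lborel (\<lambda>x. complex_of_real (indicator B x))" by simp
      then show ?thesis by (simp add: of_real_indicator)
    qed
    have lim1: "(\<lambda>k. LINT x|lborel. F (Gk k) x * indicator B x) \<longlonglongrightarrow> (LINT x|lborel. F G x * indicator B x)"
      by (intro L2_pairing_tendsto FG B FGk)
    define m where "m k \<eta> = (LINT \<xi>|lborel. gauss_hat (s k) (\<eta> - \<xi>) * indicator B \<xi>)" for k \<eta>
    have [measurable]: "m k \<in> borel_measurable borel" for k unfolding m_def[abs_def] by measurable
    have eq: "(LINT x|lborel. F (Gk k) x * indicator B x) = c * (LINT \<eta>|lborel. g \<eta> * of_real (m k \<eta>))" for k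
    proof -
      have "AE x in lborel. F (Gk k) x = wave_integral (- 1) (Gk k) x"
        using wave_L2_eq_integral[of "- 1" "Gk k" 1] Gk iGk unfolding F_def by auto
      then have "(LINT x|lborel. F (Gk k) x * indicator B x) = (LINT x|lborel. wave_integral (- 1) (Gk k) x * indicator B x)"
        using FG(2)[of k, THEN in_L2_measurable] by (intro integral_cong_AE) auto
      also have "\<dots> = (LINT \<xi>|lborel. LINT \<eta>|lborel. c * (?g k \<eta> \<xi> * indicator B \<xi>))"
      proof -
        have "(LINT \<eta>|lborel. c * (?g k \<eta> \<xi> * indicator B \<xi>))
          = c * (LINT \<eta>|lborel. ?g k \<eta> \<xi>) * indicator B \<xi>" for \<xi>
          by (simp only: integral_mult_right_zero integral_mult_left_zero mult.assoc[of c])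
        then show ?thesis unfolding mean by (simp only:)
      qed
      also have "\<dots> = (LINT \<eta>|lborel. LINT \<xi>|lborel. c * (?g k \<eta> \<xi> * indicator B \<xi>))"
      proof (rule lborel_pair.Fubini_integral)
        have "integrable (lborel \<Otimes>\<^sub>M lborel) (\<lambda>z. (of_real (gauss_hat (s k) (0::'a)) * c) * (g (fst z) * indicator B (snd z)))"
          by (intro integrable_mult_right lborel_pair.integrable_mult_pair g iB)
        then show "integrable (lborel \<Otimes>\<^sub>M lborel) (\<lambda>(\<eta>, \<xi>). c * (?g k \<eta> \<xi> * indicator B \<xi>))"
        proof (rule Bochner_Integration.integrable_bound)
          have "norm (gauss_hat (s k) (x::'a)) \<le> norm (gauss_hat (s k) (0::'a))" for x
            using s(1)[of k] by (simp add: gauss_hat_def mult_left_le)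
          then show "AE z in lborel \<Otimes>\<^sub>M lborel. norm (case z of (\<eta>, \<xi>) \<Rightarrow> c * (?g k \<eta> \<xi> * indicator B \<xi>))
             \<le> norm (of_real (gauss_hat (s k) (0::'a)) * c * (g (fst z) * indicator B (snd z)))"
            by (intro AE_I2) (auto simp: norm_mult mult_ac intro!: mult_left_mono split: split_indicator)
        qed measurable
      qed
      also have "\<dots> = c * (LINT \<eta>|lborel. g \<eta> * of_real (m k \<eta>))"
      proof -
        have e1: "(LINT \<xi>|lborel. c * (?g k \<eta> \<xi> * indicator B \<xi>)) = c * (g \<eta> * of_real (m k \<eta>))" for \<eta>
        proof -
          have "(LINT \<xi>|lborel. c * (?g k \<eta> \<xi> * indicator B \<xi>))
            = (LINT \<xi>|lborel. (c * g \<eta>) * of_real (gauss_hat (s k) (\<eta> - \<xi>) * indicator B \<xi>))"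
            by (intro Bochner_Integration.integral_cong) (auto split: split_indicator)
          also have "\<dots> = (c * g \<eta>) * of_real (m k \<eta>)"
            unfolding m_def by (simp only: integral_mult_right_zero integral_complex_of_real)
          finally show ?thesis by (simp only: mult.assoc)
        qed
        show ?thesis unfolding e1 by (rule integral_mult_right_zero)
      qed
      finally show ?thesis .
    qed
    have "(\<lambda>k. LINT \<eta>|lborel. g \<eta> * of_real (m k \<eta>)) \<longlonglongrightarrow> (LINT \<eta>|lborel. g \<eta> * of_real ((2 * pi) ^ DIM('a) * indicator B \<eta>))"
    proof (rule integral_dominated_convergence[where w="\<lambda>\<eta>. (2 * pi) ^ DIM('a) * norm (g \<eta>)"])
      have "negligible (frontier B)" unfolding B_def by (intro negligible_convex_frontier convex_box)
      then have "frontier B \<in> null_sets lebesgue" by (simp add: negligible_iff_null_sets)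
      then have "AE \<eta> in lebesgue. \<eta> \<notin> frontier B" by (rule AE_not_in)
      then have "AE \<eta> in lborel. \<eta> \<notin> frontier B" by (simp add: AE_completion_iff)
      then show "AE \<eta> in lborel. (\<lambda>k. g \<eta> * of_real (m k \<eta>)) \<longlonglongrightarrow> g \<eta> * of_real ((2 * pi) ^ DIM('a) * indicator B \<eta>)"
      proof eventually_elim
        case (elim \<eta>)
        have "(\<lambda>k. m k \<eta>) \<longlonglongrightarrow> (2 * pi) ^ DIM('a) * indicator B \<eta>"
          unfolding m_def by (rule gauss_hat_approximates[OF \<open>B \<in> sets borel\<close> elim s])
        then show ?case by (intro tendsto_intros)
      qed
      show "AE \<eta> in lborel. norm (g \<eta> * of_real (m k \<eta>)) \<le> (2 * pi) ^ DIM('a) * norm (g \<eta>)" for k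
      proof (rule AE_I2)
        fix \<eta>
        have "0 \<le> m k \<eta>" unfolding m_def using s(1)[of k]
          by (intro integral_nonneg_AE AE_I2) (auto simp: gauss_hat_nonneg)
        moreover have "m k \<eta> \<le> (LINT \<xi>|lborel. gauss_hat (s k) (\<eta> - \<xi>))"
          unfolding m_def using gauss_hat_integrable(1)[OF s(1), of k \<eta>] s(1)[of k]
          by (intro integral_mono Bochner_Integration.integrable_bound[OF gauss_hat_integrable(1)[OF s(1), of k \<eta>]])
             (auto simp: gauss_hat_nonneg split: split_indicator)
        ultimately show "norm (g \<eta> * of_real (m k \<eta>)) \<le> (2 * pi) ^ DIM('a) * norm (g \<eta>)"
          using gauss_hat_integrable(2)[OF s(1), of k \<eta>]
          by (simp add: norm_mult mult.commute mult_left_mono)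
      qed
    qed (use g(2) in auto)
    from tendsto_mult[OF tendsto_const[of c] this]
    have lim2: "(\<lambda>k. c * (LINT \<eta>|lborel. g \<eta> * of_real (m k \<eta>))) \<longlonglongrightarrow> (LINT \<eta>|lborel. g \<eta> * indicator B \<eta>)"
    proof -
      have "c * (g \<eta> * of_real ((2 * pi) ^ DIM('a) * indicator B \<eta>)) = g \<eta> * indicator B \<eta>" for \<eta>
        by (simp add: c_def split: split_indicator)
      then have "c * (LINT \<eta>|lborel. g \<eta> * of_real ((2 * pi) ^ DIM('a) * indicator B \<eta>)) = (LINT \<eta>|lborel. g \<eta> * indicator B \<eta>)"
        by (simp only: integral_mult_right_zero[symmetric])
      with \<open>(\<lambda>k. c * (LINT \<eta>|lborel. g \<eta> * of_real (m k \<eta>))) \<longlonglongrightarrow> _\<close> show ?thesis by simp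
    qed
    have "(LINT x|lborel. F G x * indicator B x) = (LINT x|lborel. g x * indicator B x)"
      using LIMSEQ_unique[OF lim1[unfolded eq] lim2] .
    then show ?thesis
      using L2_mult_integrable[OF FG(1) B] L2_mult_integrable[OF g(1) B]
      by (simp add: left_diff_distrib B_def)
  qed
  moreover have "in_L2 lborel (\<lambda>x. F G x - g x)"
    by (intro in_L2_diff FG g)
  ultimately have "AE x in lborel. F G x - g x = 0" by (intro L2_zero_of_box_integrals)
  then show ?thesis by (simp add: F_def G_def)
qed

text \<open>The general case: cutoffs of \<open>g\<close> converge to \<open>g\<close>, and both transforms are continuous in \<open>L\<^sup>2\<close>.\<close>

lemma fourier_inversion:
  fixes g :: "'a::euclidean_space \<Rightarrow> complex"
  assumes g: "in_L2 lborel g"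
  shows "AE \<xi> in lborel. fourier_L2 (inv_fourier_L2 g) \<xi> = g \<xi>"
proof -
  define c where "c = complex_of_real (1 / (2 * pi) ^ DIM('a))"
  define F where "F f = wave_L2 (- 1) 1 f" for f :: "'a \<Rightarrow> complex"
  define G where "G = wave_L2 1 c g"
  define cut where "cut R = (cutoff R g)" for R
  define GR where "GR R = inv_fourier_integral (cut R)" for R
  have cut: "in_L2 lborel (cut R)" "integrable lborel (cut R)" for R
    unfolding cut_def by (intro in_L2_cutoff integrable_cutoff g)+
  have GR_eq: "GR R = (\<lambda>y. c * wave_integral 1 (cut R) y)" for R
    by (simp add: GR_def inv_fourier_integral_eq c_def)
  have G: "in_L2 lborel G" unfolding G_def by (intro wave_L2_limit g) simp
  note [measurable] = g[THEN in_L2_measurable] cut(1)[THEN in_L2_measurable] G[THEN in_L2_measurable]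
  have GR: "in_L2 lborel (GR R)" for R
    using plancherel_const_le[OF cut(2), of 1 c R] cut(1)[of R] unfolding GR_eq
    by (auto simp: in_L2_iff wave_const_def ennreal_mult_less_top elim!: le_less_trans)
  have lim: "((\<lambda>R. nn_L2 lborel (\<lambda>y. GR R y - G y)) \<longlongrightarrow> 0) at_top"
    unfolding GR_eq G_def cut_def by (intro wave_L2_limit g) simp
  have FG: "in_L2 lborel (F G)" "in_L2 lborel (F (GR R))" for R
    unfolding F_def by (auto intro: wave_L2_limit G GR)
  note [measurable] = FG[THEN in_L2_measurable]
  have le: "nn_L2 lborel (\<lambda>x. F G x - g x) \<le> (4 * wave_const 1 TYPE('a)) * nn_L2 lborel (\<lambda>y. GR R y - G y) + 2 * nn_L2 lborel (\<lambda>x. cut R x - g x)" for R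
  proof -
    have "AE x in lborel. F (GR R) x - g x = cut R x - g x"
      using fourier_inversion_integrable[OF cut, of R] by (auto simp: F_def GR_def)
    then have 1: "nn_L2 lborel (\<lambda>x. F (GR R) x - g x) = nn_L2 lborel (\<lambda>x. cut R x - g x)"
      by (rule nn_L2_cong_AE)
    have "nn_L2 lborel (\<lambda>x. F G x - g x) \<le> 2 * nn_L2 lborel (\<lambda>x. F G x - F (GR R) x) + 2 * nn_L2 lborel (\<lambda>x. F (GR R) x - g x)"
      by (intro nn_L2_triangle) auto
    also have "\<dots> \<le> 2 * (2 * (wave_const 1 TYPE('a) * nn_L2 lborel (\<lambda>x. G x - GR R x))) + 2 * nn_L2 lborel (\<lambda>x. cut R x - g x)"
      unfolding 1 unfolding F_def by (intro add_mono mult_left_mono wave_L2_diff G GR) auto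
    finally show ?thesis by (simp add: nn_L2_uminus[of _ G] mult.assoc[symmetric])
  qed
  have "((\<lambda>R. (4 * wave_const 1 TYPE('a)) * nn_L2 lborel (\<lambda>y. GR R y - G y) + 2 * nn_L2 lborel (\<lambda>x. cut R x - g x))
      \<longlongrightarrow> (4 * wave_const 1 TYPE('a)) * 0 + 2 * 0) at_top"
    unfolding cut_def
    by (intro tendsto_add ennreal_tendsto_cmult lim nn_L2_cutoff_tendsto g) (auto simp: wave_const_def ennreal_mult_less_top)
  then have "nn_L2 lborel (\<lambda>x. F G x - g x) \<le> (4 * wave_const 1 TYPE('a)) * 0 + 2 * 0"
    by (rule tendsto_lowerbound) (auto intro!: always_eventually le)
  then have "AE x in lborel. F G x - g x = 0" by (intro nn_L2_eq_0) auto
  then show ?thesis by (simp add: F_def G_def fourier_L2_eq inv_fourier_L2_eq c_def)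
qed

section \<open>Fourier transforms of test functions\<close>

lemma japanese_ge_1: "1 \<le> japanese x"
  by (simp add: japanese_def)

lemma japanese_measurable [measurable]: "japanese \<in> borel_measurable (borel :: 'a::euclidean_space measure)"
  unfolding japanese_def[abs_def] by measurable

lemma test_function_continuous: "test_function \<phi> \<Longrightarrow> continuous_on UNIV \<phi>"
  unfolding test_function_def smooth_on_def by (metis Ck_on.simps(1))

lemma test_function_support:
  assumes "test_function (\<phi> :: 'a::euclidean_space \<Rightarrow> complex)"
  obtains R where "R > 0" "\<And>x. norm x \<ge> R \<Longrightarrow> \<phi> x = 0"
proof -
  have "bounded (closure {x. \<phi> x \<noteq> 0})" using assms unfolding test_function_def by (blast intro: compact_imp_bounded)
  then obtain R where R: "R > 0" "\<And>x. x \<in> closure {x. \<phi> x \<noteq> 0} \<Longrightarrow> norm x < R"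
    using bounded_pos_less by (metis (full_types))
  then show ?thesis using closure_subset[of "{x. \<phi> x \<noteq> 0}"] by (intro that[of R]) (force simp: not_le[symmetric])+
qed

lemma in_L2_continuous_compact:
  fixes f :: "'a::euclidean_space \<Rightarrow> complex"
  assumes f: "continuous_on UNIV f" and K: "compact K"
  shows "in_L2 lborel (\<lambda>x. indicator K x *\<^sub>R f x)"
proof -
  have [measurable]: "f \<in> borel_measurable borel" "K \<in> sets borel"
    using f K by (auto intro: borel_measurable_continuous_onI borel_closed compact_imp_closed)
  have "integrable lborel (\<lambda>x. indicator K x *\<^sub>R (norm (f x))\<^sup>2)"
    by (intro borel_integrable_compact K continuous_intros continuous_on_subset[OF f]) auto
  then show ?thesis unfolding in_L2_def
    by (auto simp: indicator_def if_distrib[of norm] if_distrib[of "\<lambda>x. x\<^sup>2"] if_distribR cong: if_cong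
        elim!: Bochner_Integration.integrable_cong[THEN iffD1, rotated -1])
qed

lemma test_function_L2:
  assumes \<phi>: "test_function (\<phi> :: 'a::euclidean_space \<Rightarrow> complex)"
  shows "in_L2 lborel \<phi>" "integrable lborel \<phi>" "in_L2 lborel (\<lambda>x. of_real (japanese x) * \<phi> x)"
proof -
  obtain R where R: "R > 0" "\<And>x. norm x \<ge> R \<Longrightarrow> \<phi> x = 0" using test_function_support[OF \<phi>] by blast
  have c: "continuous_on UNIV \<phi>" by (rule test_function_continuous[OF \<phi>])
  have cut: "(\<lambda>x. indicator (cball 0 R) x *\<^sub>R (g x * \<phi> x)) = (\<lambda>x. g x * \<phi> x)" for g
    using R(2) by (force simp: fun_eq_iff split: split_indicator)
  show L2: "in_L2 lborel \<phi>" using in_L2_continuous_compact[OF c compact_cball, of 0 R] cut[of "\<lambda>_. 1"] by simp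
  show "integrable lborel \<phi>" using integrable_cutoff[OF L2, of R] cut[of "\<lambda>_. 1"] by simp
  have "continuous_on UNIV (\<lambda>x. of_real (japanese x) * \<phi> x)"
    unfolding japanese_def by (intro continuous_intros c)
  from in_L2_continuous_compact[OF this compact_cball, of 0 R]
  show "in_L2 lborel (\<lambda>x. of_real (japanese x) * \<phi> x)" unfolding cut .
qed

lemma test_function_lipschitz:
  assumes \<phi>: "test_function (\<phi> :: 'a::euclidean_space \<Rightarrow> complex)" and b: "b \<in> Basis"
  obtains L where "L \<ge> 0" "\<And>x h. norm (\<phi> (x + h *\<^sub>R b) - \<phi> x) \<le> L * \<bar>h\<bar>"
proof -
  obtain R where R: "R > 0" "\<And>x. norm x \<ge> R \<Longrightarrow> \<phi> x = 0" using test_function_support[OF \<phi>] by blast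
  have "Ck_on 1 UNIV \<phi>" using \<phi> by (simp add: test_function_def smooth_on_def)
  then have diff: "\<And>x. \<phi> differentiable (at x)"
    and cont: "continuous_on UNIV (\<lambda>x. frechet_derivative \<phi> (at x) b)" by auto
  define D where "D x = frechet_derivative \<phi> (at x) b" for x
  have "bounded (D ` cball 0 R)"
    using cont unfolding D_def by (intro compact_imp_bounded compact_continuous_image continuous_on_subset[OF cont]) auto
  then obtain L where L: "L > 0" "\<And>x. x \<in> cball 0 R \<Longrightarrow> norm (D x) \<le> L"
    unfolding bounded_pos by blast
  have DL: "norm (D x) \<le> L" for x
  proof (cases "norm x \<le> R")
    case False
    have "(\<phi> has_derivative (\<lambda>_. 0)) (at x)"
    proof (rule has_derivative_transform_within_open[where f="\<lambda>_. 0" and s="{y. R < norm y}"])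
      show "open {y::'a. R < norm y}" by (intro open_Collect_less continuous_intros)
    qed (use False R in auto)
    then have "D x = 0" unfolding D_def by (metis frechet_derivative_at)
    then show ?thesis using L by simp
  qed (use L in auto)
  have "norm (\<phi> (x + h *\<^sub>R b) - \<phi> (x + 0 *\<^sub>R b)) \<le> L * norm (h - 0)" for x h
  proof (rule differentiable_bound[where S=UNIV and f="\<lambda>t. \<phi> (x + t *\<^sub>R b)" and f'="\<lambda>t s. s *\<^sub>R D (x + t *\<^sub>R b)"])
    fix t :: real
    have d: "(\<phi> has_derivative frechet_derivative \<phi> (at (x + t *\<^sub>R b))) (at (x + t *\<^sub>R b))"
      using diff frechet_derivative_works by blast
    have "((\<lambda>t. x + t *\<^sub>R b) has_derivative (\<lambda>s. s *\<^sub>R b)) (at t)" by (auto intro!: derivative_eq_intros)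
    from diff_chain_at[OF this d]
    have "((\<lambda>t. \<phi> (x + t *\<^sub>R b)) has_derivative (\<lambda>s. frechet_derivative \<phi> (at (x + t *\<^sub>R b)) (s *\<^sub>R b))) (at t)"
      by (simp add: o_def)
    moreover have "frechet_derivative \<phi> (at (x + t *\<^sub>R b)) (s *\<^sub>R b) = s *\<^sub>R D (x + t *\<^sub>R b)" for s
      unfolding D_def using linear_frechet_derivative[OF diff] by (simp add: linear_cmul)
    ultimately show "((\<lambda>t. \<phi> (x + t *\<^sub>R b)) has_derivative (\<lambda>s. s *\<^sub>R D (x + t *\<^sub>R b))) (at t within UNIV)" by simp
    show "onorm (\<lambda>s. s *\<^sub>R D (x + t *\<^sub>R b)) \<le> L"
      by (rule onorm_le) (use DL in \<open>simp add: mult.commute[of L] mult_left_mono\<close>)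
  qed auto
  then show ?thesis using L by (intro that[of L]) auto
qed

lemma wave_integral_shift:
  fixes \<phi> :: "'a::euclidean_space \<Rightarrow> complex"
  assumes \<phi>: "integrable lborel \<phi>"
  shows "integrable lborel (\<lambda>x. \<phi> (x + a))"
    and "wave_integral 1 (\<lambda>x. \<phi> (x + a)) \<xi> = cis (- (a \<bullet> \<xi>)) * wave_integral 1 \<phi> \<xi>"
proof -
  have tr: "lborel = distr lborel borel (\<lambda>x::'a. x + a)"
    unfolding add.commute[of _ a] by (rule lborel_distr_plus[symmetric])
  have [measurable]: "\<phi> \<in> borel_measurable borel" using \<phi> by auto
  show "integrable lborel (\<lambda>x. \<phi> (x + a))"
    using \<phi> by (subst (asm) tr, subst (asm) integrable_distr_eq) auto
  have "wave_integral 1 \<phi> \<xi> = (LINT x|lborel. cis ((x + a) \<bullet> \<xi>) * \<phi> (x + a))"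
    unfolding wave_integral_def by (subst tr, subst integral_distr) auto
  also have "\<dots> = cis (a \<bullet> \<xi>) * wave_integral 1 (\<lambda>x. \<phi> (x + a)) \<xi>"
    unfolding wave_integral_def by (simp add: inner_add_left cis_mult[symmetric] mult_ac flip: integral_mult_right_zero)
  finally show "wave_integral 1 (\<lambda>x. \<phi> (x + a)) \<xi> = cis (- (a \<bullet> \<xi>)) * wave_integral 1 \<phi> \<xi>"
    by (simp add: mult.assoc[symmetric] cis_mult)
qed

text \<open>One derivative of a test function is square integrable on the Fourier side. Difference
  quotients and Fatou's lemma take the place of integration by parts.\<close>

lemma test_function_fourier_component:
  assumes \<phi>: "test_function (\<phi> :: 'a::euclidean_space \<Rightarrow> complex)" and b: "b \<in> Basis"
  shows "nn_L2 lborel (\<lambda>\<xi>. of_real (\<xi> \<bullet> b) * wave_integral 1 \<phi> \<xi>) < \<infinity>"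
proof -
  obtain R where R: "R > 0" "\<And>x. norm x \<ge> R \<Longrightarrow> \<phi> x = 0" using test_function_support[OF \<phi>] by blast
  obtain L where L: "L \<ge> 0" "\<And>x h. norm (\<phi> (x + h *\<^sub>R b) - \<phi> x) \<le> L * \<bar>h\<bar>"
    using test_function_lipschitz[OF \<phi> b] by blast
  note i\<phi> = test_function_L2(2)[OF \<phi>]
  have [measurable]: "\<phi> \<in> borel_measurable borel" using i\<phi> by auto
  define h where "h k = inverse (real (Suc k))" for k
  have h: "0 < h k" "h k \<le> 1" for k by (auto simp: h_def field_simps)
  have h0: "h \<longlonglongrightarrow> 0" using LIMSEQ_inverse_real_of_nat by (simp add: h_def[abs_def] del: of_nat_Suc)
  define q where "q k x = (\<phi> (x + h k *\<^sub>R b) - \<phi> x) * of_real (1 / h k)" for k x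
  have iq: "integrable lborel (q k)" for k
    unfolding q_def[abs_def] by (intro integrable_mult_left Bochner_Integration.integrable_diff wave_integral_shift i\<phi>)
  \<comment> \<open>A translation becomes a phase, so the difference quotient becomes a multiplier tending to \<open>- i (\<xi> \<bullet> b)\<close>.\<close>
  have wq: "wave_integral 1 (q k) \<xi> = (cis (- (h k * (\<xi> \<bullet> b))) - 1) * of_real (1 / h k) * wave_integral 1 \<phi> \<xi>" for k \<xi>
  proof -
    have "wave_integral 1 (q k) \<xi> = wave_integral 1 (\<lambda>x. \<phi> (x + h k *\<^sub>R b) - \<phi> x) \<xi> * of_real (1 / h k)"
      unfolding wave_integral_def q_def by (simp only: mult.assoc[symmetric] integral_mult_left_zero)
    then show ?thesis
      by (simp add: wave_integral_diff wave_integral_shift i\<phi> inner_commute algebra_simps)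
  qed
  have q_bound: "norm (q k x) \<le> L * indicator (cball 0 (R + 1)) x" for k x
  proof (cases "norm x \<le> R + 1")
    case True
    have "norm (q k x) = norm (\<phi> (x + h k *\<^sub>R b) - \<phi> x) / h k" using h[of k] by (simp add: q_def norm_divide)
    also have "\<dots> \<le> L" using L(2)[of x "h k"] h[of k] by (simp add: field_simps)
    finally show ?thesis using True by simp
  next
    case False
    have "norm x \<le> norm (x + h k *\<^sub>R b) + norm (h k *\<^sub>R b)" using norm_triangle_ineq4[of "x + h k *\<^sub>R b" "h k *\<^sub>R b"] by simp
    then have "R \<le> norm (x + h k *\<^sub>R b)" using False h[of k] b by simp
    then show ?thesis using False R by (simp add: q_def)
  qed
  define B where "B = ennreal (L\<^sup>2) * emeasure lborel (cball (0::'a) (R + 1))"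
  have B: "B < \<infinity>" using emeasure_lborel_cball_finite[of "0::'a" "R + 1"] by (simp add: B_def ennreal_mult_less_top)
  have qB: "nn_L2 lborel (q k) \<le> B" for k
  proof -
    have "nn_L2 lborel (q k) \<le> (\<integral>\<^sup>+x. ennreal (L\<^sup>2) * indicator (cball (0::'a) (R + 1)) x \<partial>lborel)"
      unfolding nn_L2_def
    proof (rule nn_integral_mono)
      fix x
      have "(norm (q k x))\<^sup>2 \<le> (L * indicator (cball 0 (R + 1)) x)\<^sup>2" by (intro power_mono q_bound) auto
      then show "ennreal ((norm (q k x))\<^sup>2) \<le> ennreal (L\<^sup>2) * indicator (cball 0 (R + 1)) x"
        by (auto split: split_indicator intro: ennreal_leI)
    qed
    then show ?thesis by (simp add: B_def nn_integral_cmult_indicator)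
  qed
  have wave_m: "wave_integral 1 \<phi> \<in> borel_measurable borel" "wave_integral 1 (q k) \<in> borel_measurable borel" for k
    using iq[of k] by (auto intro!: wave_integral_measurable)
  note [measurable] = wave_m
  have "nn_L2 lborel (\<lambda>\<xi>. of_real (\<xi> \<bullet> b) * wave_integral 1 \<phi> \<xi>)
    \<le> (\<integral>\<^sup>+\<xi>. liminf (\<lambda>k. ennreal ((norm (wave_integral 1 (q k) \<xi>))\<^sup>2)) \<partial>lborel)"
    unfolding nn_L2_def
  proof (rule nn_integral_mono)
    fix \<xi> :: 'a
    define s where "s = \<xi> \<bullet> b"
    \<comment> \<open>The imaginary part of the multiplier suffices for the lower bound.\<close>
    have "((\<lambda>x. sin (x * s)) has_real_derivative s) (at 0)" by (auto intro!: derivative_eq_intros)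
    then have "((\<lambda>x. sin (x * s) / x) \<longlongrightarrow> s) (at 0)" by (simp add: DERIV_def)
    moreover have "filterlim h (at 0) sequentially"
      using h0 h(1) by (auto simp: filterlim_at intro!: always_eventually less_imp_neq[symmetric])
    ultimately have lim: "(\<lambda>k. sin (h k * s) / h k) \<longlonglongrightarrow> s" by (rule filterlim_compose)
    have "(\<lambda>k. ennreal ((sin (h k * s) / h k)\<^sup>2 * (norm (wave_integral 1 \<phi> \<xi>))\<^sup>2)) \<longlonglongrightarrow> ennreal (s\<^sup>2 * (norm (wave_integral 1 \<phi> \<xi>))\<^sup>2)"
      by (intro tendsto_ennrealI tendsto_intros lim)
    then have "ennreal (s\<^sup>2 * (norm (wave_integral 1 \<phi> \<xi>))\<^sup>2) = liminf (\<lambda>k. ennreal ((sin (h k * s) / h k)\<^sup>2 * (norm (wave_integral 1 \<phi> \<xi>))\<^sup>2))"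
      by (intro lim_imp_Liminf[symmetric]) auto
    also have "\<dots> \<le> liminf (\<lambda>k. ennreal ((norm (wave_integral 1 (q k) \<xi>))\<^sup>2))"
    proof (intro Liminf_mono always_eventually allI ennreal_leI)
      fix k
      have "\<bar>sin (h k * s)\<bar> \<le> norm (cis (- (h k * s)) - 1)"
        using abs_Im_le_cmod[of "cis (- (h k * s)) - 1"] by simp
      then have "(sin (h k * s))\<^sup>2 \<le> (norm (cis (- (h k * s)) - 1))\<^sup>2"
        using power_mono[of "\<bar>sin (h k * s)\<bar>" _ 2] by simp
      then have "(sin (h k * s))\<^sup>2 * (1 / h k)\<^sup>2 * (norm (wave_integral 1 \<phi> \<xi>))\<^sup>2
        \<le> (norm (cis (- (h k * s)) - 1))\<^sup>2 * (1 / h k)\<^sup>2 * (norm (wave_integral 1 \<phi> \<xi>))\<^sup>2"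
        by (intro mult_right_mono) auto
      then show "(sin (h k * s) / h k)\<^sup>2 * (norm (wave_integral 1 \<phi> \<xi>))\<^sup>2 \<le> (norm (wave_integral 1 (q k) \<xi>))\<^sup>2"
        using h(1)[of k] by (simp add: wq s_def norm_mult norm_divide power_mult_distrib power_divide)
    qed
    finally show "ennreal ((norm (of_real (\<xi> \<bullet> b) * wave_integral 1 \<phi> \<xi>))\<^sup>2) \<le> liminf (\<lambda>k. ennreal ((norm (wave_integral 1 (q k) \<xi>))\<^sup>2))"
      by (simp add: s_def norm_mult power_mult_distrib)
  qed
  also have "\<dots> \<le> liminf (\<lambda>k. nn_L2 lborel (wave_integral 1 (q k)))"
    unfolding nn_L2_def by (intro nn_integral_liminf) measurable
  also have "\<dots> \<le> ennreal ((2 * pi) ^ DIM('a)) * B"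
  proof (intro Liminf_le sequentially_bot always_eventually allI)
    fix k
    have "nn_L2 lborel (wave_integral 1 (q k)) \<le> ennreal ((2 * pi) ^ DIM('a)) * nn_L2 lborel (q k)"
      by (intro plancherel_le iq) simp
    also have "\<dots> \<le> ennreal ((2 * pi) ^ DIM('a)) * B" by (intro mult_left_mono qB) auto
    finally show "nn_L2 lborel (wave_integral 1 (q k)) \<le> \<dots>" .
  qed
  also have "\<dots> < \<infinity>" using B by (simp add: ennreal_mult_less_top)
  finally show ?thesis .
qed

text \<open>One derivative controls half a derivative: \<open>\<langle>\<xi>\<rangle>\<^sup>1\<^sup>/\<^sup>2 \<le> \<langle>\<xi>\<rangle>\<close> and \<open>\<langle>\<xi>\<rangle>\<^sup>2 = 1 + \<Sum> (\<xi> \<bullet> b)\<^sup>2\<close>.\<close>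

lemma test_function_fourier_weighted:
  assumes \<phi>: "test_function (\<phi> :: 'a::euclidean_space \<Rightarrow> complex)"
  shows "in_L2 lborel (\<lambda>\<xi>. of_real (japanese \<xi> powr (1/2)) * inv_fourier_integral \<phi> \<xi>)"
proof -
  note i\<phi> = test_function_L2[OF \<phi>]
  have [measurable]: "wave_integral 1 \<phi> \<in> borel_measurable borel"
    using i\<phi> by (auto intro!: wave_integral_measurable)
  have "nn_L2 lborel (\<lambda>\<xi>. of_real (japanese \<xi> powr (1/2)) * wave_integral 1 \<phi> \<xi>)
    \<le> nn_L2 lborel (\<lambda>\<xi>. of_real (japanese \<xi>) * wave_integral 1 \<phi> \<xi>)"
  proof (rule nn_L2_mono)
    fix \<xi> :: 'a
    have "japanese \<xi> powr (1/2) \<le> japanese \<xi> powr 1" using japanese_ge_1[of \<xi>] by (intro powr_mono) auto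
    then show "norm (of_real (japanese \<xi> powr (1/2)) * wave_integral 1 \<phi> \<xi>) \<le> norm (of_real (japanese \<xi>) * wave_integral 1 \<phi> \<xi>)"
      using japanese_ge_1[of \<xi>] by (simp add: norm_mult mult_right_mono)
  qed
  also have "\<dots> = (\<integral>\<^sup>+\<xi>. ennreal ((norm (wave_integral 1 \<phi> \<xi>))\<^sup>2) + (\<Sum>b\<in>Basis. ennreal ((norm (of_real (\<xi> \<bullet> b) * wave_integral 1 \<phi> \<xi>))\<^sup>2)) \<partial>lborel)"
    unfolding nn_L2_def
  proof (rule nn_integral_cong)
    fix \<xi> :: 'a
    have "(japanese \<xi>)\<^sup>2 = 1 + (\<Sum>b\<in>Basis. (\<xi> \<bullet> b)\<^sup>2)"
      by (simp add: japanese_def norm_power2_Basis[symmetric])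
    then have "(norm (of_real (japanese \<xi>) * wave_integral 1 \<phi> \<xi>))\<^sup>2
      = (norm (wave_integral 1 \<phi> \<xi>))\<^sup>2 + (\<Sum>b\<in>Basis. (norm (of_real (\<xi> \<bullet> b) * wave_integral 1 \<phi> \<xi>))\<^sup>2)"
      by (simp add: norm_mult power_mult_distrib distrib_right sum_distrib_right)
    then show "ennreal ((norm (of_real (japanese \<xi>) * wave_integral 1 \<phi> \<xi>))\<^sup>2)
      = ennreal ((norm (wave_integral 1 \<phi> \<xi>))\<^sup>2) + (\<Sum>b\<in>Basis. ennreal ((norm (of_real (\<xi> \<bullet> b) * wave_integral 1 \<phi> \<xi>))\<^sup>2))"
      by (simp add: ennreal_plus sum_nonneg sum_ennreal)
  qed
  also have "\<dots> = nn_L2 lborel (wave_integral 1 \<phi>) + (\<Sum>b\<in>Basis. nn_L2 lborel (\<lambda>\<xi>. of_real (\<xi> \<bullet> b) * wave_integral 1 \<phi> \<xi>))"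
    unfolding nn_L2_def by (simp add: nn_integral_add nn_integral_sum del: sum_ennreal)
  also have "\<dots> < \<infinity>"
  proof -
    have "nn_L2 lborel (wave_integral 1 \<phi>) \<le> ennreal ((2 * pi) ^ DIM('a)) * nn_L2 lborel \<phi>"
      by (intro plancherel_le i\<phi>) simp
    also have "\<dots> < \<infinity>" using i\<phi>(1) by (simp add: in_L2_iff ennreal_mult_less_top)
    finally show ?thesis using test_function_fourier_component[OF \<phi>] by simp
  qed
  finally have "nn_L2 lborel (\<lambda>\<xi>. of_real (japanese \<xi> powr (1/2)) * wave_integral 1 \<phi> \<xi>) < \<infinity>" .
  moreover have "nn_L2 lborel (\<lambda>\<xi>. of_real (japanese \<xi> powr (1/2)) * inv_fourier_integral \<phi> \<xi>)
    = nn_L2 lborel (\<lambda>\<xi>. of_real (1 / (2 * pi) ^ DIM('a)) * (of_real (japanese \<xi> powr (1/2)) * wave_integral 1 \<phi> \<xi>))"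
    by (simp add: inv_fourier_integral_eq mult_ac)
  moreover have "\<dots> = ennreal ((norm (complex_of_real (1 / (2 * pi) ^ DIM('a))))\<^sup>2) * nn_L2 lborel (\<lambda>\<xi>. of_real (japanese \<xi> powr (1/2)) * wave_integral 1 \<phi> \<xi>)"
    by (rule nn_L2_cmult) measurable
  ultimately show ?thesis
    by (auto simp: in_L2_iff ennreal_mult_less_top inv_fourier_integral_eq)
qed

section \<open>Level sets of homogeneous functions\<close>

lemma power_le_fact_exp: "0 \<le> y \<Longrightarrow> y ^ n \<le> fact n * exp (y::real)"
proof -
  assume y: "0 \<le> y"
  have "y ^ n /\<^sub>R fact n \<le> (\<Sum>k. y ^ k /\<^sub>R fact k)"
    using sum_le_suminf[OF summable_exp_generic[of y], of "{n}"] y by simp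
  then show ?thesis by (simp add: exp_def divide_inverse[symmetric] scaleR_conv_of_real field_simps)
qed

lemma nn_integral_power2_le:
  fixes G :: "real \<Rightarrow> ennreal"
  assumes [measurable]: "G \<in> borel_measurable borel"
  shows "(\<integral>\<^sup>+r. G (r\<^sup>2) * ennreal (2 * r) * indicator {0<..} r \<partial>lborel) \<le> (\<integral>\<^sup>+x. G x \<partial>lborel)"
proof -
  let ?f = "\<lambda>k r. G (r\<^sup>2) * ennreal (2 * r) * indicator {0..real k} r"
  have "(\<integral>\<^sup>+r. G (r\<^sup>2) * ennreal (2 * r) * indicator {0<..} r \<partial>lborel) \<le> (\<integral>\<^sup>+r. liminf (\<lambda>k. ?f k r) \<partial>lborel)"
  proof (rule nn_integral_mono)
    fix r :: real
    obtain N :: nat where N: "r \<le> real N" using real_arch_simple by blast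
    show "G (r\<^sup>2) * ennreal (2 * r) * indicator {0<..} r \<le> liminf (\<lambda>k. ?f k r)"
      by (rule Liminf_bounded, rule eventually_sequentiallyI[of N]) (use N in \<open>auto split: split_indicator\<close>)
  qed
  also have "\<dots> \<le> liminf (\<lambda>k. \<integral>\<^sup>+r. ?f k r \<partial>lborel)" by (intro nn_integral_liminf) auto
  also have "\<dots> \<le> (\<integral>\<^sup>+x. G x \<partial>lborel)"
  proof (intro Liminf_le sequentially_bot eventually_sequentiallyI[of 1])
    fix k :: nat assume k: "1 \<le> k"
    have "(\<integral>\<^sup>+r. ?f k r \<partial>lborel) = (\<integral>\<^sup>+x. G x * indicator {0\<^sup>2..(real k)\<^sup>2} x \<partial>lborel)"
      using k by (intro nn_integral_substitution_aux[symmetric])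
                 (auto intro!: derivative_eq_intros continuous_intros)
    also have "\<dots> \<le> (\<integral>\<^sup>+x. G x \<partial>lborel)"
      by (intro nn_integral_mono) (auto split: split_indicator)
    finally show "(\<integral>\<^sup>+r. ?f k r \<partial>lborel) \<le> (\<integral>\<^sup>+x. G x \<partial>lborel)" .
  qed
  finally show ?thesis .
qed

locale homogeneous_symbol =
  fixes p :: "'a::euclidean_space \<Rightarrow> real"
  assumes cont: "continuous_on (- {0}) p"
    and pos: "\<xi> \<noteq> 0 \<Longrightarrow> p \<xi> > 0"
    and homogeneous: "l > 0 \<Longrightarrow> \<xi> \<noteq> 0 \<Longrightarrow> p (l *\<^sub>R \<xi>) = l * p \<xi>"
begin

lemma p_measurable [measurable]: "p \<in> borel_measurable borel"
proof -
  have [measurable]: "(\<lambda>x. indicator (- {0}) x *\<^sub>R p x) \<in> borel_measurable borel"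
    by (intro borel_measurable_continuous_on_indicator cont) auto
  have "p = (\<lambda>x. indicator (- {0}) x *\<^sub>R p x + indicator {0} x *\<^sub>R p 0)"
    by (auto simp: fun_eq_iff split: split_indicator)
  also have "\<dots> \<in> borel_measurable borel" by measurable
  finally show ?thesis .
qed

lemma lower_bound: "\<exists>c>0. \<forall>\<xi>. \<xi> \<noteq> 0 \<longrightarrow> c * norm \<xi> \<le> p \<xi>"
proof -
  have "continuous_on (sphere 0 1) p" by (rule continuous_on_subset[OF cont]) auto
  then obtain u where u: "u \<in> sphere 0 1" "\<And>v. v \<in> sphere 0 1 \<Longrightarrow> p u \<le> p v"
    using continuous_attains_inf[of "sphere 0 1" p] by auto
  have "p u * norm \<xi> \<le> p \<xi>" if "\<xi> \<noteq> 0" for \<xi>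
  proof -
    have "p (norm \<xi> *\<^sub>R (\<xi> /\<^sub>R norm \<xi>)) = norm \<xi> * p (\<xi> /\<^sub>R norm \<xi>)"
      using that by (intro homogeneous) auto
    moreover have "p u \<le> p (\<xi> /\<^sub>R norm \<xi>)" using that by (intro u) auto
    ultimately show ?thesis using that by (simp add: mult.commute)
  qed
  moreover have "p u > 0" using u(1) by (intro pos) auto
  ultimately show ?thesis by blast
qed

text \<open>The shell \<open>1 \<le> p \<le> 2\<close>, projected along rays, carries the cone measure of the level set
  \<open>p = 1\<close> up to a constant.\<close>

definition shell :: "'a set" where
  "shell = {\<zeta>. \<zeta> \<noteq> 0 \<and> 1 \<le> p \<zeta> \<and> p \<zeta> \<le> 2}"

definition proj :: "'a \<Rightarrow> 'a" where
  "proj \<zeta> = \<zeta> /\<^sub>R p \<zeta>"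

lemma shell_measurable [measurable]: "shell \<in> sets borel"
  unfolding shell_def by measurable

lemma proj_measurable [measurable]: "proj \<in> borel_measurable borel"
  unfolding proj_def[abs_def] by measurable

lemma p_proj: "\<zeta> \<in> shell \<Longrightarrow> r > 0 \<Longrightarrow> p (r *\<^sub>R proj \<zeta>) = r"
  using pos[of \<zeta>] homogeneous[of "r / p \<zeta>" \<zeta>]
  by (auto simp: shell_def proj_def divide_inverse)

text \<open>Polar coordinates adapted to \<open>p\<close>, as an inequality. Substituting \<open>r = \<mu> p(\<zeta>)\<close> and then
  \<open>\<zeta> = \<eta> / \<mu>\<close> turns the double integral into the integral of \<open>F \<eta>\<close> against a factor that is itself an
  integral over \<open>p \<eta> / 2 \<le> \<mu> \<le> p \<eta>\<close>; its integrand is at least \<open>1 / p \<eta>\<close>, so the factor is at least \<open>1/2\<close>.\<close>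

lemma polar_inequality:
  fixes F :: "'a \<Rightarrow> ennreal"
  assumes [measurable]: "F \<in> borel_measurable borel"
  shows "(\<integral>\<^sup>+\<eta>. F \<eta> \<partial>lborel) \<le> 2 * (\<integral>\<^sup>+r. \<integral>\<^sup>+\<zeta>. indicator {0<..} r * ennreal (r ^ (DIM('a) - 1)) * indicator shell \<zeta> * F (r *\<^sub>R proj \<zeta>) \<partial>lborel \<partial>lborel)"
proof -
  define n where "n = DIM('a)"
  have n: "n > 0" by (simp add: n_def)
  let ?A = "\<lambda>r \<zeta>. indicator {0<..} r * ennreal (r ^ (n - 1)) * indicator shell \<zeta> * F (r *\<^sub>R proj \<zeta>)"
  let ?B = "\<lambda>\<mu> \<zeta>. indicator {0<..} \<mu> * ennreal (p \<zeta> ^ n * \<mu> ^ (n - 1)) * indicator shell \<zeta> * F (\<mu> *\<^sub>R \<zeta>)"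
  define W where "W \<mu> \<eta> = indicator {0<..} \<mu> * ennreal ((1 / \<mu>) ^ n * (p \<eta> / \<mu>) ^ n * \<mu> ^ (n - 1)) * indicator shell (\<eta> /\<^sub>R \<mu>)" for \<mu> :: real and \<eta> :: 'a
  have [measurable]: "case_prod W \<in> borel_measurable (lborel \<Otimes>\<^sub>M lborel)"
    unfolding W_def by measurable
  have "(\<integral>\<^sup>+r. \<integral>\<^sup>+\<zeta>. ?A r \<zeta> \<partial>lborel \<partial>lborel)
     = (\<integral>\<^sup>+\<zeta>. \<integral>\<^sup>+r. ?A r \<zeta> \<partial>lborel \<partial>lborel)"
    by (rule lborel_pair.Fubini'[symmetric]) measurable
  also have "\<dots> = (\<integral>\<^sup>+\<zeta>. \<integral>\<^sup>+\<mu>. ?B \<mu> \<zeta> \<partial>lborel \<partial>lborel)"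
  proof (rule nn_integral_cong)
    fix \<zeta> :: 'a
    show "(\<integral>\<^sup>+r. ?A r \<zeta> \<partial>lborel)
      = (\<integral>\<^sup>+\<mu>. ?B \<mu> \<zeta> \<partial>lborel)"
    proof (cases "\<zeta> \<in> shell")
      case True
      then have P: "p \<zeta> > 0" using pos by (auto simp: shell_def)
      have pw: "p \<zeta> * p \<zeta> ^ (n - 1) = p \<zeta> ^ n" using n by (simp add: power_eq_if)
      have "(\<integral>\<^sup>+r. ?A r \<zeta> \<partial>lborel)
        = (\<integral>\<^sup>+\<mu>. ennreal (p \<zeta>) * (indicator {0<..} (p \<zeta> * \<mu>) * ennreal ((p \<zeta> * \<mu>) ^ (n - 1)) * indicator shell \<zeta> * F ((p \<zeta> * \<mu>) *\<^sub>R proj \<zeta>)) \<partial>lborel)"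
        using P by (subst nn_integral_real_affine[where c="p \<zeta>" and t=0]) (auto simp: nn_integral_cmult)
      also have "\<dots> = (\<integral>\<^sup>+\<mu>. ?B \<mu> \<zeta> \<partial>lborel)"
      proof (rule nn_integral_cong)
        fix \<mu> :: real
        have "indicator {0<..} (p \<zeta> * \<mu>) = (indicator {0<..} \<mu> :: ennreal)"
          using P by (auto simp: zero_less_mult_iff split: split_indicator)
        moreover have "(p \<zeta> * \<mu>) *\<^sub>R proj \<zeta> = \<mu> *\<^sub>R \<zeta>" using P by (simp add: proj_def)
        moreover have "ennreal (p \<zeta>) * ennreal ((p \<zeta> * \<mu>) ^ (n - 1)) = ennreal (p \<zeta> ^ n * \<mu> ^ (n - 1))" if "\<mu> > 0"
          using P that by (simp add: ennreal_mult[symmetric] power_mult_distrib pw[symmetric] mult.assoc)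
        ultimately show "ennreal (p \<zeta>) * (indicator {0<..} (p \<zeta> * \<mu>) * ennreal ((p \<zeta> * \<mu>) ^ (n - 1)) * indicator shell \<zeta> * F ((p \<zeta> * \<mu>) *\<^sub>R proj \<zeta>))
          = ?B \<mu> \<zeta>"
          by (auto simp: mult.assoc[symmetric] split: split_indicator)
      qed
      finally show ?thesis .
    qed simp
  qed
  also have "\<dots> = (\<integral>\<^sup>+\<mu>. \<integral>\<^sup>+\<zeta>. ?B \<mu> \<zeta> \<partial>lborel \<partial>lborel)"
    by (rule lborel_pair.Fubini') measurable
  also have "\<dots> = (\<integral>\<^sup>+\<mu>. \<integral>\<^sup>+\<eta>. W \<mu> \<eta> * F \<eta> \<partial>lborel \<partial>lborel)"
  proof (rule nn_integral_cong)
    fix \<mu> :: real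
    show "(\<integral>\<^sup>+\<zeta>. ?B \<mu> \<zeta> \<partial>lborel) = (\<integral>\<^sup>+\<eta>. W \<mu> \<eta> * F \<eta> \<partial>lborel)"
    proof (cases "\<mu> > 0")
      case True
      have "(\<integral>\<^sup>+\<zeta>. ?B \<mu> \<zeta> \<partial>lborel)
        = (\<integral>\<^sup>+\<eta>. ennreal ((1 / \<mu>) ^ n) * (indicator {0<..} \<mu> * ennreal (p ((1 / \<mu>) *\<^sub>R \<eta>) ^ n * \<mu> ^ (n - 1)) * indicator shell ((1 / \<mu>) *\<^sub>R \<eta>) * F (\<mu> *\<^sub>R ((1 / \<mu>) *\<^sub>R \<eta>))) \<partial>lborel)"
        using True by (subst lborel_nn_integral_affine[where c="1 / \<mu>" and t=0]) (auto simp: nn_integral_cmult n_def)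
      also have "\<dots> = (\<integral>\<^sup>+\<eta>. W \<mu> \<eta> * F \<eta> \<partial>lborel)"
      proof (rule nn_integral_cong)
        fix \<eta> :: 'a
        have F: "F (\<mu> *\<^sub>R ((1 / \<mu>) *\<^sub>R \<eta>)) = F \<eta>" using True by simp
        show "ennreal ((1 / \<mu>) ^ n) * (indicator {0<..} \<mu> * ennreal (p ((1 / \<mu>) *\<^sub>R \<eta>) ^ n * \<mu> ^ (n - 1)) * indicator shell ((1 / \<mu>) *\<^sub>R \<eta>) * F (\<mu> *\<^sub>R ((1 / \<mu>) *\<^sub>R \<eta>))) = W \<mu> \<eta> * F \<eta>"
        proof (cases "\<eta> = 0")
          case True then show ?thesis by (simp add: W_def shell_def)
        next
          case False
          then have "p ((1 / \<mu>) *\<^sub>R \<eta>) = p \<eta> / \<mu>" using homogeneous[of "1 / \<mu>" \<eta>] True by simp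
          moreover have "0 < p \<eta>" using pos False by blast
          ultimately show ?thesis unfolding F using True
            by (simp add: W_def ennreal_mult mult_ac inverse_eq_divide)
        qed
      qed
      finally show ?thesis .
    qed (simp add: W_def)
  qed
  also have "\<dots> = (\<integral>\<^sup>+\<eta>. \<integral>\<^sup>+\<mu>. W \<mu> \<eta> * F \<eta> \<partial>lborel \<partial>lborel)"
    by (rule lborel_pair.Fubini'[symmetric]) measurable
  also have "\<dots> = (\<integral>\<^sup>+\<eta>. (\<integral>\<^sup>+\<mu>. W \<mu> \<eta> \<partial>lborel) * F \<eta> \<partial>lborel)"
    by (intro nn_integral_cong nn_integral_multc) measurable
  finally have eq: "(\<integral>\<^sup>+r. \<integral>\<^sup>+\<zeta>. ?A r \<zeta> \<partial>lborel \<partial>lborel)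
     = (\<integral>\<^sup>+\<eta>. (\<integral>\<^sup>+\<mu>. W \<mu> \<eta> \<partial>lborel) * F \<eta> \<partial>lborel)" .
  have half: "1 \<le> 2 * (\<integral>\<^sup>+\<mu>. W \<mu> \<eta> \<partial>lborel)" if "\<eta> \<noteq> 0" for \<eta>
  proof -
    have P: "p \<eta> > 0" using pos that by blast
    have "(\<integral>\<^sup>+\<mu>. ennreal (1 / p \<eta>) * indicator {p \<eta> / 2..p \<eta>} \<mu> \<partial>lborel) = ennreal (1 / p \<eta>) * ennreal (p \<eta> / 2)"
      using P by (subst nn_integral_cmult_indicator) (auto simp: field_simps)
    also have "\<dots> = ennreal (1/2)" using P by (simp add: ennreal_mult[symmetric])
    finally have "ennreal (1/2) = (\<integral>\<^sup>+\<mu>. ennreal (1 / p \<eta>) * indicator {p \<eta> / 2..p \<eta>} \<mu> \<partial>lborel)" by simp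
    also have "\<dots> \<le> (\<integral>\<^sup>+\<mu>. W \<mu> \<eta> \<partial>lborel)"
    proof (rule nn_integral_mono)
      fix \<mu> :: real
      show "ennreal (1 / p \<eta>) * indicator {p \<eta> / 2..p \<eta>} \<mu> \<le> W \<mu> \<eta>"
      proof (cases "\<mu> \<in> {p \<eta> / 2..p \<eta>}")
        case True
        then have l: "\<mu> > 0" "\<mu> \<le> p \<eta>" "p \<eta> \<le> 2 * \<mu>" using P by auto
        have "p (\<eta> /\<^sub>R \<mu>) = p \<eta> / \<mu>" using homogeneous[of "inverse \<mu>" \<eta>] l that by (simp add: divide_inverse mult.commute)
        moreover have "1 \<le> p \<eta> / \<mu>" "p \<eta> / \<mu> \<le> 2" using l by (auto simp: field_simps)
        ultimately have "\<eta> /\<^sub>R \<mu> \<in> shell" using l that by (simp add: shell_def)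
        moreover have "1 / p \<eta> \<le> (1 / \<mu>) ^ n * (p \<eta> / \<mu>) ^ n * \<mu> ^ (n - 1)"
        proof -
          have "(1 / \<mu>) ^ n * (p \<eta> / \<mu>) ^ n * \<mu> ^ (n - 1) = (p \<eta> / \<mu>) ^ n * (1 / \<mu>)"
            using l n by (simp add: power_eq_if[of _ n] field_simps)
          moreover have "1 \<le> (p \<eta> / \<mu>) ^ n" using l by (intro one_le_power) (simp add: field_simps)
          moreover have "1 / p \<eta> \<le> 1 / \<mu>" using l by (intro divide_left_mono) auto
          ultimately show ?thesis using l mult_mono[of 1 "(p \<eta> / \<mu>) ^ n" "1 / p \<eta>" "1 / \<mu>"] P by simp
        qed
        ultimately show ?thesis using l by (simp add: W_def ennreal_leI)
      qed simp
    qed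
    finally have "2 * ennreal (1/2) \<le> 2 * (\<integral>\<^sup>+\<mu>. W \<mu> \<eta> \<partial>lborel)" by (intro mult_left_mono) auto
    moreover have "2 * ennreal (1/2) = 1"
      using ennreal_mult[of 2 "1/2"] by simp
    ultimately show ?thesis by simp
  qed
  have "(\<integral>\<^sup>+\<eta>. F \<eta> \<partial>lborel) \<le> (\<integral>\<^sup>+\<eta>. 2 * ((\<integral>\<^sup>+\<mu>. W \<mu> \<eta> \<partial>lborel) * F \<eta>) \<partial>lborel)"
  proof (rule nn_integral_mono_AE, use AE_lborel_singleton[of "0::'a"] in eventually_elim)
    case (elim \<eta>)
    show ?case using mult_right_mono[OF half[OF elim], of "F \<eta>"] by (simp add: mult.assoc)
  qed
  also have "\<dots> = 2 * (\<integral>\<^sup>+\<eta>. (\<integral>\<^sup>+\<mu>. W \<mu> \<eta> \<partial>lborel) * F \<eta> \<partial>lborel)"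
    by (rule nn_integral_cmult) measurable
  finally show ?thesis unfolding eq[symmetric] n_def .
qed

text \<open>The cone measure of a ball of radius \<open>w\<close> is \<open>O(w\<^sup>n\<^sup>-\<^sup>1)\<close>, with a Gaussian in place of the ball.
  For bounded \<open>z\<close> and small \<open>w\<close>: if the projection of \<open>\<zeta>\<close> is close to \<open>z\<close>, then \<open>\<zeta>\<close> is
  close to \<open>\<mu> z\<close> for all \<open>\<mu>\<close> in the interval \<open>[p \<zeta>, p \<zeta> + w]\<close>; averaging over \<open>\<mu>\<close> costs
  a factor \<open>1 / w\<close> and leaves full-dimensional Gaussian integrals. For \<open>z\<close> far from the level set
  the Gaussian is small on the whole shell.\<close>

lemma shell_gaussian_bound:
  "\<exists>C>0. \<forall>z w. w > 0 \<longrightarrow>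
     (\<integral>\<^sup>+\<zeta>. indicator shell \<zeta> * ennreal (exp (- ((norm (z - proj \<zeta>))\<^sup>2 / (4 * w\<^sup>2)))) \<partial>lborel)
       \<le> ennreal (C * min 1 ((w / max 1 (norm z)) ^ (DIM('a) - 1)))"
proof -
  define n where "n = DIM('a)"
  have n: "n > 0" by (simp add: n_def)
  obtain c where c: "c > 0" "\<And>\<xi>. \<xi> \<noteq> 0 \<Longrightarrow> c * norm \<xi> \<le> p \<xi>" using lower_bound by blast
  define R0 where "R0 = 1 / c"
  define Z where "Z = max 1 (2 * R0)"
  have R0: "R0 > 0" "norm (proj \<zeta>) \<le> R0" if "\<zeta> \<in> shell" for \<zeta>
    using c that pos[of \<zeta>] by (auto simp: R0_def shell_def proj_def field_simps)
  \<comment> \<open>\<open>R0\<close> bounds the level set \<open>p = 1\<close>; points with norm above \<open>Z\<close> have distance at least half their norm to it.\<close>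
  have Z: "Z \<ge> 1" "2 * R0 \<le> Z" by (auto simp: Z_def)
  define M where "M = measure lborel shell"
  have M: "emeasure lborel shell = ennreal M"
  proof -
    have "shell \<subseteq> cball 0 (2 / c)"
    proof
      fix \<zeta> assume "\<zeta> \<in> shell"
      then have "c * norm \<zeta> \<le> 2" using c(2)[of \<zeta>] by (auto simp: shell_def)
      then show "\<zeta> \<in> cball 0 (2 / c)" using c(1) by (simp add: field_simps)
    qed
    then have "emeasure lborel shell \<le> emeasure lborel (cball (0::'a) (2 / c))" by (intro emeasure_mono) auto
    also have "\<dots> < \<infinity>" by (rule emeasure_lborel_cball_finite)
    finally show ?thesis unfolding M_def by (intro emeasure_eq_ennreal_measure) auto
  qed
  have M0: "M \<ge> 0" by (simp add: M_def)
  define A where "A = 2 * exp (Z\<^sup>2 / 16) * sqrt (32 * pi) ^ n"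
  have A0: "A > 0" by (simp add: A_def)
  define K where "K = 16 ^ n * (fact n :: real)"
  have K1: "K \<ge> 1" unfolding K_def using mult_mono[of 1 "16 ^ n" 1 "fact n :: real"] by simp
  define C where "C = A * Z ^ (n - 1) + M * Z ^ (n - 1) + M * K"
  have Zn: "Z ^ (n - 1) \<ge> 1" using Z by simp
  have C0: "C > 0" using A0 M0 Zn K1 by (simp add: C_def add_pos_nonneg)
  let ?I = "\<lambda>z w. \<integral>\<^sup>+\<zeta>. indicator shell \<zeta> * ennreal (exp (- ((norm (z - proj \<zeta>))\<^sup>2 / (4 * w\<^sup>2)))) \<partial>lborel"
  let ?m = "\<lambda>z w. min 1 ((w / max 1 (norm z)) ^ (n - 1))"
  let ?g = "\<lambda>\<zeta> \<mu> w z. ennreal (exp (- (1 / (32 * w\<^sup>2)) * (norm (\<zeta> - \<mu> *\<^sub>R z))\<^sup>2))"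
  have main: "?I z w \<le> ennreal (C * ?m z w)" if w: "w > 0" for z w
  proof -
    have IM: "?I z w \<le> ennreal M"
    proof -
      have "?I z w \<le> (\<integral>\<^sup>+\<zeta>. indicator shell \<zeta> \<partial>lborel)"
        by (intro nn_integral_mono) (auto split: split_indicator)
      then show ?thesis by (simp add: M)
    qed
    consider (A) "norm z \<le> Z" "w \<le> 1" | (B) "norm z \<le> Z" "w > 1" | (C) "norm z > Z" by linarith
    then show ?thesis
    proof cases
      case A
      have pt: "indicator shell \<zeta> * ennreal (exp (- ((norm (z - proj \<zeta>))\<^sup>2 / (4 * w\<^sup>2))))
        \<le> ennreal (exp (Z\<^sup>2 / 16) / w) * (\<integral>\<^sup>+\<mu>. indicator {1..3} \<mu> * ?g \<zeta> \<mu> w z \<partial>lborel)" for \<zeta>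
      proof (cases "\<zeta> \<in> shell")
        case True
        define d where "d = norm (z - proj \<zeta>)"
        have ps: "\<zeta> \<noteq> 0" "1 \<le> p \<zeta>" "p \<zeta> \<le> 2" using True by (auto simp: shell_def)
        have "exp (- (d\<^sup>2 / (4 * w\<^sup>2))) \<le> exp (Z\<^sup>2 / 16) * exp (- (1 / (32 * w\<^sup>2)) * (norm (\<zeta> - \<mu> *\<^sub>R z))\<^sup>2)"
          if l: "\<mu> \<in> {p \<zeta>..p \<zeta> + w}" for \<mu>
        proof -
          have "\<zeta> - \<mu> *\<^sub>R z = p \<zeta> *\<^sub>R (proj \<zeta> - z) - (\<mu> - p \<zeta>) *\<^sub>R z"
            using ps by (simp add: proj_def algebra_simps)
          then have "norm (\<zeta> - \<mu> *\<^sub>R z) \<le> norm (p \<zeta> *\<^sub>R (proj \<zeta> - z)) + norm ((\<mu> - p \<zeta>) *\<^sub>R z)"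
            by (simp only: norm_triangle_ineq4)
          also have "\<dots> \<le> 2 * d + w * Z"
            using l ps A w by (intro add_mono) (auto simp: d_def norm_minus_commute intro!: mult_mono)
          finally have "(norm (\<zeta> - \<mu> *\<^sub>R z))\<^sup>2 \<le> (2 * d + w * Z)\<^sup>2" by (intro power_mono) auto
          also have "\<dots> \<le> 8 * d\<^sup>2 + 2 * w\<^sup>2 * Z\<^sup>2"
            using zero_le_power2[of "2 * d - w * Z"] by (simp add: power2_eq_square algebra_simps)
          finally have "(1 / (32 * w\<^sup>2)) * (norm (\<zeta> - \<mu> *\<^sub>R z))\<^sup>2 \<le> (1 / (32 * w\<^sup>2)) * (8 * d\<^sup>2 + 2 * w\<^sup>2 * Z\<^sup>2)"
            by (intro mult_left_mono) auto
          also have "\<dots> = d\<^sup>2 / (4 * w\<^sup>2) + Z\<^sup>2 / 16"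
            using w by (simp add: field_simps)
          finally have "- (d\<^sup>2 / (4 * w\<^sup>2)) \<le> Z\<^sup>2 / 16 + - (1 / (32 * w\<^sup>2)) * (norm (\<zeta> - \<mu> *\<^sub>R z))\<^sup>2" by simp
          then show ?thesis unfolding exp_add[symmetric] by (rule exp_mono)
        qed
        then have *: "ennreal (exp (- (d\<^sup>2 / (4 * w\<^sup>2)))) * indicator {p \<zeta>..p \<zeta> + w} \<mu>
          \<le> ennreal (exp (Z\<^sup>2 / 16)) * (indicator {1..3} \<mu> * ?g \<zeta> \<mu> w z)" for \<mu>
          using ps A by (auto simp: ennreal_mult[symmetric] split: split_indicator intro!: ennreal_leI)
        have "ennreal (exp (- (d\<^sup>2 / (4 * w\<^sup>2)))) * ennreal w
          = (\<integral>\<^sup>+\<mu>. ennreal (exp (- (d\<^sup>2 / (4 * w\<^sup>2)))) * indicator {p \<zeta>..p \<zeta> + w} \<mu> \<partial>lborel)"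
          using w by (subst nn_integral_cmult_indicator) auto
        also have "\<dots> \<le> (\<integral>\<^sup>+\<mu>. ennreal (exp (Z\<^sup>2 / 16)) * (indicator {1..3} \<mu> * ?g \<zeta> \<mu> w z) \<partial>lborel)"
          by (intro nn_integral_mono *)
        also have "\<dots> = ennreal (exp (Z\<^sup>2 / 16)) * (\<integral>\<^sup>+\<mu>. indicator {1..3} \<mu> * ?g \<zeta> \<mu> w z \<partial>lborel)"
          by (rule nn_integral_cmult) measurable
        finally have "ennreal (1 / w) * (ennreal (exp (- (d\<^sup>2 / (4 * w\<^sup>2)))) * ennreal w)
          \<le> ennreal (1 / w) * (ennreal (exp (Z\<^sup>2 / 16)) * (\<integral>\<^sup>+\<mu>. indicator {1..3} \<mu> * ?g \<zeta> \<mu> w z \<partial>lborel))"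
          by (intro mult_left_mono) auto
        moreover have "ennreal (1 / w) * (ennreal (exp (- (d\<^sup>2 / (4 * w\<^sup>2)))) * ennreal w) = ennreal (exp (- (d\<^sup>2 / (4 * w\<^sup>2))))"
          using w by (simp add: ennreal_mult[symmetric])
        moreover have "ennreal (1 / w) * (ennreal (exp (Z\<^sup>2 / 16)) * X) = ennreal (exp (Z\<^sup>2 / 16) / w) * X" for X
          using w by (simp add: ennreal_mult[symmetric] mult.assoc[symmetric])
        ultimately show ?thesis using True by (simp add: d_def)
      qed simp
      have "?I z w \<le> (\<integral>\<^sup>+\<zeta>. ennreal (exp (Z\<^sup>2 / 16) / w) * (\<integral>\<^sup>+\<mu>. indicator {1..3} \<mu> * ?g \<zeta> \<mu> w z \<partial>lborel) \<partial>lborel)"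
        by (intro nn_integral_mono pt)
      also have "\<dots> = ennreal (exp (Z\<^sup>2 / 16) / w) * (\<integral>\<^sup>+\<zeta>. \<integral>\<^sup>+\<mu>. indicator {1..3} \<mu> * ?g \<zeta> \<mu> w z \<partial>lborel \<partial>lborel)"
        by (rule nn_integral_cmult) measurable
      also have "(\<integral>\<^sup>+\<zeta>. \<integral>\<^sup>+\<mu>. indicator {1..3} \<mu> * ?g \<zeta> \<mu> w z \<partial>lborel \<partial>lborel)
        = (\<integral>\<^sup>+\<mu>. \<integral>\<^sup>+\<zeta>. indicator {1..3} \<mu> * ?g \<zeta> \<mu> w z \<partial>lborel \<partial>lborel)"
        by (rule lborel_pair.Fubini') measurable
      also have "\<dots> = (\<integral>\<^sup>+\<mu>. ennreal (sqrt (32 * pi) ^ n * w ^ n) * indicator {1..3::real} \<mu> \<partial>lborel)"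
      proof (rule nn_integral_cong)
        fix \<mu> :: real
        have "(\<integral>\<^sup>+\<zeta>. ?g \<zeta> \<mu> w z \<partial>lborel)
          = (\<integral>\<^sup>+\<zeta>. ennreal (exp (- (1 / (32 * w\<^sup>2)) * (norm (\<zeta>::'a))\<^sup>2)) \<partial>lborel)"
          by (subst lborel_nn_integral_affine[where c=1 and t="\<mu> *\<^sub>R z"]) auto
        also have "\<dots> = ennreal (sqrt (pi / (1 / (32 * w\<^sup>2))) ^ n)"
          using w by (subst gaussian_nn_integral) (auto simp: n_def)
        also have "sqrt (pi / (1 / (32 * w\<^sup>2))) = sqrt (32 * pi) * w"
          using w by (simp add: real_sqrt_mult mult_ac)
        finally have "(\<integral>\<^sup>+\<zeta>. ?g \<zeta> \<mu> w z \<partial>lborel) = ennreal (sqrt (32 * pi) ^ n * w ^ n)"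
          by (simp only: power_mult_distrib)
        then show "(\<integral>\<^sup>+\<zeta>. indicator {1..3} \<mu> * ?g \<zeta> \<mu> w z \<partial>lborel)
          = ennreal (sqrt (32 * pi) ^ n * w ^ n) * indicator {1..3} \<mu>"
          by (cases "\<mu> \<in> {1..3}") auto
      qed
      also have "\<dots> = ennreal (sqrt (32 * pi) ^ n * w ^ n) * 2"
        by (subst nn_integral_cmult_indicator) auto
      also have "ennreal (exp (Z\<^sup>2 / 16) / w) * (ennreal (sqrt (32 * pi) ^ n * w ^ n) * 2) = ennreal (A * w ^ (n - 1))"
      proof -
        have "ennreal (sqrt (32 * pi) ^ n * w ^ n) * 2 = ennreal (sqrt (32 * pi) ^ n * w ^ n * 2)"
          using w by (subst ennreal_mult) auto
        moreover have "exp (Z\<^sup>2 / 16) / w * (sqrt (32 * pi) ^ n * w ^ n * 2) = A * w ^ (n - 1)"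
          using w n by (simp add: A_def power_eq_if[of w n])
        ultimately show ?thesis using w by (simp only: ennreal_mult''[symmetric] zero_le_mult_iff zero_le_power less_imp_le real_sqrt_ge_0_iff) (simp add: ennreal_mult[symmetric])
      qed
      finally have IA: "?I z w \<le> ennreal (A * w ^ (n - 1))" .
      have "A * w ^ (n - 1) \<le> (A * Z ^ (n - 1)) * ?m z w"
      proof -
        have "w ^ (n - 1) \<le> 1" using A w by (intro power_le_one) auto
        moreover have "w ^ (n - 1) \<le> Z ^ (n - 1) * (w / max 1 (norm z)) ^ (n - 1)"
        proof -
          have "w \<le> Z * (w / max 1 (norm z))" using A w Z by (simp add: field_simps)
          then have "w ^ (n - 1) \<le> (Z * (w / max 1 (norm z))) ^ (n - 1)" using w by (intro power_mono) auto
          then show ?thesis by (simp only: power_mult_distrib)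
        qed
        ultimately have "w ^ (n - 1) \<le> Z ^ (n - 1) * ?m z w"
          using Zn by (auto simp: min_def)
        from mult_left_mono[OF this less_imp_le[OF A0]] show ?thesis by (simp add: mult.assoc)
      qed
      also have "\<dots> \<le> C * ?m z w"
        unfolding C_def using M0 Zn K1 w by (intro mult_right_mono) auto
      finally show ?thesis using IA by (meson ennreal_leI order_trans)
    next
      case B
      have "1 \<le> Z * (w / max 1 (norm z))"
      proof -
        have "max 1 (norm z) \<le> Z * w" using B Z mult_mono[of 1 Z 1 w] mult_mono[of "norm z" Z 1 w] by auto
        then show ?thesis by (simp add: field_simps)
      qed
      then have "1 \<le> (Z * (w / max 1 (norm z))) ^ (n - 1)" by (rule one_le_power)
      then have "1 \<le> Z ^ (n - 1) * (w / max 1 (norm z)) ^ (n - 1)" by (simp only: power_mult_distrib)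
      then have "1 \<le> Z ^ (n - 1) * ?m z w"
        using Zn by (auto simp: min_def)
      from mult_left_mono[OF this M0] have "M \<le> (M * Z ^ (n - 1)) * ?m z w"
        by (simp add: mult.assoc)
      also have "\<dots> \<le> C * ?m z w"
        unfolding C_def using M0 Zn K1 A0 w by (intro mult_right_mono) auto
      finally show ?thesis using IM by (meson ennreal_leI order_trans)
    next
      case C
      define x where "x = norm z / w"
      have zz: "norm z > 0" using C Z by linarith
      have x: "x > 0" using zz w by (simp add: x_def)
      have mx: "max 1 (norm z) = norm z" using C Z by simp
      have "?I z w \<le> (\<integral>\<^sup>+\<zeta>. ennreal (exp (- (x\<^sup>2 / 16))) * indicator shell \<zeta> \<partial>lborel)"
      proof (rule nn_integral_mono)
        fix \<zeta>
        show "indicator shell \<zeta> * ennreal (exp (- ((norm (z - proj \<zeta>))\<^sup>2 / (4 * w\<^sup>2)))) \<le> ennreal (exp (- (x\<^sup>2 / 16))) * indicator shell \<zeta>"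
        proof (cases "\<zeta> \<in> shell")
          case True
          have "norm z / 2 \<le> norm (z - proj \<zeta>)"
            using R0(2)[OF True] C Z norm_triangle_ineq2[of z "proj \<zeta>"] by linarith
          then have "(norm z / 2)\<^sup>2 \<le> (norm (z - proj \<zeta>))\<^sup>2" by (intro power_mono) auto
          then have "x\<^sup>2 / 16 \<le> (norm (z - proj \<zeta>))\<^sup>2 / (4 * w\<^sup>2)"
            using w by (simp add: x_def power_divide field_simps)
          then show ?thesis using True by (simp add: ennreal_leI)
        qed simp
      qed
      also have "\<dots> = ennreal (exp (- (x\<^sup>2 / 16)) * M)"
        by (subst nn_integral_cmult_indicator) (auto simp: M ennreal_mult[symmetric] M0)
      finally have IC: "?I z w \<le> ennreal (exp (- (x\<^sup>2 / 16)) * M)" .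
      have "exp (- (x\<^sup>2 / 16)) \<le> K * min 1 ((1 / x) ^ (n - 1))"
      proof (cases "x \<le> 1")
        case True
        have "(1 / x) ^ (n - 1) \<ge> 1" using True x by (intro one_le_power) simp
        moreover have "exp (- (x\<^sup>2 / 16)) \<le> K" by (rule order_trans[OF _ K1]) simp
        ultimately show ?thesis by (simp add: min_def)
      next
        case False
        have "x ^ (n - 1) \<le> x ^ (2 * n)" using False by (intro power_increasing) auto
        also have "\<dots> = 16 ^ n * (x\<^sup>2 / 16) ^ n" by (simp add: power_mult power_divide)
        also have "\<dots> \<le> 16 ^ n * (fact n * exp (x\<^sup>2 / 16))" by (intro mult_left_mono power_le_fact_exp) auto
        finally have "x ^ (n - 1) * exp (- (x\<^sup>2 / 16)) \<le> K"
          by (simp add: K_def exp_minus field_simps)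
        then have "exp (- (x\<^sup>2 / 16)) \<le> K * (1 / x) ^ (n - 1)"
          using x by (simp add: field_simps)
        moreover have "(1 / x) ^ (n - 1) \<le> 1" using False by (intro power_le_one) auto
        ultimately show ?thesis by simp
      qed
      from mult_right_mono[OF this M0]
      have "exp (- (x\<^sup>2 / 16)) * M \<le> (M * K) * ?m z w"
        using w zz by (simp add: mx x_def mult_ac)
      also have "\<dots> \<le> C * ?m z w"
        unfolding C_def using M0 Zn K1 A0 w by (intro mult_right_mono) auto
      finally show ?thesis using IC by (meson ennreal_leI order_trans)
    qed
  qed
  show ?thesis using C0 main unfolding n_def by blast
qed

end

section \<open>The kernel of the weight\<close>

text \<open>With \<open>A = 1 + \<bar>x\<bar>\<^sup>2\<close> this writes the weight as a superposition of Gaussians. The parameter is the square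
  root of the usual one, so that only integer powers of \<open>w\<close> occur below.\<close>

lemma nn_integral_exp_weight:
  assumes A: "A > 0"
  shows "(\<integral>\<^sup>+w. indicator {0<..} w * ennreal (2 * w * exp (- (w\<^sup>2 * A))) \<partial>lborel) = ennreal (1 / A)"
proof -
  have "(\<integral>\<^sup>+w. ennreal (2 * w * exp (- (w\<^sup>2 * A))) * indicator {0..} w \<partial>lborel) = ennreal (0 - (- exp (- (0\<^sup>2 * A)) / A))"
  proof (rule nn_integral_FTC_atLeast)
    have "filterlim (\<lambda>w::real. w\<^sup>2 * A) at_top at_top"
      using A by (intro filterlim_at_top_mult_tendsto_pos[OF tendsto_const] filterlim_pow_at_top filterlim_ident) auto
    then have "((\<lambda>w. exp (- (w\<^sup>2 * A))) \<longlongrightarrow> 0) at_top"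
      by (intro filterlim_compose[OF exp_at_bot] filterlim_compose[OF filterlim_uminus_at_bot_at_top])
    then have "((\<lambda>w. - exp (- (w\<^sup>2 * A)) / A) \<longlongrightarrow> - 0 / A) at_top" by (intro tendsto_intros) (use A in auto)
    then show "((\<lambda>w. - exp (- (w\<^sup>2 * A)) / A) \<longlongrightarrow> 0) at_top" by simp
  qed (use A in \<open>auto intro!: derivative_eq_intros\<close>)
  moreover have "(\<integral>\<^sup>+w. indicator {0<..} w * ennreal (2 * w * exp (- (w\<^sup>2 * A))) \<partial>lborel)
    = (\<integral>\<^sup>+w. ennreal (2 * w * exp (- (w\<^sup>2 * A))) * indicator {0..} w \<partial>lborel)"
    by (intro nn_integral_cong) (auto split: split_indicator)
  ultimately show ?thesis by simp
qed

lemma nn_integral_inverse_square: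
  assumes q: "q > 0"
  shows "(\<integral>\<^sup>+w. ennreal (2 * q / w\<^sup>2) * indicator {q..} w \<partial>lborel) = ennreal 2"
proof -
  have "(\<integral>\<^sup>+w. ennreal (2 * q / w\<^sup>2) * indicator {q..} w \<partial>lborel) = ennreal (0 - (- (2 * q / q)))"
  proof (rule nn_integral_FTC_atLeast[where F="\<lambda>w. - (2 * q / w)"])
    have "((\<lambda>w. - (2 * q * inverse w)) \<longlongrightarrow> - (2 * q * 0)) at_top"
      by (intro tendsto_intros tendsto_inverse_0_at_top filterlim_ident)
    then show "((\<lambda>w. - (2 * q / w)) \<longlongrightarrow> 0) at_top" by (simp add: divide_inverse)
  qed (use q in \<open>auto intro!: derivative_eq_intros simp: power2_eq_square field_simps\<close>)
  then show ?thesis using q by simp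
qed

text \<open>The integral over the scales \<open>w\<close> that make up the weight \<open>(1 + \<bar>x\<bar>\<^sup>2)\<^sup>-\<^sup>1\<close>. The two bounds
  come from the exponential factor when \<open>q\<close> is large, and from the scales below and above \<open>q\<close> when
  \<open>q\<close> is small; convergence at large scales is where \<open>n \<ge> 3\<close> enters, as \<open>(q / w)\<^sup>n\<^sup>-\<^sup>1 \<le> (q / w)\<^sup>2\<close>.\<close>

lemma scale_integral_bound:
  fixes q :: real
  assumes q: "q > 0" and n: "n \<ge> 3"
  shows "(\<integral>\<^sup>+w. indicator {0<..} w * ennreal (2 * w * exp (- w\<^sup>2) * (1 / w) ^ n * q ^ (n - 2) * min 1 ((w / q) ^ (n - 1))) \<partial>lborel)
    \<le> ennreal (4 * min 1 (1 / q))"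
proof -
  let ?T = "\<lambda>w. 2 * w * exp (- w\<^sup>2) * (1 / w) ^ n * q ^ (n - 2) * min 1 ((w / q) ^ (n - 1))"
  obtain m where m: "n = m + 3" using n by (metis add.commute le_Suc_ex)
  \<comment> \<open>In terms of the ratio \<open>q / w\<close> all powers collapse.\<close>
  have T: "?T w = (2 / q) * exp (- w\<^sup>2) * min 1 ((q / w) ^ (m + 2))" if w: "w > 0" for w
  proof -
    have "2 * w * exp (- w\<^sup>2) * (1 / w) ^ n * q ^ (n - 2) = (2 / q) * exp (- w\<^sup>2) * (q / w) ^ (m + 2)"
      using w q by (simp add: m power_add power_divide power2_eq_square power3_eq_cube field_simps)
    moreover have "(q / w) ^ (m + 2) * min 1 ((w / q) ^ (m + 2)) = min 1 ((q / w) ^ (m + 2))"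
    proof -
      have "(q / w) ^ (m + 2) * (w / q) ^ (m + 2) = 1"
        using w q by (simp add: power_mult_distrib[symmetric] del: power_add power_Suc)
      moreover have "(q / w) ^ (m + 2) \<ge> 0" using w q by (intro zero_le_power) auto
      ultimately show ?thesis by (simp add: min_mult_distrib_left min.commute)
    qed
    moreover have "n - 1 = m + 2" using m by simp
    ultimately show ?thesis by (simp only: mult.assoc)
  qed
  have le1: "?T w \<le> (2 / q) * exp (- w\<^sup>2)" if "w > 0" for w
    unfolding T[OF that] using q by (intro mult_left_le) auto
  have le2: "?T w \<le> 2 / q" if "w > 0" for w
    using le1[OF that] q mult_left_le[of "exp (- w\<^sup>2)" "2 / q"] by auto
  have le3: "?T w \<le> 2 * q / w\<^sup>2" if "w \<ge> q" for w
  proof -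
    have w: "w > 0" using that q by simp
    have "exp (- w\<^sup>2) * min 1 ((q / w) ^ (m + 2)) \<le> 1 * (q / w) ^ 2"
    proof (intro mult_mono)
      have "(q / w) ^ (m + 2) \<le> (q / w) ^ 2" using that q w by (intro power_decreasing) auto
      then show "min 1 ((q / w) ^ (m + 2)) \<le> (q / w) ^ 2" by simp
    qed (use w q in auto)
    then have "(2 / q) * (exp (- w\<^sup>2) * min 1 ((q / w) ^ (m + 2))) \<le> (2 / q) * (1 * (q / w) ^ 2)"
      using q by (intro mult_left_mono) auto
    also have "\<dots> = 2 * q / w\<^sup>2" using q by (simp add: power2_eq_square)
    finally show ?thesis unfolding T[OF w] by (simp only: mult.assoc)
  qed
  have "(\<integral>\<^sup>+w. indicator {0<..} w * ennreal (?T w) \<partial>lborel) \<le> ennreal (4 / q)"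
  proof -
    have "(\<integral>\<^sup>+w. indicator {0<..} w * ennreal (?T w) \<partial>lborel) \<le> (\<integral>\<^sup>+w. ennreal (2 / q) * ennreal (exp (- 1 * (norm (w::real))\<^sup>2)) \<partial>lborel)"
      using q le1 by (intro nn_integral_mono) (auto simp: ennreal_mult[symmetric] intro!: ennreal_leI split: split_indicator)
    also have "\<dots> = ennreal (2 / q) * ennreal (sqrt pi)"
      using gaussian_nn_integral[of 1, where 'a=real] by (subst nn_integral_cmult) auto
    also have "\<dots> \<le> ennreal (2 / q) * ennreal 2"
    proof -
      have "sqrt pi \<le> sqrt (2\<^sup>2)" using pi_less_4 by (intro real_sqrt_le_mono) simp
      then show ?thesis by (intro mult_left_mono ennreal_leI) auto
    qed
    also have "ennreal (2 / q) * ennreal 2 = ennreal (4 / q)"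
      using q by (subst ennreal_mult[symmetric]) auto
    finally show ?thesis .
  qed
  moreover have "(\<integral>\<^sup>+w. indicator {0<..} w * ennreal (?T w) \<partial>lborel) \<le> ennreal 4"
  proof -
    have "(\<integral>\<^sup>+w. indicator {0<..} w * ennreal (?T w) \<partial>lborel)
      \<le> (\<integral>\<^sup>+w. ennreal (2 / q) * indicator {0..q} w + ennreal (2 * q / w\<^sup>2) * indicator {q..} w \<partial>lborel)"
    proof (rule nn_integral_mono)
      fix w :: real
      consider "w \<le> 0" | "0 < w" "w \<le> q" | "w > q" by linarith
      then show "indicator {0<..} w * ennreal (?T w) \<le> ennreal (2 / q) * indicator {0..q} w + ennreal (2 * q / w\<^sup>2) * indicator {q..} w"
      proof cases
        case 2 then show ?thesis using le2[of w] by (auto intro: add_increasing2 ennreal_leI)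
      next
        case 3 then show ?thesis using le3[of w] q by (auto intro: ennreal_leI)
      qed simp
    qed
    also have "\<dots> = ennreal (2 / q) * ennreal q + ennreal 2"
      using q by (simp add: nn_integral_add nn_integral_cmult_indicator nn_integral_inverse_square)
    also have "\<dots> = ennreal 4" using q by (simp add: ennreal_mult[symmetric] flip: ennreal_plus ennreal_numeral)
    finally show ?thesis .
  qed
  ultimately show ?thesis by (simp add: min_def)
qed

context homogeneous_symbol
begin

text \<open>Rescaling by \<open>r\<close> reduces each Gaussian to \<open>shell_gaussian_bound\<close> with \<open>z = \<eta> / r\<close> and width \<open>w / r\<close>;
  the bound depends on \<open>\<eta>\<close> and \<open>r\<close> only through \<open>q = max r \<bar>\<eta>\<bar>\<close>.\<close>

lemma shell_kernel_bound:
  assumes dim: "DIM('a) \<ge> 3"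
  shows "\<exists>C>0. \<forall>\<eta> r. r > 0 \<longrightarrow>
     ennreal (r ^ (DIM('a) - 2)) * (\<integral>\<^sup>+w. \<integral>\<^sup>+\<zeta>. indicator {0<..} w * ennreal (2 * w * exp (- w\<^sup>2))
        * (indicator shell \<zeta> * ennreal (gauss_hat (w\<^sup>2) (\<eta> - r *\<^sub>R proj \<zeta>))) \<partial>lborel \<partial>lborel)
     \<le> ennreal (C / japanese \<eta>)"
proof -
  define n where "n = DIM('a)"
  have n: "n \<ge> 3" using dim by (simp add: n_def)
  obtain C where C: "C > 0" and shell: "\<And>z w. w > 0 \<Longrightarrow>
     (\<integral>\<^sup>+\<zeta>. indicator shell \<zeta> * ennreal (exp (- ((norm (z - proj \<zeta>))\<^sup>2 / (4 * w\<^sup>2)))) \<partial>lborel)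
       \<le> ennreal (C * min 1 ((w / max 1 (norm z)) ^ (n - 1)))"
    using shell_gaussian_bound unfolding n_def by blast
  define P where "P = sqrt pi ^ n"
  have P: "P > 0" by (simp add: P_def)
  let ?G = "\<lambda>w \<zeta> \<eta> r. indicator {0<..} w * ennreal (2 * w * exp (- w\<^sup>2))
        * (indicator shell \<zeta> * ennreal (gauss_hat (w\<^sup>2) (\<eta> - r *\<^sub>R proj \<zeta>)))"
  have "ennreal (r ^ (n - 2)) * (\<integral>\<^sup>+w. \<integral>\<^sup>+\<zeta>. ?G w \<zeta> \<eta> r \<partial>lborel \<partial>lborel)
     \<le> ennreal (8 * P * C / japanese \<eta>)" if r: "r > 0" for \<eta> r
  proof -
    define q where "q = max r (norm \<eta>)"
    have q: "q > 0" "r \<le> q" "norm \<eta> \<le> q" using r by (auto simp: q_def)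
    define f where "f w = indicator {0<..} w * ennreal (2 * w * exp (- w\<^sup>2) * (1 / w) ^ n * min 1 ((w / q) ^ (n - 1)))" for w
    have mf [measurable]: "f \<in> borel_measurable lborel" unfolding f_def[abs_def] by measurable
    have inner: "(\<integral>\<^sup>+\<zeta>. ?G w \<zeta> \<eta> r \<partial>lborel)
      \<le> ennreal (P * C) * f w" for w
    proof (cases "w > 0")
      case True
      have g: "gauss_hat (w\<^sup>2) (\<eta> - r *\<^sub>R proj \<zeta>) = P * (1 / w) ^ n * exp (- ((norm (\<eta> /\<^sub>R r - proj \<zeta>))\<^sup>2 / (4 * (w / r)\<^sup>2)))" for \<zeta>
      proof -
        have "\<eta> - r *\<^sub>R proj \<zeta> = r *\<^sub>R (\<eta> /\<^sub>R r - proj \<zeta>)" using r by (simp add: algebra_simps)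
        then have "norm (\<eta> - r *\<^sub>R proj \<zeta>) = r * norm (\<eta> /\<^sub>R r - proj \<zeta>)" using r by simp
        then show ?thesis using r True
          by (simp add: gauss_hat_def n_def P_def real_sqrt_divide power_divide power_mult_distrib mult_ac)
      qed
      have "(\<integral>\<^sup>+\<zeta>. ?G w \<zeta> \<eta> r \<partial>lborel)
        = (\<integral>\<^sup>+\<zeta>. ennreal (2 * w * exp (- w\<^sup>2) * (P * (1 / w) ^ n)) * (indicator shell \<zeta> * ennreal (exp (- ((norm (\<eta> /\<^sub>R r - proj \<zeta>))\<^sup>2 / (4 * (w / r)\<^sup>2))))) \<partial>lborel)"
        unfolding g using True P by (intro nn_integral_cong) (simp add: ennreal_mult mult_ac)
      also have "\<dots> = ennreal (2 * w * exp (- w\<^sup>2) * (P * (1 / w) ^ n)) * (\<integral>\<^sup>+\<zeta>. indicator shell \<zeta> * ennreal (exp (- ((norm (\<eta> /\<^sub>R r - proj \<zeta>))\<^sup>2 / (4 * (w / r)\<^sup>2)))) \<partial>lborel)"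
        by (intro nn_integral_cmult) measurable
      also have "\<dots> \<le> ennreal (2 * w * exp (- w\<^sup>2) * (P * (1 / w) ^ n)) * ennreal (C * min 1 (((w / r) / max 1 (norm (\<eta> /\<^sub>R r))) ^ (n - 1)))"
        using True r by (intro mult_left_mono shell) auto
      also have "(w / r) / max 1 (norm (\<eta> /\<^sub>R r)) = w / q"
        using r by (auto simp: q_def max_def field_simps)
      also have "ennreal (2 * w * exp (- w\<^sup>2) * (P * (1 / w) ^ n)) * ennreal (C * min 1 ((w / q) ^ (n - 1)))
        = ennreal (P * C) * f w"
        using True P C q by (simp add: f_def ennreal_mult[symmetric] mult_ac)
      finally show ?thesis .
    qed simp
    have "ennreal (r ^ (n - 2)) * (\<integral>\<^sup>+w. \<integral>\<^sup>+\<zeta>. ?G w \<zeta> \<eta> r \<partial>lborel \<partial>lborel)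
      \<le> ennreal (q ^ (n - 2)) * (\<integral>\<^sup>+w. ennreal (P * C) * f w \<partial>lborel)"
      using r q by (intro mult_mono ennreal_leI power_mono nn_integral_mono inner) auto
    also have "\<dots> = ennreal (P * C) * (\<integral>\<^sup>+w. ennreal (q ^ (n - 2)) * f w \<partial>lborel)"
      by (simp only: nn_integral_cmult[OF mf] mult.left_commute)
    also have "\<dots> = ennreal (P * C) * (\<integral>\<^sup>+w. indicator {0<..} w * ennreal (2 * w * exp (- w\<^sup>2) * (1 / w) ^ n * q ^ (n - 2) * min 1 ((w / q) ^ (n - 1))) \<partial>lborel)"
    proof -
      have "ennreal (q ^ (n - 2)) * f w = indicator {0<..} w * ennreal (2 * w * exp (- w\<^sup>2) * (1 / w) ^ n * q ^ (n - 2) * min 1 ((w / q) ^ (n - 1)))" for w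
      proof (cases "w > 0")
        case True
        have "ennreal (q ^ (n - 2)) * ennreal (2 * w * exp (- w\<^sup>2) * (1 / w) ^ n * min 1 ((w / q) ^ (n - 1)))
          = ennreal (q ^ (n - 2) * (2 * w * exp (- w\<^sup>2) * (1 / w) ^ n * min 1 ((w / q) ^ (n - 1))))"
          using q True by (intro ennreal_mult[symmetric]) auto
        then show ?thesis using True by (simp add: f_def mult_ac)
      qed (simp add: f_def)
      then show ?thesis by (simp only:)
    qed
    also have "\<dots> \<le> ennreal (P * C) * ennreal (4 * min 1 (1 / q))"
      by (intro mult_left_mono scale_integral_bound q n) auto
    also have "\<dots> \<le> ennreal (P * C) * ennreal (8 / japanese \<eta>)"
    proof (intro mult_left_mono ennreal_leI)
      have j: "japanese \<eta> > 0" by (simp add: japanese_def add_pos_nonneg)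
      show "4 * min 1 (1 / q) \<le> 8 / japanese \<eta>"
      proof (cases "q \<ge> 1")
        case True
        have "1 + (norm \<eta>)\<^sup>2 \<le> 1\<^sup>2 * 4 * q\<^sup>2"
        proof -
          have "1\<^sup>2 \<le> q\<^sup>2" "(norm \<eta>)\<^sup>2 \<le> q\<^sup>2" using True q by (intro power_mono; simp)+
          then show ?thesis by simp
        qed
        then have "japanese \<eta> \<le> sqrt ((2 * q)\<^sup>2)" unfolding japanese_def by (intro real_sqrt_le_mono) (simp add: power_mult_distrib)
        then have "japanese \<eta> \<le> 2 * q" using q by (simp only: real_sqrt_abs)
        then have "4 / q \<le> 8 / japanese \<eta>" using q j by (simp add: field_simps)
        then show ?thesis by (simp add: min_def)
      next
        case False
        have "(norm \<eta>)\<^sup>2 \<le> 1\<^sup>2" using False q by (intro power_mono) auto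
        then have "japanese \<eta> \<le> sqrt (2\<^sup>2)" unfolding japanese_def by (intro real_sqrt_le_mono) simp
        then have "4 \<le> 8 / japanese \<eta>" using j by (simp add: field_simps)
        then show ?thesis by (simp add: min_def)
      qed
    qed auto
    also have "\<dots> = ennreal (8 * P * C / japanese \<eta>)"
      using P C by (subst ennreal_mult[symmetric]) (auto simp: japanese_def mult_ac)
    finally show ?thesis .
  qed
  moreover have "8 * P * C > 0" using P C by simp
  ultimately show ?thesis unfolding n_def by blast
qed

text \<open>The image under \<open>p\<^sup>2\<close> of the measure whose density is the Fourier transform of the weight
  \<open>(1 + \<bar>x\<bar>\<^sup>2)\<^sup>-\<^sup>1\<close>, centred at \<open>\<eta>\<close>, has a bounded density on the line: \<open>O(1 / \<langle>\<eta>\<rangle>)\<close>.\<close>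

lemma kernel_bound:
  assumes dim: "DIM('a) \<ge> 3"
  shows "\<exists>C>0. \<forall>\<eta> G. G \<in> borel_measurable borel \<longrightarrow>
     (\<integral>\<^sup>+w. \<integral>\<^sup>+\<xi>. indicator {0<..} w * ennreal (2 * w * exp (- w\<^sup>2)) * (ennreal (gauss_hat (w\<^sup>2) (\<eta> - \<xi>)) * G ((p \<xi>)\<^sup>2)) \<partial>lborel \<partial>lborel)
     \<le> ennreal (C / japanese \<eta>) * (\<integral>\<^sup>+\<tau>. G \<tau> \<partial>lborel)"
proof -
  define n where "n = DIM('a)"
  have n: "n \<ge> 3" using dim by (simp add: n_def)
  obtain C where C: "C > 0" and K: "\<And>\<eta> r. r > 0 \<Longrightarrow>
     ennreal (r ^ (n - 2)) * (\<integral>\<^sup>+w. \<integral>\<^sup>+\<zeta>. indicator {0<..} w * ennreal (2 * w * exp (- w\<^sup>2))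
        * (indicator shell \<zeta> * ennreal (gauss_hat (w\<^sup>2) (\<eta> - r *\<^sub>R proj \<zeta>))) \<partial>lborel \<partial>lborel)
     \<le> ennreal (C / japanese \<eta>)"
    using shell_kernel_bound[OF dim] unfolding n_def by blast
  have "(\<integral>\<^sup>+w. \<integral>\<^sup>+\<xi>. indicator {0<..} w * ennreal (2 * w * exp (- w\<^sup>2)) * (ennreal (gauss_hat (w\<^sup>2) (\<eta> - \<xi>)) * G ((p \<xi>)\<^sup>2)) \<partial>lborel \<partial>lborel)
     \<le> ennreal (C / japanese \<eta>) * (\<integral>\<^sup>+\<tau>. G \<tau> \<partial>lborel)"
    if [measurable]: "G \<in> borel_measurable borel" for \<eta> G
  proof -
    define \<omega> where "\<omega> w = indicator {0<..} w * ennreal (2 * w * exp (- w\<^sup>2))" for w :: real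
    have [measurable]: "\<omega> \<in> borel_measurable borel" unfolding \<omega>_def[abs_def] by measurable
    have [measurable]: "(\<lambda>x. gauss_hat ((fst x)\<^sup>2) (\<eta> - snd x)) \<in> borel_measurable (lborel \<Otimes>\<^sub>M lborel)"
      unfolding gauss_hat_def by measurable
    have [measurable]: "(\<lambda>x. gauss_hat ((snd x)\<^sup>2) (\<eta> - fst x)) \<in> borel_measurable (lborel \<Otimes>\<^sub>M lborel)"
      unfolding gauss_hat_def by measurable
    define k where "k \<xi> = (\<integral>\<^sup>+w. \<omega> w * ennreal (gauss_hat (w\<^sup>2) (\<eta> - \<xi>)) \<partial>lborel)" for \<xi>
    have [measurable]: "k \<in> borel_measurable borel" unfolding k_def[abs_def] by (simp add: split_beta')
    have "(\<integral>\<^sup>+w. \<integral>\<^sup>+\<xi>. \<omega> w * (ennreal (gauss_hat (w\<^sup>2) (\<eta> - \<xi>)) * G ((p \<xi>)\<^sup>2)) \<partial>lborel \<partial>lborel)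
      = (\<integral>\<^sup>+\<xi>. \<integral>\<^sup>+w. \<omega> w * (ennreal (gauss_hat (w\<^sup>2) (\<eta> - \<xi>)) * G ((p \<xi>)\<^sup>2)) \<partial>lborel \<partial>lborel)"
      by (rule lborel_pair.Fubini') (simp add: split_beta')
    also have "\<dots> = (\<integral>\<^sup>+\<xi>. k \<xi> * G ((p \<xi>)\<^sup>2) \<partial>lborel)"
      unfolding k_def by (intro nn_integral_cong) (simp add: nn_integral_multc[symmetric] mult.assoc gauss_hat_def)
    also have "\<dots> \<le> 2 * (\<integral>\<^sup>+r. \<integral>\<^sup>+\<zeta>. indicator {0<..} r * ennreal (r ^ (n - 1)) * indicator shell \<zeta> * (k (r *\<^sub>R proj \<zeta>) * G ((p (r *\<^sub>R proj \<zeta>))\<^sup>2)) \<partial>lborel \<partial>lborel)"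
      unfolding n_def by (intro polar_inequality) measurable
    also have "\<dots> \<le> 2 * (\<integral>\<^sup>+r. ennreal (C / japanese \<eta>) * (indicator {0<..} r * ennreal r * G (r\<^sup>2)) \<partial>lborel)"
    proof (intro mult_left_mono nn_integral_mono)
      fix r :: real
      show "(\<integral>\<^sup>+\<zeta>. indicator {0<..} r * ennreal (r ^ (n - 1)) * indicator shell \<zeta> * (k (r *\<^sub>R proj \<zeta>) * G ((p (r *\<^sub>R proj \<zeta>))\<^sup>2)) \<partial>lborel)
        \<le> ennreal (C / japanese \<eta>) * (indicator {0<..} r * ennreal r * G (r\<^sup>2))"
      proof (cases "r > 0")
        case True
        have rn: "r ^ (n - Suc 0) = r * r ^ (n - 2)"
        proof -
          have "n - Suc 0 = Suc (n - 2)" using n by simp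
          then show ?thesis by simp
        qed
        have "(\<integral>\<^sup>+\<zeta>. indicator {0<..} r * ennreal (r ^ (n - 1)) * indicator shell \<zeta> * (k (r *\<^sub>R proj \<zeta>) * G ((p (r *\<^sub>R proj \<zeta>))\<^sup>2)) \<partial>lborel)
          = (\<integral>\<^sup>+\<zeta>. (ennreal r * G (r\<^sup>2) * ennreal (r ^ (n - 2))) * (indicator shell \<zeta> * k (r *\<^sub>R proj \<zeta>)) \<partial>lborel)"
          using True p_proj[of _ r] by (intro nn_integral_cong) (auto simp: rn ennreal_mult mult_ac split: split_indicator)
        also have "\<dots> = (ennreal r * G (r\<^sup>2)) * (ennreal (r ^ (n - 2)) * (\<integral>\<^sup>+\<zeta>. indicator shell \<zeta> * k (r *\<^sub>R proj \<zeta>) \<partial>lborel))"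
          by (subst nn_integral_cmult) (auto simp: mult.assoc)
        also have "(\<integral>\<^sup>+\<zeta>. indicator shell \<zeta> * k (r *\<^sub>R proj \<zeta>) \<partial>lborel)
          = (\<integral>\<^sup>+\<zeta>. \<integral>\<^sup>+w. \<omega> w * (indicator shell \<zeta> * ennreal (gauss_hat (w\<^sup>2) (\<eta> - r *\<^sub>R proj \<zeta>))) \<partial>lborel \<partial>lborel)"
          unfolding k_def by (intro nn_integral_cong) (simp add: nn_integral_cmult[symmetric] mult_ac gauss_hat_def)
        also have "\<dots> = (\<integral>\<^sup>+w. \<integral>\<^sup>+\<zeta>. \<omega> w * (indicator shell \<zeta> * ennreal (gauss_hat (w\<^sup>2) (\<eta> - r *\<^sub>R proj \<zeta>))) \<partial>lborel \<partial>lborel)"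
          by (rule lborel_pair.Fubini') (simp add: gauss_hat_def)
        also have "(ennreal r * G (r\<^sup>2)) * (ennreal (r ^ (n - 2)) * \<dots>) \<le> (ennreal r * G (r\<^sup>2)) * ennreal (C / japanese \<eta>)"
          unfolding \<omega>_def by (intro mult_left_mono K True) auto
        also have "\<dots> = ennreal (C / japanese \<eta>) * (indicator {0<..} r * ennreal r * G (r\<^sup>2))"
          using True by (simp add: mult_ac)
        finally show ?thesis .
      qed simp
    qed auto
    also have "\<dots> = ennreal (C / japanese \<eta>) * (\<integral>\<^sup>+r. G (r\<^sup>2) * ennreal (2 * r) * indicator {0<..} r \<partial>lborel)"
    proof -
      have mg: "(\<lambda>r. indicator {0<..} r * ennreal r * G (r\<^sup>2)) \<in> borel_measurable lborel" by measurable
      have "2 * (\<integral>\<^sup>+r. ennreal (C / japanese \<eta>) * (indicator {0<..} r * ennreal r * G (r\<^sup>2)) \<partial>lborel)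
        = ennreal (C / japanese \<eta>) * (\<integral>\<^sup>+r. 2 * (indicator {0<..} r * ennreal r * G (r\<^sup>2)) \<partial>lborel)"
        by (simp only: nn_integral_cmult[OF mg] mult.left_commute)
      moreover have "2 * (indicator {0<..} r * ennreal r * G (r\<^sup>2)) = G (r\<^sup>2) * ennreal (2 * r) * indicator {0<..} r" for r :: real
        by (auto simp: ennreal_mult mult_ac split: split_indicator)
      ultimately show ?thesis by simp
    qed
    also have "\<dots> \<le> ennreal (C / japanese \<eta>) * (\<integral>\<^sup>+\<tau>. G \<tau> \<partial>lborel)"
      by (intro mult_left_mono nn_integral_power2_le) auto
    finally show ?thesis unfolding \<omega>_def .
  qed
  then show ?thesis using C by blast
qed

end

section \<open>The space-time estimate\<close>

lemma gaussian_wave_integrable: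
  assumes a: "a > 0"
  shows "integrable lborel (\<lambda>x::'a::euclidean_space. cis (x \<bullet> \<xi>) * of_real (exp (- a * (norm x)\<^sup>2)))"
  by (rule Bochner_Integration.integrable_bound[OF gaussian_integrable[OF a]]) (auto simp: norm_mult)

lemma space_time_gaussian:
  fixes \<delta> :: "'a::euclidean_space" and \<Delta> :: real
  assumes \<epsilon>: "\<epsilon> > 0" and s: "s > 0"
  shows "integrable lborel (\<lambda>y::real \<times> 'a. exp (- \<epsilon> * (fst y)\<^sup>2) * exp (- s * (norm (snd y))\<^sup>2))"
    and "(LINT y|lborel. cis (fst y * \<Delta> + snd y \<bullet> \<delta>) * of_real (exp (- \<epsilon> * (fst y)\<^sup>2) * exp (- s * (norm (snd y))\<^sup>2)))
      = of_real (gauss_hat \<epsilon> \<Delta> * gauss_hat s \<delta>)"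
proof -
  define f where "f \<Delta> t = cis (t \<bullet> \<Delta>) * of_real (exp (- \<epsilon> * (norm t)\<^sup>2))" for \<Delta> t :: real
  define g where "g \<delta> x = cis (x \<bullet> \<delta>) * of_real (exp (- s * (norm x)\<^sup>2))" for \<delta> x :: 'a
  have i: "integrable lborel (f \<Delta>)" "integrable lborel (g \<delta>)" for \<Delta> \<delta>
    unfolding f_def g_def by (intro gaussian_wave_integrable \<epsilon> s)+
  have eq: "cis (fst y * \<Delta> + snd y \<bullet> \<delta>) * of_real (exp (- \<epsilon> * (fst y)\<^sup>2) * exp (- s * (norm (snd y))\<^sup>2)) = f \<Delta> (fst y) * g \<delta> (snd y)" for y \<Delta> \<delta>
    by (simp add: f_def g_def cis_mult[symmetric])
  have "integrable lborel (\<lambda>y::real \<times> 'a. f 0 (fst y) * g 0 (snd y))"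
    unfolding lborel_prod[symmetric] by (intro lborel_pair.integrable_mult_pair i)
  then have "integrable lborel (\<lambda>y::real \<times> 'a. complex_of_real (exp (- \<epsilon> * (fst y)\<^sup>2) * exp (- s * (norm (snd y))\<^sup>2)))"
    unfolding eq[of _ 0 0, symmetric] by simp
  then show "integrable lborel (\<lambda>y::real \<times> 'a. exp (- \<epsilon> * (fst y)\<^sup>2) * exp (- s * (norm (snd y))\<^sup>2))"
    unfolding complex_of_real_integrable_eq .
  show "(LINT y|lborel. cis (fst y * \<Delta> + snd y \<bullet> \<delta>) * of_real (exp (- \<epsilon> * (fst y)\<^sup>2) * exp (- s * (norm (snd y))\<^sup>2)))
      = of_real (gauss_hat \<epsilon> \<Delta> * gauss_hat s \<delta>)"
    unfolding eq lborel_prod[symmetric] lborel_pair.integral_mult_pair[OF i]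
    unfolding f_def g_def gaussian_fourier(1)[OF \<epsilon>] gaussian_fourier(1)[OF s] by simp
qed

text \<open>The Borel algebra of a product space is a product measure only up to an equation, so the
  projections from it need rules of their own.\<close>

lemma borel_measurable_fst_snd [measurable (raw)]:
  fixes f :: "'c \<Rightarrow> 'a::euclidean_space \<times> 'b::euclidean_space"
  assumes f: "f \<in> borel_measurable M"
  shows "(\<lambda>x. fst (f x)) \<in> borel_measurable M" "(\<lambda>x. snd (f x)) \<in> borel_measurable M"
  by (rule measurable_compose[OF f], intro borel_measurable_continuous_onI continuous_intros)+

context homogeneous_symbol
begin

text \<open>The inverse space-time Fourier transform, without constants, of the density \<open>H\<close> carried by the
  surface \<open>\<tau> = p(\<xi>)\<^sup>2\<close>.\<close>

definition flow :: "('a \<Rightarrow> complex) \<Rightarrow> real \<times> 'a \<Rightarrow> complex" where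
  "flow H y = (LINT \<xi>|lborel. cis (fst y * (p \<xi>)\<^sup>2 + snd y \<bullet> \<xi>) * H \<xi>)"

lemma flow_measurable [measurable]:
  assumes [measurable]: "H \<in> borel_measurable lborel"
  shows "flow H \<in> borel_measurable borel"
proof -
  have "flow H \<in> borel_measurable (lborel :: (real \<times> 'a) measure)"
    unfolding flow_def[abs_def] by measurable
  then show ?thesis by simp
qed

text \<open>For fixed Gaussian weights the kernel of the \<open>T T\<^sup>*\<close> form is a product of Gaussians in
  \<open>p(\<xi>)\<^sup>2 - p(\<xi>')\<^sup>2\<close> and \<open>\<xi> - \<xi>'\<close>. After Schur's test the superposition over \<open>w\<close>
  of the weights in \<open>x\<close> is carried out, and the time cutoff \<open>\<epsilon>\<close> is removed at the end.\<close>

lemma space_time_estimate: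
  assumes dim: "DIM('a) \<ge> 3"
  shows "\<exists>C>0. \<forall>H. integrable lborel H \<longrightarrow>
    nn_L2 lborel (\<lambda>y. of_real (inverse (japanese (snd y))) * flow H y)
      \<le> ennreal C * (\<integral>\<^sup>+\<xi>. ennreal ((norm (H \<xi>))\<^sup>2 / japanese \<xi>) \<partial>lborel)"
proof -
  obtain C where C: "C > 0" and K: "\<And>\<eta> G. G \<in> borel_measurable borel \<Longrightarrow>
     (\<integral>\<^sup>+w. \<integral>\<^sup>+\<xi>. indicator {0<..} w * ennreal (2 * w * exp (- w\<^sup>2)) * (ennreal (gauss_hat (w\<^sup>2) (\<eta> - \<xi>)) * G ((p \<xi>)\<^sup>2)) \<partial>lborel \<partial>lborel)
     \<le> ennreal (C / japanese \<eta>) * (\<integral>\<^sup>+\<tau>. G \<tau> \<partial>lborel)"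
    using kernel_bound[OF dim] by blast
  define \<omega> where "\<omega> w = indicator {0<..} w * ennreal (2 * w * exp (- w\<^sup>2))" for w :: real
  have [measurable]: "\<omega> \<in> borel_measurable borel" unfolding \<omega>_def[abs_def] by measurable
  have j: "japanese \<xi> > 0" for \<xi> :: 'a using japanese_ge_1[of \<xi>] by linarith
  have "nn_L2 lborel (\<lambda>y. of_real (inverse (japanese (snd y))) * flow H y)
      \<le> ennreal (2 * pi * C) * (\<integral>\<^sup>+\<xi>. ennreal ((norm (H \<xi>))\<^sup>2 / japanese \<xi>) \<partial>lborel)"
    if H: "integrable lborel H" for H
    unfolding nn_L2_def
  proof (rule nn_integral_le_of_gaussian_weights[where g="\<lambda>y. (fst y)\<^sup>2"])
    have Hm[measurable]: "H \<in> borel_measurable lborel" using H by auto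
    show "(\<lambda>y::real \<times> 'a. (fst y)\<^sup>2) \<in> borel_measurable lborel" by measurable
    show "(\<lambda>y. ennreal ((norm (of_real (inverse (japanese (snd y))) * flow H y))\<^sup>2)) \<in> borel_measurable lborel"
      by measurable
    fix \<epsilon> :: real assume \<epsilon>: "\<epsilon> > 0"
    define F where "F y = ennreal ((norm (flow H y))\<^sup>2)" for y
    have [measurable]: "F \<in> borel_measurable borel" unfolding F_def[abs_def] by measurable
    define E where "E w y = exp (- \<epsilon> * (fst y)\<^sup>2) * exp (- w\<^sup>2 * (norm (snd y))\<^sup>2)" for w and y :: "real \<times> 'a"
    have [measurable]: "(\<lambda>z. E (fst z) (snd z)) \<in> borel_measurable (borel \<Otimes>\<^sub>M borel)"
      "(\<lambda>z. E (snd z) (fst z)) \<in> borel_measurable (borel \<Otimes>\<^sub>M borel)"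
      unfolding E_def by measurable
    have E0: "E w y \<ge> 0" for w y by (simp add: E_def)
    have Em[measurable]: "E w \<in> borel_measurable borel" for w unfolding E_def[abs_def] by measurable
    define k where "k w \<xi> \<xi>' = gauss_hat \<epsilon> ((p \<xi>)\<^sup>2 - (p \<xi>')\<^sup>2) * gauss_hat (w\<^sup>2) (\<xi> - \<xi>')" for w :: real and \<xi> \<xi>' :: 'a
    let ?k = "\<lambda>w \<xi>. \<integral>\<^sup>+\<xi>'. ennreal (k w \<xi> \<xi>') \<partial>lborel"
    let ?u = "\<lambda>y. ennreal ((norm (of_real (inverse (japanese (snd y))) * flow H y))\<^sup>2)"
    have weight: "ennreal (exp (- \<epsilon> * (fst y)\<^sup>2)) * ?u y
      = (\<integral>\<^sup>+w. \<omega> w * (ennreal (E w y) * F y) \<partial>lborel)" for y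
    proof -
      define A where "A = 1 + (norm (snd y))\<^sup>2"
      have A: "A > 0" by (simp add: A_def add_pos_nonneg)
      have "\<omega> w * (ennreal (E w y) * F y) = (ennreal (exp (- \<epsilon> * (fst y)\<^sup>2)) * F y) * (indicator {0<..} w * ennreal (2 * w * exp (- (w\<^sup>2 * A))))" for w
      proof (cases "w > 0")
        case True
        have "exp (- w\<^sup>2) * exp (- w\<^sup>2 * (norm (snd y))\<^sup>2) = exp (- (w\<^sup>2 * A))"
          by (simp add: A_def exp_add[symmetric] algebra_simps)
        then have "ennreal (2 * w * exp (- w\<^sup>2)) * ennreal (E w y) = ennreal (exp (- \<epsilon> * (fst y)\<^sup>2)) * ennreal (2 * w * exp (- (w\<^sup>2 * A)))"
          using True by (simp add: E_def ennreal_mult[symmetric] mult_ac)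
        then show ?thesis using True by (simp add: \<omega>_def mult_ac)
      qed (simp add: \<omega>_def)
      then have "(\<integral>\<^sup>+w. \<omega> w * (ennreal (E w y) * F y) \<partial>lborel)
        = (ennreal (exp (- \<epsilon> * (fst y)\<^sup>2)) * F y) * ennreal (1 / A)"
        by (simp add: nn_integral_cmult nn_integral_exp_weight[OF A])
      also have "\<dots> = ennreal (exp (- \<epsilon> * (fst y)\<^sup>2)) * ?u y"
      proof -
        have "(norm (of_real (inverse (japanese (snd y))) * flow H y))\<^sup>2 = (norm (flow H y))\<^sup>2 * (1 / A)"
        proof -
          have "(japanese (snd y))\<^sup>2 = A" by (simp add: japanese_def A_def)
          then show ?thesis
            by (simp add: norm_mult norm_inverse power_mult_distrib power_inverse divide_inverse)
        qed
        then have "?u y = F y * ennreal (1 / A)"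
          using A by (simp only: F_def) (intro ennreal_mult, auto)
        then show ?thesis by (simp only: mult.assoc)
      qed
      finally show ?thesis by simp
    qed
    have step: "(\<integral>\<^sup>+y. ennreal (E w y) * F y \<partial>lborel) \<le> (\<integral>\<^sup>+\<xi>. ennreal ((norm (H \<xi>))\<^sup>2) * ?k w \<xi> \<partial>lborel)"
      if w: "w > 0" for w
    proof -
      have w2: "w\<^sup>2 > 0" using w by simp
      have G1: "integrable lborel (E w)"
        unfolding E_def[abs_def] by (rule space_time_gaussian(1)[OF \<epsilon> w2])
      have G2: "(LINT y|lborel. cis (fst y * \<Delta> + snd y \<bullet> \<delta>) * of_real (E w y)) = of_real (gauss_hat \<epsilon> \<Delta> * gauss_hat (w\<^sup>2) \<delta>)" for \<Delta> \<delta>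
        unfolding E_def by (rule space_time_gaussian(2)[OF \<epsilon> w2])
      have \<phi>: "(\<lambda>(y, \<xi>). fst y * (p \<xi>)\<^sup>2 + snd y \<bullet> \<xi>) \<in> borel_measurable ((lborel :: (real \<times> 'a) measure) \<Otimes>\<^sub>M lborel)"
        by measurable
      have ker: "norm (LINT y|lborel. cis ((fst y * (p \<xi>)\<^sup>2 + snd y \<bullet> \<xi>) - (fst y * (p \<xi>')\<^sup>2 + snd y \<bullet> \<xi>')) * of_real (E w y)) = k w \<xi> \<xi>'" for \<xi> \<xi>'
      proof -
        have d: "(fst y * (p \<xi>)\<^sup>2 + snd y \<bullet> \<xi>) - (fst y * (p \<xi>')\<^sup>2 + snd y \<bullet> \<xi>') = fst y * ((p \<xi>)\<^sup>2 - (p \<xi>')\<^sup>2) + snd y \<bullet> (\<xi> - \<xi>')" for y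
          by (simp add: inner_diff_right algebra_simps)
        show ?thesis
          unfolding k_def d G2 norm_of_real by (intro abs_of_nonneg mult_nonneg_nonneg gauss_hat_nonneg \<epsilon> w2)
      qed
      have "(\<integral>\<^sup>+y. ennreal (E w y) * F y \<partial>lborel)
        \<le> (\<integral>\<^sup>+\<xi>. \<integral>\<^sup>+\<xi>'. ennreal (norm (H \<xi>) * norm (H \<xi>') * k w \<xi> \<xi>') \<partial>lborel \<partial>lborel)"
        using weighted_TTstar_bound[OF G1 E0 sigma_finite_lborel \<phi> H]
        unfolding ker F_def flow_def by simp
      also have "\<dots> \<le> (\<integral>\<^sup>+\<xi>. ennreal ((norm (H \<xi>))\<^sup>2) * ?k w \<xi> \<partial>lborel)"
      proof (rule schur_test[OF sigma_finite_lborel Hm])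
        show "case_prod (k w) \<in> borel_measurable (lborel \<Otimes>\<^sub>M lborel)" unfolding k_def by measurable
        show "0 \<le> k w m m'" for m m' unfolding k_def using \<epsilon> w2 by (simp add: gauss_hat_nonneg)
        show "k w m m' = k w m' m" for m m'
          unfolding k_def gauss_hat_def by (simp add: norm_minus_commute power2_commute)
      qed
      finally show ?thesis .
    qed
    have [measurable]: "(\<lambda>z. k (fst z) \<xi> (snd z)) \<in> borel_measurable (borel \<Otimes>\<^sub>M borel)" for \<xi>
      unfolding k_def gauss_hat_def by measurable
    have [measurable]: "(\<lambda>z. k (fst (fst z)) (snd (fst z)) (snd z)) \<in> borel_measurable ((lborel \<Otimes>\<^sub>M lborel) \<Otimes>\<^sub>M lborel)"
      unfolding k_def gauss_hat_def by measurable
    have "(\<integral>\<^sup>+y. ennreal (exp (- \<epsilon> * (fst y)\<^sup>2)) * ?u y \<partial>lborel)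
      = (\<integral>\<^sup>+y. \<integral>\<^sup>+w. \<omega> w * (ennreal (E w y) * F y) \<partial>lborel \<partial>lborel)"
      unfolding weight ..
    also have "\<dots> = (\<integral>\<^sup>+w. \<integral>\<^sup>+y. \<omega> w * (ennreal (E w y) * F y) \<partial>lborel \<partial>lborel)"
      by (rule lborel_pair.Fubini') (simp add: split_beta')
    also have "\<dots> = (\<integral>\<^sup>+w. \<omega> w * (\<integral>\<^sup>+y. ennreal (E w y) * F y \<partial>lborel) \<partial>lborel)"
      by (intro nn_integral_cong nn_integral_cmult) measurable
    also have "\<dots> \<le> (\<integral>\<^sup>+w. \<omega> w * (\<integral>\<^sup>+\<xi>. ennreal ((norm (H \<xi>))\<^sup>2) * ?k w \<xi> \<partial>lborel) \<partial>lborel)"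
    proof (rule nn_integral_mono)
      fix w :: real
      show "\<omega> w * (\<integral>\<^sup>+y. ennreal (E w y) * F y \<partial>lborel) \<le> \<omega> w * (\<integral>\<^sup>+\<xi>. ennreal ((norm (H \<xi>))\<^sup>2) * ?k w \<xi> \<partial>lborel)"
      proof (cases "w > 0")
        case True
        then show ?thesis by (intro mult_left_mono step) simp_all
      qed (simp add: \<omega>_def)
    qed
    also have "\<dots> = (\<integral>\<^sup>+w. \<integral>\<^sup>+\<xi>. \<omega> w * (ennreal ((norm (H \<xi>))\<^sup>2) * ?k w \<xi>) \<partial>lborel \<partial>lborel)"
      by (intro nn_integral_cong nn_integral_cmult[symmetric]) (simp add: k_def gauss_hat_def)
    also have "\<dots> = (\<integral>\<^sup>+\<xi>. \<integral>\<^sup>+w. \<omega> w * (ennreal ((norm (H \<xi>))\<^sup>2) * ?k w \<xi>) \<partial>lborel \<partial>lborel)"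
      by (rule lborel_pair.Fubini') (simp add: split_beta' k_def gauss_hat_def)
    also have "\<dots> \<le> (\<integral>\<^sup>+\<xi>. ennreal (2 * pi * C) * ennreal ((norm (H \<xi>))\<^sup>2 / japanese \<xi>) \<partial>lborel)"
    proof (rule nn_integral_mono)
      fix \<xi> :: 'a
      define G where "G \<tau> = ennreal (gauss_hat \<epsilon> ((p \<xi>)\<^sup>2 - \<tau>))" for \<tau> :: real
      have [measurable]: "G \<in> borel_measurable borel" unfolding G_def[abs_def] by measurable
      have "(\<integral>\<^sup>+w. \<omega> w * (ennreal ((norm (H \<xi>))\<^sup>2) * ?k w \<xi>) \<partial>lborel)
        = (\<integral>\<^sup>+w. ennreal ((norm (H \<xi>))\<^sup>2) * (\<omega> w * ?k w \<xi>) \<partial>lborel)"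
        by (simp only: mult.left_commute)
      also have "\<dots> = ennreal ((norm (H \<xi>))\<^sup>2) * (\<integral>\<^sup>+w. \<omega> w * ?k w \<xi> \<partial>lborel)"
        by (intro nn_integral_cmult) (simp add: split_beta')
      also have "(\<integral>\<^sup>+w. \<omega> w * ?k w \<xi> \<partial>lborel)
        = (\<integral>\<^sup>+w. \<integral>\<^sup>+\<xi>'. \<omega> w * ennreal (k w \<xi> \<xi>') \<partial>lborel \<partial>lborel)"
        by (intro nn_integral_cong nn_integral_cmult[symmetric]) (simp add: k_def gauss_hat_def)
      also have "\<dots> = (\<integral>\<^sup>+w. \<integral>\<^sup>+\<xi>'. indicator {0<..} w * ennreal (2 * w * exp (- w\<^sup>2)) * (ennreal (gauss_hat (w\<^sup>2) (\<xi> - \<xi>')) * G ((p \<xi>')\<^sup>2)) \<partial>lborel \<partial>lborel)"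
      proof (intro nn_integral_cong)
        fix w :: real and \<xi>' :: 'a
        show "\<omega> w * ennreal (k w \<xi> \<xi>') = indicator {0<..} w * ennreal (2 * w * exp (- w\<^sup>2)) * (ennreal (gauss_hat (w\<^sup>2) (\<xi> - \<xi>')) * G ((p \<xi>')\<^sup>2))"
          using \<epsilon> by (cases "w > 0") (auto simp: \<omega>_def k_def G_def ennreal_mult gauss_hat_nonneg mult_ac)
      qed
      also have "\<dots> \<le> ennreal (C / japanese \<xi>) * (\<integral>\<^sup>+\<tau>. G \<tau> \<partial>lborel)" by (rule K) measurable
      also have "(\<integral>\<^sup>+\<tau>. G \<tau> \<partial>lborel) = ennreal (2 * pi)"
        unfolding G_def using gauss_hat_nn_integral[OF \<epsilon>, of "(p \<xi>)\<^sup>2"] by simp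
      also have "ennreal ((norm (H \<xi>))\<^sup>2) * (ennreal (C / japanese \<xi>) * ennreal (2 * pi)) = ennreal (2 * pi * C) * ennreal ((norm (H \<xi>))\<^sup>2 / japanese \<xi>)"
      proof -
        have "(norm (H \<xi>))\<^sup>2 * (C / japanese \<xi> * (2 * pi)) = 2 * pi * C * ((norm (H \<xi>))\<^sup>2 / japanese \<xi>)" by simp
        then show ?thesis using C j[of \<xi>] by (simp add: ennreal_mult[symmetric] less_imp_le)
      qed
      finally show "(\<integral>\<^sup>+w. \<omega> w * (ennreal ((norm (H \<xi>))\<^sup>2) * ?k w \<xi>) \<partial>lborel)
        \<le> ennreal (2 * pi * C) * ennreal ((norm (H \<xi>))\<^sup>2 / japanese \<xi>)"
        by (simp add: mult_left_mono)
    qed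
    also have "\<dots> = ennreal (2 * pi * C) * (\<integral>\<^sup>+\<xi>. ennreal ((norm (H \<xi>))\<^sup>2 / japanese \<xi>) \<partial>lborel)"
      by (intro nn_integral_cmult) measurable
    finally show "(\<integral>\<^sup>+y. ennreal (exp (- \<epsilon> * (fst y)\<^sup>2)) * ?u y \<partial>lborel)
      \<le> ennreal (2 * pi * C) * (\<integral>\<^sup>+\<xi>. ennreal ((norm (H \<xi>))\<^sup>2 / japanese \<xi>) \<partial>lborel)" .
  qed
  moreover have "2 * pi * C > 0" using C by simp
  ultimately show ?thesis by blast
qed

end

section \<open>The smoothing estimate\<close>

context homogeneous_symbol
begin

text \<open>Here \<open>h\<close> is the Fourier transform of \<open>f\<close>, \<open>cut N\<close> its restriction to \<open>\<bar>\<xi>\<bar> \<le> N\<close>, and \<open>U N\<close> the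
  weighted half derivative of the solution with these frequencies. The factor \<open>\<langle>\<xi>\<rangle>\<close> gained in \<open>space_time_estimate\<close>
  cancels the half derivative, so \<open>U N\<close> is a Cauchy sequence, and its limit \<open>V\<close> determines \<open>v\<close>.
  Slices at fixed time converge in \<open>L\<^sup>2\<close> only along a subsequence and for almost every time.\<close>

theorem smoothing_estimate:
  assumes dim: "DIM('a) \<ge> 3"
  shows "\<exists>C>0. \<forall>f. in_L2 lborel f \<longrightarrow>
    (\<exists>v :: real \<times> 'a \<Rightarrow> complex.
       (AE t in lborel. is_function_distr (half_deriv (evolution p t f)) (\<lambda>x. v (t, x))) \<and>
       in_L2 lborel (\<lambda>(t, x). of_real (inverse (japanese x)) * v (t, x)) \<and>
       L2_norm lborel (\<lambda>(t, x). of_real (inverse (japanese x)) * v (t, x)) \<le> C * L2_norm lborel f)"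
proof -
  obtain C0 where C0: "C0 > 0" and space_time: "\<And>H. integrable lborel H \<Longrightarrow>
    nn_L2 lborel (\<lambda>y. of_real (inverse (japanese (snd y))) * flow H y)
      \<le> ennreal C0 * (\<integral>\<^sup>+\<xi>. ennreal ((norm (H \<xi>))\<^sup>2 / japanese \<xi>) \<partial>lborel)"
    using space_time_estimate[OF dim] by blast
  define c where "c = complex_of_real (1 / (2 * pi) ^ DIM('a))"
  define K where "K = ennreal ((norm c)\<^sup>2 * C0)"
  \<comment> \<open>One factor \<open>2\<close> each from \<open>wave_L2_bound\<close> and from the limit defining \<open>V\<close>.\<close>
  define K' where "K' = 4 * ((norm c)\<^sup>2 * C0) * (2 * pi) ^ DIM('a)"
  have K': "K' \<ge> 0" using C0 by (simp add: K'_def)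
  define a where "a \<xi> = japanese \<xi> powr (1/2)" for \<xi> :: 'a
  have [measurable]: "a \<in> borel_measurable borel" unfolding a_def[abs_def] by measurable
  have j: "japanese \<xi> > 0" for \<xi> :: 'a using japanese_ge_1[of \<xi>] by linarith
  have a: "a \<xi> > 0" "(a \<xi>)\<^sup>2 = japanese \<xi>" "a \<xi> \<le> 1 + norm \<xi>" for \<xi> :: 'a
  proof -
    show "a \<xi> > 0" using j[of \<xi>] by (simp add: a_def)
    show "(a \<xi>)\<^sup>2 = japanese \<xi>" using j[of \<xi>] by (simp add: a_def power2_eq_square powr_add[symmetric])
    have "a \<xi> \<le> japanese \<xi> powr 1" unfolding a_def using japanese_ge_1[of \<xi>] by (intro powr_mono) auto
    also have "\<dots> = japanese \<xi>" using j[of \<xi>] by simp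
    also have "\<dots> \<le> sqrt ((1 + norm \<xi>)\<^sup>2)"
      unfolding japanese_def by (intro real_sqrt_le_mono) (simp add: power2_eq_square algebra_simps)
    also have "\<dots> = 1 + norm \<xi>" by simp
    finally show "a \<xi> \<le> 1 + norm \<xi>" .
  qed
  have flow_diff: "flow (\<lambda>\<xi>. H \<xi> - H' \<xi>) y = flow H y - flow H' y" if H: "integrable lborel H" "integrable lborel H'" for H H' y
  proof -
    have "integrable lborel (\<lambda>\<xi>. cis (fst y * (p \<xi>)\<^sup>2 + snd y \<bullet> \<xi>) * H \<xi>)" if "integrable lborel H" for H
    proof -
      have [measurable]: "H \<in> borel_measurable lborel" using that by auto
      show ?thesis by (rule Bochner_Integration.integrable_bound[OF that]) (auto simp: norm_mult)
    qed
    then show ?thesis unfolding flow_def by (simp add: right_diff_distrib H)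
  qed
  have estimate: "nn_L2 lborel (\<lambda>y. of_real (inverse (japanese (snd y))) * (c * flow (\<lambda>\<xi>. of_real (a \<xi>) * g \<xi>) y)) \<le> K * nn_L2 lborel g"
    if g: "integrable lborel (\<lambda>\<xi>. of_real (a \<xi>) * g \<xi>)" for g
  proof -
    have [measurable]: "(\<lambda>\<xi>. of_real (a \<xi>) * g \<xi>) \<in> borel_measurable lborel" using g by auto
    have "nn_L2 lborel (\<lambda>y. of_real (inverse (japanese (snd y))) * (c * flow (\<lambda>\<xi>. of_real (a \<xi>) * g \<xi>) y))
      = nn_L2 lborel (\<lambda>y. c * (of_real (inverse (japanese (snd y))) * flow (\<lambda>\<xi>. of_real (a \<xi>) * g \<xi>) y))"
      by (simp only: mult.left_commute)
    also have "\<dots> = ennreal ((norm c)\<^sup>2) * nn_L2 lborel (\<lambda>y. of_real (inverse (japanese (snd y))) * flow (\<lambda>\<xi>. of_real (a \<xi>) * g \<xi>) y)"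
      by (intro nn_L2_cmult) measurable
    also have "\<dots> \<le> ennreal ((norm c)\<^sup>2) * (ennreal C0 * (\<integral>\<^sup>+\<xi>. ennreal ((norm (of_real (a \<xi>) * g \<xi>))\<^sup>2 / japanese \<xi>) \<partial>lborel))"
      by (intro mult_left_mono space_time g) auto
    also have "(\<lambda>\<xi>. ennreal ((norm (of_real (a \<xi>) * g \<xi>))\<^sup>2 / japanese \<xi>)) = (\<lambda>\<xi>. ennreal ((norm (g \<xi>))\<^sup>2))"
      using j by (auto simp: norm_mult power_mult_distrib a(2) fun_eq_iff less_imp_neq[symmetric])
    finally show ?thesis using C0 by (simp add: K_def nn_L2_def ennreal_mult mult.assoc)
  qed
  have "\<exists>v :: real \<times> 'a \<Rightarrow> complex.
       (AE t in lborel. is_function_distr (half_deriv (evolution p t f)) (\<lambda>x. v (t, x))) \<and>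
       in_L2 lborel (\<lambda>(t, x). of_real (inverse (japanese x)) * v (t, x)) \<and>
       L2_norm lborel (\<lambda>(t, x). of_real (inverse (japanese x)) * v (t, x)) \<le> (sqrt K' + 1) * L2_norm lborel f"
    if f: "in_L2 lborel f" for f
  proof -
    define h where "h = fourier_L2 f"
    have h: "in_L2 lborel h" "nn_L2 lborel h \<le> 2 * (wave_const 1 TYPE('a) * nn_L2 lborel f)"
      unfolding h_def fourier_L2_eq by (intro wave_L2_limit(1) wave_L2_bound f; simp)+
    note [measurable] = h(1)[THEN in_L2_measurable]
    define cut where "cut N = (\<lambda>\<xi>. indicator (cball 0 (real N)) \<xi> *\<^sub>R h \<xi>)" for N
    have cut: "in_L2 lborel (cut N)" "integrable lborel (cut N)" for N
      unfolding cut_def by (intro in_L2_cutoff integrable_cutoff h)+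
    note [measurable] = cut(1)[THEN in_L2_measurable]
    have cut_lim: "(\<lambda>N. nn_L2 lborel (\<lambda>\<xi>. cut N \<xi> - h \<xi>)) \<longlonglongrightarrow> 0"
      unfolding cut_def by (rule filterlim_compose[OF nn_L2_cutoff_tendsto[OF h(1)] filterlim_real_sequentially])
    define H where "H N = (\<lambda>\<xi>. of_real (a \<xi>) * cut N \<xi>)" for N
    have [measurable]: "H N \<in> borel_measurable borel" for N unfolding H_def by measurable
    have Hb: "norm (H N \<xi>) \<le> norm (of_real (1 + real N) * cut N \<xi>)" for N \<xi>
    proof (cases "norm \<xi> \<le> real N")
      case True
      then have "a \<xi> \<le> 1 + real N" using a(3)[of \<xi>] by simp
      then show ?thesis using a(1)[of \<xi>] unfolding H_def norm_mult norm_of_real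
        by (intro mult_right_mono) auto
    qed (simp add: H_def cut_def)
    have H: "integrable lborel (H N)" for N
      by (rule Bochner_Integration.integrable_bound[OF integrable_mult_right[OF cut(2)[of N], of "of_real (1 + real N)"]])
         (auto simp only: intro!: AE_I2 Hb, measurable)
    have HL2: "in_L2 lborel (H N)" for N
    proof -
      have "nn_L2 lborel (H N) \<le> nn_L2 lborel (\<lambda>\<xi>. of_real (1 + real N) * cut N \<xi>)" by (intro nn_L2_mono Hb)
      also have "\<dots> = ennreal ((norm (complex_of_real (1 + real N)))\<^sup>2) * nn_L2 lborel (cut N)" by (intro nn_L2_cmult) measurable
      also have "\<dots> < \<infinity>" using cut(1)[of N] by (simp add: in_L2_iff ennreal_mult_less_top)
      finally show ?thesis by (simp add: in_L2_iff)
    qed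
    define U where "U N y = of_real (inverse (japanese (snd y))) * (c * flow (H N) y)" for N y
    have [measurable]: "U N \<in> borel_measurable borel" for N unfolding U_def[abs_def] by measurable
    have U_diff: "nn_L2 lborel (\<lambda>y. U M y - U N y) \<le> K * nn_L2 lborel (\<lambda>\<xi>. cut M \<xi> - cut N \<xi>)" for M N
    proof -
      have eq: "(\<lambda>\<xi>. of_real (a \<xi>) * (cut M \<xi> - cut N \<xi>)) = (\<lambda>\<xi>. H M \<xi> - H N \<xi>)"
        by (simp add: H_def right_diff_distrib)
      have "(\<lambda>y. U M y - U N y) = (\<lambda>y. of_real (inverse (japanese (snd y))) * (c * flow (\<lambda>\<xi>. H M \<xi> - H N \<xi>) y))"
        by (simp add: U_def flow_diff H right_diff_distrib)
      then show ?thesis using estimate[of "\<lambda>\<xi>. cut M \<xi> - cut N \<xi>"] H unfolding eq by simp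
    qed
    have "\<exists>N. \<forall>m\<ge>N. \<forall>n\<ge>N. nn_L2 lborel (\<lambda>y. U m y - U n y) \<le> ennreal e" if e: "e > 0" for e
    proof -
      have "\<exists>N. \<forall>m\<ge>N. \<forall>n\<ge>N. K * nn_L2 lborel (\<lambda>\<xi>. cut m \<xi> - cut n \<xi>) \<le> ennreal e"
        by (rule scaled_L2_Cauchy[OF _ _ cut_lim _ e]) (auto simp: K_def)
      then show ?thesis using U_diff by (meson order_trans)
    qed
    then obtain V where V[measurable]: "V \<in> borel_measurable lborel"
      and V_lim: "(\<lambda>N. nn_L2 lborel (\<lambda>y. U N y - V y)) \<longlonglongrightarrow> 0"
      using L2_complete[of U lborel] by (auto simp: Ball_def)
    have "nn_L2 lborel (U N) \<le> K * nn_L2 lborel h" for N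
    proof -
      have "nn_L2 lborel (U N) \<le> K * nn_L2 lborel (cut N)"
        using estimate[of "cut N"] H[of N] by (simp add: U_def[abs_def] H_def)
      also have "\<dots> \<le> K * nn_L2 lborel h"
        by (intro mult_left_mono nn_L2_mono) (auto simp: cut_def split: split_indicator)
      finally show ?thesis .
    qed
    then have "nn_L2 lborel V \<le> 2 * (K * nn_L2 lborel h)"
      by (intro nn_L2_limit_le[OF _ _ V_lim]) auto
    also have "\<dots> \<le> 2 * (K * (2 * (wave_const 1 TYPE('a) * nn_L2 lborel f)))"
      by (intro mult_left_mono h) auto
    also have "\<dots> = ennreal K' * nn_L2 lborel f"
    proof -
      have "2 * (K * (2 * wave_const 1 TYPE('a))) = ennreal K'"
      proof -
        have "2 * (ennreal x * (2 * ennreal y)) = ennreal (4 * x * y)" if "x \<ge> 0" "y \<ge> 0" for x y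
          using that by (simp add: ennreal_mult mult.left_commute mult.assoc flip: ennreal_numeral) (simp add: mult.assoc[symmetric] ennreal_mult[symmetric] flip: ennreal_numeral)
        then show ?thesis using C0 by (simp add: K_def K'_def wave_const_def)
      qed
      then show ?thesis by (simp only: mult.assoc[symmetric])
    qed
    finally have V_bound: "nn_L2 lborel V \<le> ennreal K' * nn_L2 lborel f" .
    have VL2: "in_L2 lborel V"
      using V_bound f by (auto simp: in_L2_iff ennreal_mult_less_top elim!: le_less_trans)
    have norm_bound: "L2_norm lborel V \<le> (sqrt K' + 1) * L2_norm lborel f"
    proof -
      have nn: "L2_norm lborel f \<ge> 0" by (simp add: L2_norm_def)
      have "ennreal ((L2_norm lborel V)\<^sup>2) \<le> ennreal (K' * (L2_norm lborel f)\<^sup>2)"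
        using V_bound by (simp add: L2_norm_eq[OF VL2] L2_norm_eq[OF f] ennreal_mult K')
      then have "(L2_norm lborel V)\<^sup>2 \<le> K' * (L2_norm lborel f)\<^sup>2" using K' by (simp add: ennreal_le_iff)
      then have "L2_norm lborel V \<le> sqrt (K' * (L2_norm lborel f)\<^sup>2)" by (rule real_le_rsqrt)
      also have "\<dots> = sqrt K' * L2_norm lborel f" using nn by (simp add: real_sqrt_mult)
      also have "\<dots> \<le> (sqrt K' + 1) * L2_norm lborel f" using nn by (simp add: mult_right_mono)
      finally show ?thesis .
    qed
    define v where "v y = of_real (japanese (snd y)) * V y" for y
    have vV: "of_real (inverse (japanese x)) * v (t, x) = V (t, x)" for t x
      using j[of x] by (simp add: v_def)
    have "AE t in lborel. is_function_distr (half_deriv (evolution p t f)) (\<lambda>x. v (t, x))"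
    proof -
      define D where "D N t = nn_L2 lborel (\<lambda>x. U N (t, x) - V (t, x))" for N t
      have [measurable]: "V \<in> borel_measurable (lborel \<Otimes>\<^sub>M lborel)" "U N \<in> borel_measurable (lborel \<Otimes>\<^sub>M lborel)" for N
        by (simp_all add: lborel_prod)
      have [measurable]: "D N \<in> borel_measurable lborel" for N unfolding D_def[abs_def] nn_L2_def by measurable
      have "(\<integral>\<^sup>+t. D N t \<partial>lborel) = nn_L2 lborel (\<lambda>y. U N y - V y)" for N
        unfolding D_def nn_L2_def by (subst lborel.nn_integral_fst) (auto simp: lborel_prod)
      with V_lim have "(\<lambda>N. \<integral>\<^sup>+t. D N t \<partial>lborel) \<longlonglongrightarrow> 0" by simp
      then obtain r where r: "filterlim r at_top sequentially" "AE t in lborel. (\<lambda>k. D (r k) t) \<longlonglongrightarrow> 0"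
        using nn_integral_tendsto_0_AE_subseq[of D lborel] by auto
      have "(\<integral>\<^sup>+t. nn_L2 lborel (\<lambda>x. V (t, x)) \<partial>lborel) = nn_L2 lborel V"
        unfolding nn_L2_def by (subst lborel.nn_integral_fst) (auto simp: lborel_prod)
      then have "AE t in lborel. nn_L2 lborel (\<lambda>x. V (t, x)) \<noteq> \<infinity>"
        using VL2 by (intro nn_integral_PInf_AE) (auto simp: nn_L2_def in_L2_iff)
      with r(2) show ?thesis
      proof eventually_elim
        case (elim t)
        have Vt: "in_L2 lborel (\<lambda>x. V (t, x))"
          using elim(2) by (auto simp: in_L2_iff less_top)
        define e where "e \<xi> = exp (\<i> * of_real (t * (p \<xi>)\<^sup>2))" for \<xi>
        have e_cis: "e \<xi> = cis (t * (p \<xi>)\<^sup>2)" for \<xi> by (simp add: e_def cis_conv_exp)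
        have [measurable]: "e \<in> borel_measurable borel" unfolding e_cis[abs_def] by measurable
        have ne: "norm (e \<xi>) = 1" for \<xi> by (simp add: e_cis)
        have eL2: "in_L2 lborel (\<lambda>\<xi>. e \<xi> * g \<xi>)" if "in_L2 lborel g" for g
          using that by (auto simp: in_L2_iff nn_L2_def norm_mult ne)
        define w where "w k x = c * wave_integral 1 (\<lambda>\<xi>. e \<xi> * H (r k) \<xi>) x" for k x
        have ieH: "integrable lborel (\<lambda>\<xi>. e \<xi> * H N \<xi>)" for N
          by (rule Bochner_Integration.integrable_bound[OF H[of N]]) (auto simp: norm_mult ne)
        have Uw: "U (r k) (t, x) = of_real (inverse (japanese x)) * w k x" for k x
          by (simp add: U_def w_def flow_def wave_integral_def e_cis inner_commute mult.assoc[symmetric] cis_mult add.commute)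
        have Ut: "in_L2 lborel (\<lambda>x. U (r k) (t, x))" for k
        proof -
          have "nn_L2 lborel (\<lambda>x. U (r k) (t, x)) \<le> nn_L2 lborel (w k)"
            unfolding Uw
          proof (rule nn_L2_mono)
            fix x :: 'a
            have "norm (complex_of_real (inverse (japanese x))) \<le> 1"
              unfolding norm_of_real using japanese_ge_1[of x] by (simp add: inverse_le_1_iff)
            then show "norm (of_real (inverse (japanese x)) * w k x) \<le> norm (w k x)"
              unfolding norm_mult by (intro mult_left_le_one_le) auto
          qed
          also have "\<dots> \<le> wave_const c TYPE('a) * nn_L2 lborel (\<lambda>\<xi>. e \<xi> * H (r k) \<xi>)"
            unfolding w_def by (intro plancherel_const_le ieH) simp
          also have "\<dots> < \<infinity>" using eL2[OF HL2, of "r k"] by (simp add: in_L2_iff wave_const_def ennreal_mult_less_top)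
          finally show ?thesis by (simp add: in_L2_iff)
        qed
        have Ut_lim: "(\<lambda>k. nn_L2 lborel (\<lambda>x. U (r k) (t, x) - V (t, x))) \<longlonglongrightarrow> 0"
          using elim(1) by (simp add: D_def)
        have g: "in_L2 lborel (\<lambda>\<xi>. e \<xi> * h \<xi>)" by (rule eL2[OF h(1)])
        have evol: "evolution p t f = inv_fourier_L2 (\<lambda>\<xi>. e \<xi> * h \<xi>)"
          by (simp add: evolution_def multiplier_def h_def e_def)
        have evol_hat: "AE \<xi> in lborel. fourier_L2 (evolution p t f) \<xi> = e \<xi> * h \<xi>"
          unfolding evol by (rule fourier_inversion[OF g])
        have "in_L2 lborel (evolution p t f)"
          unfolding evol inv_fourier_L2_eq by (intro wave_L2_limit(1) g) simp
        then have "in_L2 lborel (fourier_L2 (evolution p t f))"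
          unfolding fourier_L2_eq by (intro wave_L2_limit(1)) auto
        note [measurable] = this[THEN in_L2_measurable]
        show ?case
          unfolding is_function_distr_def
        proof (intro conjI allI impI)
          fix X :: "'a set" assume X: "compact X"
          have "continuous_on UNIV (\<lambda>x::'a. complex_of_real (japanese x))"
            unfolding japanese_def by (intro continuous_intros)
          from L2_mult_integrable[OF Vt in_L2_continuous_compact[OF this X]]
          show "set_integrable lborel X (\<lambda>x. v (t, x))"
            unfolding set_integrable_def by (simp add: v_def mult.commute)
        next
          fix \<phi> :: "'a \<Rightarrow> complex" assume \<phi>: "test_function \<phi>"
          note \<phi>L2 = test_function_L2[OF \<phi>] and \<phi>w = test_function_fourier_weighted[OF \<phi>, folded a_def]
          note [measurable] = \<phi>w[THEN in_L2_measurable]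
          let ?w = "\<lambda>\<xi>. of_real (a \<xi>) * inv_fourier_integral \<phi> \<xi>"
          have "half_deriv (evolution p t f) \<phi> = (LINT \<xi>|lborel. fourier_L2 (evolution p t f) \<xi> * ?w \<xi>)"
            by (simp add: half_deriv_def multiplier_distr_def a_def mult_ac)
          also have "\<dots> = (LINT \<xi>|lborel. (e \<xi> * h \<xi>) * ?w \<xi>)"
          proof (rule integral_cong_AE)
            show "(\<lambda>\<xi>. fourier_L2 (evolution p t f) \<xi> * ?w \<xi>) \<in> borel_measurable lborel"
              "(\<lambda>\<xi>. (e \<xi> * h \<xi>) * ?w \<xi>) \<in> borel_measurable lborel" by measurable
            show "AE \<xi> in lborel. fourier_L2 (evolution p t f) \<xi> * ?w \<xi> = (e \<xi> * h \<xi>) * ?w \<xi>"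
              using evol_hat by eventually_elim simp
          qed
          finally have lhs: "half_deriv (evolution p t f) \<phi> = (LINT \<xi>|lborel. (e \<xi> * h \<xi>) * ?w \<xi>)" .
          have lim1: "(\<lambda>k. LINT \<xi>|lborel. (e \<xi> * cut (r k) \<xi>) * ?w \<xi>) \<longlonglongrightarrow> (LINT \<xi>|lborel. (e \<xi> * h \<xi>) * ?w \<xi>)"
          proof (rule L2_pairing_tendsto[OF eL2[OF cut(1)] g \<phi>w])
            have "nn_L2 lborel (\<lambda>\<xi>. e \<xi> * cut N \<xi> - e \<xi> * h \<xi>) = nn_L2 lborel (\<lambda>\<xi>. cut N \<xi> - h \<xi>)" for N
              unfolding nn_L2_def by (simp add: norm_mult ne flip: right_diff_distrib)
            then show "(\<lambda>k. nn_L2 lborel (\<lambda>\<xi>. e \<xi> * cut (r k) \<xi> - e \<xi> * h \<xi>)) \<longlonglongrightarrow> 0"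
              using filterlim_compose[OF cut_lim r(1)] by simp
          qed
          have lim2: "(\<lambda>k. LINT x|lborel. U (r k) (t, x) * (of_real (japanese x) * \<phi> x)) \<longlonglongrightarrow> (LINT x|lborel. V (t, x) * (of_real (japanese x) * \<phi> x))"
            by (rule L2_pairing_tendsto[OF Ut Vt \<phi>L2(3) Ut_lim])
          \<comment> \<open>For truncated frequencies the pairing is the multiplication formula; the weight is moved to \<open>\<phi>\<close>.\<close>
          have eq: "(LINT \<xi>|lborel. (e \<xi> * cut (r k) \<xi>) * ?w \<xi>) = (LINT x|lborel. U (r k) (t, x) * (of_real (japanese x) * \<phi> x))" for k
          proof -
            have "(LINT \<xi>|lborel. (e \<xi> * cut (r k) \<xi>) * ?w \<xi>) = (LINT \<xi>|lborel. c * ((e \<xi> * H (r k) \<xi>) * wave_integral 1 \<phi> \<xi>))"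
              by (simp add: H_def inv_fourier_integral_eq c_def mult_ac)
            also have "\<dots> = c * (LINT x|lborel. wave_integral 1 (\<lambda>\<xi>. e \<xi> * H (r k) \<xi>) x * \<phi> x)"
              by (simp only: integral_mult_right_zero wave_integral_exchange[OF ieH \<phi>L2(2)])
            also have "\<dots> = (LINT x|lborel. w k x * \<phi> x)"
              by (simp only: w_def mult.assoc integral_mult_right_zero)
            also have "(\<lambda>x. w k x * \<phi> x) = (\<lambda>x. U (r k) (t, x) * (of_real (japanese x) * \<phi> x))"
              using j by (auto simp: Uw fun_eq_iff less_imp_neq[symmetric])
            finally show ?thesis .
          qed
          have "half_deriv (evolution p t f) \<phi> = (LINT x|lborel. V (t, x) * (of_real (japanese x) * \<phi> x))"
            unfolding lhs using LIMSEQ_unique[OF lim1[unfolded eq] lim2] .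
          then show "half_deriv (evolution p t f) \<phi> = (LINT x|lborel. v (t, x) * \<phi> x)"
            by (simp add: v_def mult_ac)
        qed
      qed
    qed
    moreover have "(\<lambda>(t, x). of_real (inverse (japanese x)) * v (t, x)) = V"
    proof (rule ext)
      fix y :: "real \<times> 'a"
      show "(case y of (t, x) \<Rightarrow> of_real (inverse (japanese x)) * v (t, x)) = V y"
        by (cases y) (simp only: prod.case vV)
    qed
    ultimately show ?thesis using VL2 norm_bound by (intro exI[of _ v]) simp
  qed
  moreover have "sqrt K' + 1 > 0" using K' by (simp add: add_nonneg_pos)
  ultimately show ?thesis by blast
qed

end

theorem theorem4p2:
  fixes p :: "real ^ 'n \<Rightarrow> real"
  assumes "CARD('n) \<ge> 3"
    and "smooth_on (- {0}) p"
    and "\<And>\<xi>. \<xi> \<noteq> 0 \<Longrightarrow> p \<xi> > 0"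
    and "\<And>l \<xi>. l > 0 \<Longrightarrow> \<xi> \<noteq> 0 \<Longrightarrow> p (l *\<^sub>R \<xi>) = l * p \<xi>"
    and "\<And>\<xi>. \<xi> \<noteq> 0 \<Longrightarrow> p \<xi> = 1 \<Longrightarrow> gaussian_curvature p \<xi> \<noteq> 0"
  shows "\<exists>C>0. \<forall>f. in_L2 lborel f \<longrightarrow>
    (\<exists>v :: real \<times> (real ^ 'n) \<Rightarrow> complex.
       (AE t in lborel. is_function_distr (half_deriv (evolution p t f)) (\<lambda>x. v (t, x))) \<and>
       in_L2 lborel (\<lambda>(t, x). of_real (inverse (japanese x)) * v (t, x)) \<and>
       L2_norm lborel (\<lambda>(t, x). of_real (inverse (japanese x)) * v (t, x)) \<le> C * L2_norm lborel f)"
proof -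
  interpret homogeneous_symbol p
  proof
    have "Ck_on 0 (- {0}) p" using assms(2) unfolding smooth_on_def by blast
    then show "continuous_on (- {0}) p" by simp
  qed (use assms in auto)
  show ?thesis using assms(1) by (intro smoothing_estimate) simp
qed

end
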